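(* For all $g,k,r\in\mathbb{N}$, every $(g,k)$-planar graph $G$ satisfies $\operatorname{cw}_r(G)\leq (4g+6)(k+1)(8r+1)$.
   Context: All graphs are finite, simple and undirected; $\mathbb{N}=\{1,2,\dots\}$. A graph $G$ is $(g,k)$-planar if for some surface $\Sigma$ of Euler genus at most $g$, $G$ has a drawing on $\Sigma$ in which every edge is involved in at most $k$ crossings. Cop-width game with radius $r$ and width $m$ on $G$: initially the cops occupy a set $C_0\subseteq V(G)$ with $|C_0|\le m$ and the robber chooses a vertex $x_0$. In each round $i\ge1$, the cops announce a new set $C_i\subseteq V(G)$ with $|C_i|\le m$; the robber, knowing $C_i$, moves from $x_{i-1}$ to a vertex $x_i$ along a path in $G$ of length at most $r$ containing no vertex of $C_{i-1}\cap C_i$. The robber is caught if $x_i\in C_i$. The radius-$r$ cop-width $\operatorname{cw}_r(G)$ is the least $m\in\mathbb{N}$ such that the cops can guarantee capture in finitely many rounds. *)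

theory Defs
  imports "HOL-Analysis.Analysis"
begin

section \<open>Graphs\<close>

definition simple_graph :: "'a set \<Rightarrow> 'a set set \<Rightarrow> bool" where
  "simple_graph V E \<longleftrightarrow> finite V \<and> (\<forall>e\<in>E. e \<subseteq> V \<and> card e = 2)"

definition graph_path :: "'a set \<Rightarrow> 'a set set \<Rightarrow> 'a list \<Rightarrow> bool" where
  "graph_path V E p \<longleftrightarrow>
     p \<noteq> [] \<and> distinct p \<and> set p \<subseteq> V \<and> (\<forall>i. Suc i < length p \<longrightarrow> {p ! i, p ! Suc i} \<in> E)"

section \<open>Surfaces and Euler genus\<close>

definition closed_surface :: "'p topology \<Rightarrow> bool" where
  "closed_surface X \<longleftrightarrow>
     topspace X \<noteq> {} \<and> compact_space X \<and> connected_space X \<and> Hausdorff_space X \<and>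
     (\<forall>x\<in>topspace X. \<exists>U. openin X U \<and> x \<in> U \<and>
        subtopology X U homeomorphic_space (euclidean :: (real^2) topology))"

text \<open>The library's simplicial complexes contain the empty face, as a simplex of dimension
  \<open>-1\<close>; it is not counted here.\<close>

definition euler_char_2 :: "'n::euclidean_space set set \<Rightarrow> int" where
  "euler_char_2 K =
     int (card {S\<in>K. 0 simplex S}) - int (card {S\<in>K. 1 simplex S}) + int (card {S\<in>K. 2 simplex S})"

text \<open>The Euler genus is \<open>2 - \<chi>\<close>, with the Euler characteristic \<open>\<chi>\<close> read off a triangulation.
  Every closed surface has a triangulation (Rado), every finite two-dimensional
  simplicial complex can be realised with straight simplices in five-dimensional Euclidean space,
  and \<open>\<chi>\<close> does not depend on the triangulation, so exactly one \<open>\<gamma>\<close> is related to each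
  closed surface.\<close>

definition has_euler_genus :: "'p topology \<Rightarrow> nat \<Rightarrow> bool" where
  "has_euler_genus X \<gamma> \<longleftrightarrow>
     (\<exists>K :: (real^5) set set. simplicial_complex K \<and>
        X homeomorphic_space top_of_set (\<Union>K) \<and> int \<gamma> = 2 - euler_char_2 K)"

section \<open>Drawings\<close>

definition edge_interior :: "('a set \<Rightarrow> real \<Rightarrow> 'p) \<Rightarrow> 'a set \<Rightarrow> 'p set" where
  "edge_interior c e = c e ` {0<..<1}"

text \<open>\<open>\<pi>\<close> places the vertices and \<open>c e\<close> is the curve of the edge \<open>e\<close>, traversed in either
  direction. As usual, an edge is drawn as a simple arc and meets no vertex other than its ends,
  and no three edges cross at a single point.\<close>

definition drawing ::
  "'p topology \<Rightarrow> 'a set \<Rightarrow> 'a set set \<Rightarrow> ('a \<Rightarrow> 'p) \<Rightarrow> ('a set \<Rightarrow> real \<Rightarrow> 'p) \<Rightarrow> bool" where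
  "drawing X V E \<pi> c \<longleftrightarrow>
     inj_on \<pi> V \<and> \<pi> ` V \<subseteq> topspace X \<and>
     (\<forall>e\<in>E. pathin X (c e) \<and> inj_on (c e) {0..1} \<and> {c e 0, c e 1} = \<pi> ` e \<and>
            edge_interior c e \<inter> \<pi> ` V = {}) \<and>
     (\<forall>e\<in>E. \<forall>f\<in>E. e \<noteq> f \<longrightarrow> finite (edge_interior c e \<inter> edge_interior c f)) \<and>
     (\<forall>e\<in>E. \<forall>f\<in>E. \<forall>h\<in>E. e \<noteq> f \<and> f \<noteq> h \<and> e \<noteq> h \<longrightarrow>
            edge_interior c e \<inter> edge_interior c f \<inter> edge_interior c h = {})"

text \<open>A crossing is a common interior point of two distinct edges.\<close>

definition crossings :: "'a set set \<Rightarrow> ('a set \<Rightarrow> real \<Rightarrow> 'p) \<Rightarrow> 'a set \<Rightarrow> ('a set \<times> 'p) set" where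
  "crossings E c e = (SIGMA f : E - {e}. edge_interior c e \<inter> edge_interior c f)"

text \<open>The type argument is the type of points of the surface. A statement with a free type
  variable in this place covers surfaces over every type.\<close>

definition gk_planar :: "'p itself \<Rightarrow> nat \<Rightarrow> nat \<Rightarrow> 'a set \<Rightarrow> 'a set set \<Rightarrow> bool" where
  "gk_planar T g k V E \<longleftrightarrow>
     (\<exists>(X :: 'p topology) \<gamma> \<pi> c.
        closed_surface X \<and> has_euler_genus X \<gamma> \<and> \<gamma> \<le> g \<and>
        drawing X V E \<pi> c \<and> (\<forall>e\<in>E. card (crossings E c e) \<le> k))"

section \<open>Cop-width\<close>

definition robber_move ::
  "'a set \<Rightarrow> 'a set set \<Rightarrow> nat \<Rightarrow> 'a set \<Rightarrow> 'a set \<Rightarrow> 'a \<Rightarrow> 'a \<Rightarrow> bool" where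
  "robber_move V E r C C' x y \<longleftrightarrow>
     (\<exists>p. graph_path V E p \<and> hd p = x \<and> last p = y \<and> length p - 1 \<le> r \<and> set p \<inter> (C \<inter> C') = {})"

text \<open>A cop strategy \<open>\<sigma>\<close> maps the list of robber positions so far to the next set of cops. If the
  robber visits \<open>x 0, x 1, \<dots>\<close>, the cops occupy \<open>cop_position \<sigma> x i = \<sigma> [x 0, \<dots>, x (i - 1)]\<close> in
  round \<open>i\<close>, and \<open>\<sigma> []\<close> initially. A robber who has not been caught can always stay where he is,
  so only infinite sequences of moves need to be considered.\<close>

definition cop_position :: "('a list \<Rightarrow> 'a set) \<Rightarrow> (nat \<Rightarrow> 'a) \<Rightarrow> nat \<Rightarrow> 'a set" where
  "cop_position \<sigma> x i = \<sigma> (map x [0..<i])"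

definition robber_play ::
  "'a set \<Rightarrow> 'a set set \<Rightarrow> nat \<Rightarrow> ('a list \<Rightarrow> 'a set) \<Rightarrow> (nat \<Rightarrow> 'a) \<Rightarrow> bool" where
  "robber_play V E r \<sigma> x \<longleftrightarrow>
     x 0 \<in> V \<and>
     (\<forall>i. robber_move V E r (cop_position \<sigma> x i) (cop_position \<sigma> x (Suc i)) (x i) (x (Suc i)))"

definition cops_win :: "'a set \<Rightarrow> 'a set set \<Rightarrow> nat \<Rightarrow> nat \<Rightarrow> bool" where
  "cops_win V E r m \<longleftrightarrow>
     (\<exists>\<sigma>. (\<forall>h. \<sigma> h \<subseteq> V \<and> card (\<sigma> h) \<le> m) \<and>
          (\<forall>x. robber_play V E r \<sigma> x \<longrightarrow> (\<exists>i. x i \<in> cop_position \<sigma> x i)))"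

definition cop_width :: "'a set \<Rightarrow> 'a set set \<Rightarrow> nat \<Rightarrow> nat" where
  "cop_width V E r = (LEAST m. 1 \<le> m \<and> cops_win V E r m)"

text \<open>The minimum is over a nonempty set: \<open>card V\<close> cops catch the robber at once.\<close>

lemma cops_win_card: "cops_win V E r (card V)"
  unfolding cops_win_def robber_play_def cop_position_def
  by (rule exI[of _ "\<lambda>_. V"]) auto

end

theory Submission
  imports Defs
begin

text \<open>The planarisation of the drawing is a graph embedded in the surface. In a fine enough triangulation
  of the surface, disjoint connected pieces of the drawing occupy disjoint connected sets of vertices,
  so the vertices of the triangulation can be partitioned into connected parts, one for each vertex of
  the planarisation, with adjacent parts for adjacent vertices.

  Let \<open>D\<close> be the breadth-first level in the quotient graph and choose a spanning tree of the
  triangulation along whose root paths each level meets only one part. The dual graph without the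
  duals of tree edges is connected; a spanning tree of it leaves at most \<open>g\<close> further edges \<open>X\<close>. For an
  edge \<open>e\<close> of this dual tree, the root paths from the ends of \<open>e\<close> and of \<open>X\<close> separate the two sides of
  \<open>e\<close>, because a cycle space argument modulo 2 shows that the boundary of a side lies on these paths.
  The cops descend the dual tree towards the robber. At a triangle they guard the root paths of its
  three vertices and of the ends of \<open>X\<close>, at most \<open>2g + 3\<close> paths, and only on the levels within
  \<open>2r(k + 1)\<close> of the robber; a crossing point is guarded by one end of each of its two edges.\<close>

text \<open>The planarisation may be disconnected and its faces need not be discs, so the argument
  with two trees runs on a triangulation. A fine triangulation has unbounded size, so distances are
  counted in the quotient: an edge of the graph passes at most \<open>k\<close> crossings and
  changes the level by at most \<open>k + 1\<close>, a move of the robber by at most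
  \<open>r (k + 1)\<close>. The window is twice as wide because a guard is announced one move before
  the move on which it has to hold. It meets a root path in at most \<open>4 r (k + 1) + 1\<close>
  parts; two cops per part on \<open>2 g + 3\<close> paths give
  \<open>2 (2 g + 3) (4 r (k + 1) + 1)\<close> cops. Only cops present before and after a move block
  it; the separators of adjacent triangles of the dual tree share the root paths from their common
  edge, and these stay guarded during the change. The surface is never cut along a curve: separation
  is a parity statement about edges. Topology enters where a triangulated closed surface is shown to
  be a combinatorial one, mainly by invariance of domain, and where connected pieces of the drawing
  are replaced by sets of vertices.\<close>

section \<open>Rooted trees\<close>

text \<open>For symmetric \<open>R\<close> this is connectedness of the subgraph induced on \<open>A\<close>.\<close>

definition conn :: "('b \<Rightarrow> 'b \<Rightarrow> bool) \<Rightarrow> 'b set \<Rightarrow> bool" where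
  "conn R A \<longleftrightarrow> (\<forall>B. B \<subseteq> A \<longrightarrow> B \<noteq> {} \<longrightarrow> (\<forall>x\<in>B. \<forall>y\<in>A. R x y \<longrightarrow> y \<in> B) \<longrightarrow> B = A)"

lemma connI:
  "(\<And>B. B \<subseteq> A \<Longrightarrow> B \<noteq> {} \<Longrightarrow> (\<And>x y. x \<in> B \<Longrightarrow> y \<in> A \<Longrightarrow> R x y \<Longrightarrow> y \<in> B) \<Longrightarrow> B = A) \<Longrightarrow> conn R A"
  unfolding conn_def by blast

lemma connD:
  "conn R A \<Longrightarrow> B \<subseteq> A \<Longrightarrow> B \<noteq> {} \<Longrightarrow> (\<And>x y. x \<in> B \<Longrightarrow> y \<in> A \<Longrightarrow> R x y \<Longrightarrow> y \<in> B) \<Longrightarrow> B = A"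
  unfolding conn_def by blast

lemma conn_rtrancl:
  assumes "conn R A" "x \<in> A" "y \<in> A"
  shows "(x, y) \<in> {(u, v). u \<in> A \<and> v \<in> A \<and> R u v}\<^sup>*"
proof -
  let ?N = "{(u, v). u \<in> A \<and> v \<in> A \<and> R u v}"
  have "{z \<in> A. (x, z) \<in> ?N\<^sup>*} = A"
  proof (rule connD[OF assms(1)])
    fix u v assume "u \<in> {z \<in> A. (x, z) \<in> ?N\<^sup>*}" "v \<in> A" "R u v"
    then show "v \<in> {z \<in> A. (x, z) \<in> ?N\<^sup>*}"
      by (auto intro: rtrancl_into_rtrancl)
  qed (use assms in auto)
  then show ?thesis using assms by blast
qed

text \<open>\<open>par y\<close> is the second vertex of a shortest \<open>N\<close>-walk from
  \<open>y\<close> to \<open>rt\<close>, and \<open>d\<close> is the length of such a walk.\<close>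

lemma ex_parent:
  assumes "\<And>y. y \<in> W \<Longrightarrow> (y, rt) \<in> N\<^sup>*"
  shows "\<exists>par d. \<forall>y\<in>W. y \<noteq> rt \<longrightarrow> (y, par y) \<in> N \<and> d (par y) < (d y :: nat)"
proof -
  define d where "d y = (LEAST n. (y, rt) \<in> N ^^ n)" for y
  have "\<exists>z. (y, z) \<in> N \<and> d z < d y" if "y \<in> W" "y \<noteq> rt" for y
  proof -
    have "\<exists>n. (y, rt) \<in> N ^^ n"
      using assms[OF that(1)] by (simp add: rtrancl_power)
    then have dy: "(y, rt) \<in> N ^^ d y" unfolding d_def by (rule LeastI_ex)
    with that(2) obtain m where m: "d y = Suc m" by (cases "d y") auto
    with dy obtain z where z: "(y, z) \<in> N" "(z, rt) \<in> N ^^ m"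
      by (metis relpow_Suc_D2)
    have "d z \<le> m" unfolding d_def by (rule Least_le) (rule z(2))
    with z m show ?thesis by auto
  qed
  then show ?thesis by metis
qed

text \<open>The rank \<open>d\<close> need not be the depth; it only has to drop from a vertex to
  its parent, which excludes cycles and makes every root path end. The locale serves both for the
  spanning tree on vertices and for the dual tree on triangles.\<close>

locale rooted_tree =
  fixes W :: "'b set" and rt :: 'b and par :: "'b \<Rightarrow> 'b" and d :: "'b \<Rightarrow> nat"
  assumes root_in: "rt \<in> W"
    and par_in: "v \<in> W \<Longrightarrow> v \<noteq> rt \<Longrightarrow> par v \<in> W"
    and d_par: "v \<in> W \<Longrightarrow> v \<noteq> rt \<Longrightarrow> d (par v) < d v"
begin

definition up :: "'b \<Rightarrow> 'b set" where
  "up v = {u. (v, u) \<in> {(y, par y) |y. y \<in> W \<and> y \<noteq> rt}\<^sup>*}"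

definition UP :: "'b set \<Rightarrow> 'b set" where
  "UP S = (\<Union>v\<in>S. up v)"

definition tree_edges :: "'b set set" where
  "tree_edges = {{v, par v} |v. v \<in> W \<and> v \<noteq> rt}"

lemma up_refl [simp]: "v \<in> up v"
  by (simp add: up_def)

lemma subset_UP: "S \<subseteq> UP S"
  unfolding UP_def using up_refl by blast

lemma UP_mono: "S \<subseteq> S' \<Longrightarrow> UP S \<subseteq> UP S'"
  unfolding UP_def by blast

lemma UP_par: "v \<in> UP S \<Longrightarrow> v \<in> W \<Longrightarrow> v \<noteq> rt \<Longrightarrow> par v \<in> UP S"
  unfolding UP_def up_def by (auto intro: rtrancl_into_rtrancl)

lemma up_root: "up rt = {rt}"
  unfolding up_def by (auto elim: converse_rtranclE)

lemma up_step: "v \<in> W \<Longrightarrow> v \<noteq> rt \<Longrightarrow> up v = insert v (up (par v))"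
proof -
  let ?N = "{(y, par y) |y. y \<in> W \<and> y \<noteq> rt}"
  assume v: "v \<in> W" "v \<noteq> rt"
  have "(v, u) \<in> ?N\<^sup>* \<longleftrightarrow> u = v \<or> (par v, u) \<in> ?N\<^sup>*" for u
  proof
    assume "(v, u) \<in> ?N\<^sup>*"
    then show "u = v \<or> (par v, u) \<in> ?N\<^sup>*" by (cases rule: converse_rtranclE) auto
  next
    have step: "(v, par v) \<in> ?N" using v by blast
    assume "u = v \<or> (par v, u) \<in> ?N\<^sup>*"
    then show "(v, u) \<in> ?N\<^sup>*"
    proof
      assume "(par v, u) \<in> ?N\<^sup>*"
      with step show ?thesis by (rule converse_rtrancl_into_rtrancl)
    qed simp
  qed
  then show ?thesis unfolding up_def by blast
qed

lemma tree_induct [consumes 1, case_names rt step]: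
  assumes "v \<in> W" "P rt" "\<And>v. v \<in> W \<Longrightarrow> v \<noteq> rt \<Longrightarrow> P (par v) \<Longrightarrow> P v"
  shows "P v"
  using assms(1)
proof (induction "d v" arbitrary: v rule: less_induct)
  case less
  then show ?case using assms par_in d_par by metis
qed

lemma root_in_up: "v \<in> W \<Longrightarrow> rt \<in> up v"
  by (induction rule: tree_induct) (auto simp: up_step)

text \<open>Two vertices with the same parent edge would be parents of each other, and
  \<open>d\<close> would drop in both directions.\<close>

lemma inj_tree_edges: "inj_on (\<lambda>v. {v, par v}) (W - {rt})"
proof (rule inj_onI)
  fix v w assume vw: "v \<in> W - {rt}" "w \<in> W - {rt}" "{v, par v} = {w, par w}"
  show "v = w"
  proof (rule ccontr)
    assume "v \<noteq> w"
    with vw(3) have *: "v = par w" "w = par v" by (auto simp: doubleton_eq_iff)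
    have "d (par v) < d v" "d (par w) < d w" using vw d_par by auto
    with * show False by (metis less_asym)
  qed
qed

lemma card_tree_edges:
  assumes "finite W" shows "card tree_edges = card W - 1"
proof -
  have "tree_edges = (\<lambda>v. {v, par v}) ` (W - {rt})"
    unfolding tree_edges_def by auto
  then show ?thesis using inj_tree_edges assms root_in by (simp add: card_image)
qed

text \<open>Towards the root a label either persists or gives way to one of strictly smaller level.
  A level once left never returns, so on one root path the level determines the label.\<close>

lemma level_up:
  assumes "v \<in> W"
    and lam: "\<And>y. y \<in> W \<Longrightarrow> y \<noteq> rt \<Longrightarrow> lam (par y) = lam y \<or> D (lam (par y)) < (D (lam y) :: nat)"
  shows "(\<forall>u\<in>up v. D (lam u) \<le> D (lam v)) \<and>
    (\<forall>u\<in>up v. \<forall>u'\<in>up v. D (lam u) = D (lam u') \<longrightarrow> lam u = lam u')"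
  using assms(1)
proof (induction rule: tree_induct)
  case rt
  then show ?case by (simp add: up_root)
next
  case (step v)
  have IH1: "D (lam u) \<le> D (lam (par v))" if "u \<in> up (par v)" for u
    using step.IH that by blast
  have IH2: "lam u = lam u'" if "u \<in> up (par v)" "u' \<in> up (par v)" "D (lam u) = D (lam u')" for u u'
    using step.IH that by blast
  have le: "D (lam (par v)) \<le> D (lam v)" using lam[OF step.hyps] by auto
  \<comment> \<open>No level on the path of \<open>par v\<close> exceeds that of
    \<open>par v\<close>. If one of them equals the level of \<open>v\<close>, the level did not
    drop from \<open>v\<close> to \<open>par v\<close>, so
    \<open>lam (par v) = lam v\<close>.\<close>
  have new: "lam u = lam v" if "u \<in> up (par v)" "D (lam u) = D (lam v)" for u
    using lam[OF step.hyps] IH1[OF that(1)] IH2[OF that(1), of "par v"] that(2) by auto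
  show ?case unfolding up_step[OF step.hyps]
    using IH1 IH2 le new by (auto intro: le_trans)
qed

text \<open>By \<open>level_up\<close>, \<open>D\<close> is injective on the labels of a root path,
  so their number is bounded by the number of levels in the window. Where \<open>a < R\<close>, the
  truncated difference \<open>a - R\<close> only shortens the window.\<close>

lemma card_level_up:
  assumes "v \<in> W"
    and "\<And>y. y \<in> W \<Longrightarrow> y \<noteq> rt \<Longrightarrow> lam (par y) = lam y \<or> D (lam (par y)) < (D (lam y) :: nat)"
  shows "finite {q \<in> lam ` up v. D q \<le> a + R \<and> a \<le> D q + R}"
    "card {q \<in> lam ` up v. D q \<le> a + R \<and> a \<le> D q + R} \<le> 2 * R + 1"
proof -
  let ?A = "{q \<in> lam ` up v. D q \<le> a + R \<and> a \<le> D q + R}"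
  have inj: "inj_on D ?A"
    using level_up[where lam = lam and D = D, OF assms] by (auto simp: inj_on_def)
  have sub: "D ` ?A \<subseteq> {a - R..a + R}" by auto
  show "finite ?A" using inj sub finite_subset finite_imageD by blast
  have "card ?A = card (D ` ?A)" using inj by (simp add: card_image)
  also have "\<dots> \<le> card {a - R..a + R}" using sub by (intro card_mono) auto
  also have "\<dots> \<le> 2 * R + 1" by auto
  finally show "card ?A \<le> 2 * R + 1" .
qed

end

section \<open>Combinatorial surfaces\<close>

definition edges :: "'b set set \<Rightarrow> 'b set set" where
  "edges T = {e. card e = 2 \<and> (\<exists>t\<in>T. e \<subseteq> t)}"

definition euler :: "'b set set \<Rightarrow> int" where
  "euler T = int (card (\<Union>T)) - int (card (edges T)) + int (card T)"

definition vadj :: "'b set set \<Rightarrow> 'b \<Rightarrow> 'b \<Rightarrow> bool" where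
  "vadj T x y \<longleftrightarrow> x \<noteq> y \<and> (\<exists>t\<in>T. x \<in> t \<and> y \<in> t)"

lemma vadj_edges: "vadj T x y \<longleftrightarrow> x \<noteq> y \<and> {x, y} \<in> edges T"
  unfolding vadj_def edges_def by auto

lemma vadj_sym: "vadj T x y \<Longrightarrow> vadj T y x"
  unfolding vadj_def by blast

definition tadj :: "'b set \<Rightarrow> 'b set \<Rightarrow> bool" where
  "tadj s t \<longleftrightarrow> card (s \<inter> t) = 2"

text \<open>An abstract closed surface, given by its triangles alone. Two triangles at
  \<open>v\<close> that share an edge share one through \<open>v\<close>; so by \<open>two\<close>
  the link of a vertex is a union of cycles, and \<open>link\<close> says that it is a single
  one.\<close>

locale surface =
  fixes T :: "'b set set"
  assumes fin: "finite T" and ne: "T \<noteq> {}"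
    and card3: "t \<in> T \<Longrightarrow> card t = 3"
    and two: "e \<in> edges T \<Longrightarrow> card {t \<in> T. e \<subseteq> t} = 2"
    and link: "v \<in> \<Union>T \<Longrightarrow> conn (\<lambda>s t. tadj s t) {t \<in> T. v \<in> t}"
    and conn_verts: "conn (vadj T) (\<Union>T)"
begin

abbreviation "W \<equiv> \<Union>T"

lemma fin_t: "t \<in> T \<Longrightarrow> finite t"
  using card3 by (metis card.infinite zero_neq_numeral)

lemma fin_W: "finite W"
  using fin fin_t by blast

lemma edge_subset: "e \<in> edges T \<Longrightarrow> e \<subseteq> W"
  unfolding edges_def by auto

lemma fin_edges: "finite (edges T)"
  by (rule finite_subset[of _ "Pow W"]) (use fin_W edge_subset in auto)

lemma tadj_neq: "s \<in> T \<Longrightarrow> tadj s t \<Longrightarrow> s \<noteq> t"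
  unfolding tadj_def using card3 by fastforce

lemma tadj_edge: "s \<in> T \<Longrightarrow> tadj s t \<Longrightarrow> s \<inter> t \<in> edges T"
  unfolding tadj_def edges_def by auto

lemma edge_cases:
  assumes "e \<in> edges T"
  obtains s t where "s \<in> T" "t \<in> T" "s \<noteq> t" "s \<inter> t = e" "{t \<in> T. e \<subseteq> t} = {s, t}"
proof -
  from two[OF assms] obtain s t where st: "{t \<in> T. e \<subseteq> t} = {s, t}" "s \<noteq> t"
    by (auto simp: card_2_iff)
  then have *: "s \<in> T" "t \<in> T" "e \<subseteq> s" "e \<subseteq> t" by auto
  have e2: "card e = 2" using assms by (simp add: edges_def)
  have "e = s \<inter> t"
  proof (rule card_seteq)
    show "finite (s \<inter> t)" using fin_t * by auto
    show "e \<subseteq> s \<inter> t" using * by auto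
    have "\<not> s \<subseteq> t" using card_subset_eq[of t s] st(2) * card3 fin_t by auto
    then have "card (s \<inter> t) < card s" using fin_t[OF *(1)] by (intro psubset_card_mono) auto
    then have "card (s \<inter> t) < 3" using card3[OF *(1)] by simp
    then show "card (s \<inter> t) \<le> card e" using e2 by simp
  qed
  with st * show ?thesis using that by auto
qed

lemma edge_triangles:
  assumes "s \<in> T" "t \<in> T" "tadj s t"
  shows "{x \<in> T. s \<inter> t \<subseteq> x} = {s, t}"
proof -
  have "{s, t} \<subseteq> {x \<in> T. s \<inter> t \<subseteq> x}" using assms by auto
  moreover have "card {s, t} = 2" using tadj_neq[OF assms(1,3)] by simp
  ultimately show ?thesis
    using two[OF tadj_edge[OF assms(1,3)]] fin by (intro card_subset_eq[symmetric]) auto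
qed

text \<open>A set of triangles closed under adjacency contains, by \<open>link\<close>, the whole
  star of each of its vertices; its vertex set is therefore closed under
  \<open>vadj\<close>.\<close>

lemma strongly_conn: "conn tadj T"
proof (rule connI)
  fix A assume A: "A \<subseteq> T" "A \<noteq> {}" and cl: "\<And>x y. x \<in> A \<Longrightarrow> y \<in> T \<Longrightarrow> tadj x y \<Longrightarrow> y \<in> A"
  have star: "t \<in> A" if v: "v \<in> \<Union>A" and t: "t \<in> T" "v \<in> t" for v t
  proof -
    have "{t \<in> A. v \<in> t} = {t \<in> T. v \<in> t}"
      by (rule connD[OF link[of v]]) (use v A cl in auto)
    with t show ?thesis by blast
  qed
  have "\<Union>A = \<Union>T"
  proof (rule connD[OF conn_verts])
    show "\<Union>A \<subseteq> \<Union>T" using A by blast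
    show "\<Union>A \<noteq> {}" using A card3 by fastforce
    show "y \<in> \<Union>A" if "x \<in> \<Union>A" "y \<in> \<Union>T" "vadj T x y" for x y
      using that star unfolding vadj_def by blast
  qed
  have "t \<in> A" if t: "t \<in> T" for t
  proof -
    obtain v where "v \<in> t" using card3[OF t] by fastforce
    then show ?thesis using star[of v t] t \<open>\<Union>A = \<Union>T\<close> by blast
  qed
  with A show "A = T" by blast
qed

text \<open>For \<open>A \<subseteq> T\<close> this is the boundary of the 2-chain \<open>A\<close>
  modulo 2, since an edge lies in at most two triangles of \<open>A\<close>.\<close>

definition bd :: "'b set set \<Rightarrow> 'b set set" where
  "bd A = {e \<in> edges T. card {t \<in> A. e \<subseteq> t} = 1}"

lemma edges_at_vertex:
  assumes "t \<in> T" "v \<in> t"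
  shows "card {e \<in> edges T. v \<in> e \<and> e \<subseteq> t} = 2"
proof -
  have "{e \<in> edges T. v \<in> e \<and> e \<subseteq> t} = (\<lambda>w. {v, w}) ` (t - {v})"
  proof (intro equalityI subsetI)
    fix e assume "e \<in> {e \<in> edges T. v \<in> e \<and> e \<subseteq> t}"
    then have e: "card e = 2" "v \<in> e" "e \<subseteq> t" by (auto simp: edges_def)
    then obtain w where "e = {v, w}" "w \<noteq> v" by (metis card_2_iff doubleton_eq_iff insertE singletonD)
    with e show "e \<in> (\<lambda>w. {v, w}) ` (t - {v})" by auto
  qed (use assms in \<open>auto simp: edges_def\<close>)
  moreover have "inj_on (\<lambda>w. {v, w}) (t - {v})" by (auto simp: inj_on_def doubleton_eq_iff)
  ultimately show ?thesis using card3 assms fin_t by (simp add: card_image)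
qed

text \<open>The boundary of a boundary vanishes modulo 2: among the pairs of an edge at
  \<open>v\<close> and a triangle of \<open>A\<close> containing it, each triangle at
  \<open>v\<close> accounts for two.\<close>

lemma bd_even:
  assumes "A \<subseteq> T"
  shows "even (card {e \<in> bd A. v \<in> e})"
proof -
  let ?E = "{e \<in> edges T. v \<in> e}"
  have finA: "finite A" using assms fin finite_subset by blast
  have finE: "finite ?E" using fin_edges by auto
  have "(\<Sum>e\<in>?E. card {t \<in> A. e \<subseteq> t}) = (\<Sum>t\<in>A. card {e \<in> ?E. e \<subseteq> t})"
    using sum.swap_restrict[OF finE finA, of "\<lambda>_ _. 1::nat" "\<lambda>e t. e \<subseteq> t"] by simp
  also have "even \<dots>"
  proof (rule dvd_sum)
    fix t assume t: "t \<in> A"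
    have eq: "{e \<in> ?E. e \<subseteq> t} = {e \<in> edges T. v \<in> e \<and> e \<subseteq> t}" by auto
    show "even (card {e \<in> ?E. e \<subseteq> t})"
    proof (cases "v \<in> t")
      case True then show ?thesis using edges_at_vertex[of t v] t assms eq by auto
    next
      case False then have "{e \<in> ?E. e \<subseteq> t} = {}" by auto
      then show ?thesis by (metis card.empty even_zero)
    qed
  qed
  finally have ev: "even (\<Sum>e\<in>?E. card {t \<in> A. e \<subseteq> t})" .
  have le2: "card {t \<in> A. e \<subseteq> t} \<le> 2" if "e \<in> ?E" for e
  proof -
    have "card {t \<in> A. e \<subseteq> t} \<le> card {t \<in> T. e \<subseteq> t}"
      using assms fin by (intro card_mono) auto
    then show ?thesis using two that by auto
  qed
  have "even (\<Sum>e\<in>?E. card {t \<in> A. e \<subseteq> t}) \<longleftrightarrow> even (card {e \<in> ?E. odd (card {t \<in> A. e \<subseteq> t})})"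
    using finE by (rule even_sum_iff)
  moreover have "{e \<in> ?E. odd (card {t \<in> A. e \<subseteq> t})} = {e \<in> bd A. v \<in> e}"
  proof -
    have "odd (card {t \<in> A. e \<subseteq> t}) \<longleftrightarrow> card {t \<in> A. e \<subseteq> t} = 1" if "e \<in> ?E" for e
      using le2[OF that] by (auto simp: le_Suc_eq numeral_2_eq_2)
    then show ?thesis unfolding bd_def by auto
  qed
  ultimately show ?thesis using ev by simp
qed

lemma bd_iff:
  assumes "A \<subseteq> T" "s \<in> T" "t \<in> T" "tadj s t"
  shows "s \<inter> t \<in> bd A \<longleftrightarrow> (s \<in> A \<longleftrightarrow> t \<notin> A)"
proof -
  let ?e = "s \<inter> t"
  have e: "?e \<in> edges T" using tadj_edge assms by auto
  have eq: "{x \<in> T. ?e \<subseteq> x} = {s, t}" by (rule edge_triangles[OF assms(2-4)])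
  have "{x \<in> A. ?e \<subseteq> x} = {s, t} \<inter> A" using eq assms by auto
  then have "?e \<in> bd A \<longleftrightarrow> card ({s, t} \<inter> A) = 1" using e unfolding bd_def by simp
  then show ?thesis using tadj_neq[OF assms(2,4)] by (cases "s \<in> A"; cases "t \<in> A") auto
qed

lemma bd_cases:
  assumes "A \<subseteq> T" "e \<in> bd A"
  obtains s t where "s \<in> A" "t \<in> T" "t \<notin> A" "tadj s t" "s \<inter> t = e"
proof -
  have e: "e \<in> edges T" using assms by (auto simp: bd_def)
  obtain s t where st: "s \<in> T" "t \<in> T" "s \<noteq> t" "s \<inter> t = e" using edge_cases[OF e] by metis
  have adj: "tadj s t" using e st by (auto simp: tadj_def edges_def)
  with bd_iff[OF assms(1) st(1,2)] st assms consider "s \<in> A" "t \<notin> A" | "t \<in> A" "s \<notin> A" by blast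
  then show ?thesis
  proof cases
    case 1 then show ?thesis using that st adj by blast
  next
    case 2 then show ?thesis using that[of t s] st adj by (auto simp: tadj_def Int_commute)
  qed
qed

text \<open>Adjacent triangles around \<open>v\<close> share an edge through \<open>v\<close>, which
  is not in \<open>bd A\<close>, so they lie on one side by \<open>bd_iff\<close>;
  \<open>link\<close> extends this to all of them. A change of side is thus possible only at
  vertices of boundary edges.\<close>

lemma same_side_star:
  assumes "A \<subseteq> T" "v \<in> W" "\<And>e. e \<in> bd A \<Longrightarrow> v \<notin> e" "s \<in> A" "v \<in> s" "t \<in> T" "v \<in> t"
  shows "t \<in> A"
proof -
  have "{t \<in> A. v \<in> t} = {t \<in> T. v \<in> t}"
  proof (rule connD[OF link[OF assms(2)]])
    show "y \<in> {t \<in> A. v \<in> t}" if "x \<in> {t \<in> A. v \<in> t}" "y \<in> {t \<in> T. v \<in> t}" "tadj x y" for x y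
      using bd_iff[OF assms(1), of x y] that assms(1) assms(3)[of "x \<inter> y"] by auto
  qed (use assms in auto)
  then show ?thesis using assms by blast
qed

end

section \<open>Tree-cotree decomposition and separating root paths\<close>

locale surface_tree = surface T + tr: rooted_tree "\<Union>T" rt par d
  for T :: "'b set set" and rt par d +
  assumes par_adj: "v \<in> \<Union>T \<Longrightarrow> v \<noteq> rt \<Longrightarrow> {v, par v} \<in> edges T"
begin

lemma tree_edges_subset: "tr.tree_edges \<subseteq> edges T"
  unfolding tr.tree_edges_def using par_adj by auto

text \<open>A forest carries no nonzero cycle modulo 2: away from the root paths of
  \<open>Z\<close>, parity at the lower end of a boundary edge forces a further boundary edge below
  it, and this cannot go on forever.\<close>

lemma bd_subset_UP:
  assumes A: "A \<subseteq> T" and bd: "bd A \<subseteq> tr.tree_edges \<union> Z" and e: "e \<in> bd A"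
  shows "e \<subseteq> tr.UP (\<Union>Z)"
proof (rule ccontr)
  assume neg: "\<not> e \<subseteq> tr.UP (\<Union>Z)"
  \<comment> \<open>The lower ends of the offending tree edges; the contradiction arises at one of
    largest rank.\<close>
  define B where "B = {v \<in> W. v \<noteq> rt \<and> {v, par v} \<in> bd A \<and> v \<notin> tr.UP (\<Union>Z)}"
  have "B \<noteq> {}"
  proof -
    have "e \<notin> Z" using neg tr.subset_UP[of "\<Union>Z"] by blast
    then have "e \<in> tr.tree_edges" using bd e by blast
    then obtain v where v: "e = {v, par v}" "v \<in> W" "v \<noteq> rt"
      unfolding tr.tree_edges_def by blast
    then have "v \<notin> tr.UP (\<Union>Z)" using neg tr.UP_par by blast
    then show ?thesis using v e unfolding B_def by blast
  qed
  moreover have "finite B" unfolding B_def by (rule finite_subset[OF _ fin_W]) blast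
  ultimately have "Max (d ` B) \<in> d ` B" by (intro Max_in) auto
  then obtain v where v: "v \<in> B" "d v = Max (d ` B)" by (metis imageE)
  have max: "d w \<le> d v" if "w \<in> B" for w
    using that v(2) \<open>finite B\<close> by (simp add: Max_ge)
  \<comment> \<open>A second boundary edge at \<open>v\<close> is not in \<open>Z\<close>, as
    \<open>v\<close> is off the root paths, so it is a tree edge to a child \<open>w\<close> of
    \<open>v\<close>. If \<open>w\<close> were on these paths, so would be its parent
    \<open>v\<close>; hence \<open>w\<close> is in \<open>B\<close> and has larger rank.\<close>
  have "{e \<in> bd A. v \<in> e} = {{v, par v}}"
  proof (rule ccontr)
    assume "\<not> ?thesis"
    then obtain f where f: "f \<in> bd A" "v \<in> f" "f \<noteq> {v, par v}" using v unfolding B_def by blast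
    have "f \<notin> Z" using f v tr.subset_UP[of "\<Union>Z"] unfolding B_def by blast
    then have "f \<in> tr.tree_edges" using bd f by blast
    then obtain w where w: "f = {w, par w}" "w \<in> W" "w \<noteq> rt"
      unfolding tr.tree_edges_def by blast
    then have "v = par w" using f by auto
    then have "w \<notin> tr.UP (\<Union>Z)" using tr.UP_par[of w] w v unfolding B_def by blast
    then have "w \<in> B" using w f unfolding B_def by auto
    with max[of w] tr.d_par[of w] w \<open>v = par w\<close> show False by auto
  qed
  with bd_even[OF A, of v] show False by simp
qed

definition cadj :: "'b set \<Rightarrow> 'b set \<Rightarrow> bool" where
  "cadj s t \<longleftrightarrow> tadj s t \<and> s \<inter> t \<notin> tr.tree_edges"

text \<open>A set closed under \<open>cadj\<close> has all of its boundary in the tree. With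
  \<open>Z = {}\<close> in \<open>bd_subset_UP\<close> this boundary is empty, and strong
  connectedness applies.\<close>

lemma cotree_conn: "conn cadj T"
proof (rule connI)
  fix A assume A: "A \<subseteq> T" "A \<noteq> {}" and cl: "\<And>x y. x \<in> A \<Longrightarrow> y \<in> T \<Longrightarrow> cadj x y \<Longrightarrow> y \<in> A"
  have sub: "bd A \<subseteq> tr.tree_edges \<union> {}"
  proof
    fix e assume "e \<in> bd A"
    then obtain s t where "s \<in> A" "t \<in> T" "t \<notin> A" "tadj s t" "s \<inter> t = e"
      using bd_cases[OF A(1)] by metis
    then show "e \<in> tr.tree_edges \<union> {}" using cl[of s t] unfolding cadj_def by blast
  qed
  have empty: "bd A = {}"
  proof (rule ccontr)
    assume "bd A \<noteq> {}"
    then obtain e where e: "e \<in> bd A" by blast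
    have "e \<subseteq> {}" using bd_subset_UP[OF A(1) sub e] by (simp add: tr.UP_def)
    with e show False by (auto simp: bd_def edges_def)
  qed
  show "A = T"
  proof (rule connD[OF strongly_conn A])
    show "y \<in> A" if "x \<in> A" "y \<in> T" "tadj x y" for x y
      using bd_iff[OF A(1), of x y] that A(1) empty by blast
  qed
qed

text \<open>With V vertices, E edges and F triangles, \<open>X\<close> has E - (V - 1) - (F - 1)
  elements. The branch below \<open>c\<close> is joined to the rest of the dual tree only through
  the edge \<open>c \<inter> q c\<close>: for any other \<open>h\<close>, the triangles
  \<open>h\<close> and \<open>q h\<close> are both inside or both outside.\<close>

theorem tree_cotree:
  assumes "f0 \<in> T"
  obtains q D X where "rooted_tree T f0 q D"
    "\<And>c. c \<in> T \<Longrightarrow> c \<noteq> f0 \<Longrightarrow> tadj c (q c)"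
    "X \<subseteq> edges T" "int (card X) = 2 - euler T"
    "\<And>c. c \<in> T \<Longrightarrow> c \<noteq> f0 \<Longrightarrow>
       bd {h \<in> T. c \<in> rooted_tree.up T f0 q h} \<subseteq> tr.tree_edges \<union> insert (c \<inter> q c) X"
proof -
  let ?N = "{(u, v). u \<in> T \<and> v \<in> T \<and> cadj u v}"
  have "(y, f0) \<in> ?N\<^sup>*" if "y \<in> T" for y
    using conn_rtrancl[OF cotree_conn that assms] .
  from ex_parent[where W = T and rt = f0 and N = ?N, OF this] obtain q and D :: "'b set \<Rightarrow> nat"
    where q: "\<And>y. y \<in> T \<Longrightarrow> y \<noteq> f0 \<Longrightarrow> (y, q y) \<in> ?N \<and> D (q y) < D y" by blast
  interpret co: rooted_tree T f0 q D
    by unfold_locales (use q assms in auto)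
  have adj: "tadj c (q c)" "c \<inter> q c \<notin> tr.tree_edges" "c \<inter> q c \<in> edges T" if "c \<in> T" "c \<noteq> f0" for c
    using q[OF that] tadj_edge unfolding cadj_def by auto
  \<comment> \<open>\<open>Y\<close> consists of the edges crossed by the dual tree, and
    \<open>X\<close> of those that neither tree uses.\<close>
  define Y where "Y = (\<lambda>c. c \<inter> q c) ` (T - {f0})"
  define X where "X = edges T - tr.tree_edges - Y"
  have pair: "{t \<in> T. c \<inter> q c \<subseteq> t} = {c, q c}" if c: "c \<in> T" "c \<noteq> f0" for c
    by (rule edge_triangles[OF c(1) co.par_in[OF c] adj(1)[OF c]])
  have injY: "inj_on (\<lambda>c. c \<inter> q c) (T - {f0})"
  proof (rule inj_onI)
    fix c c' assume c: "c \<in> T - {f0}" "c' \<in> T - {f0}" "c \<inter> q c = c' \<inter> q c'"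
    then have "{c, q c} = {c', q c'}" using pair[of c] pair[of c'] by simp
    then show "c = c'" using co.inj_tree_edges c unfolding inj_on_def by blast
  qed
  have cardY: "card Y = card T - 1"
    unfolding Y_def using injY fin assms by (simp add: card_image)
  have Yd: "Y \<inter> tr.tree_edges = {}" "Y \<subseteq> edges T" using adj unfolding Y_def by auto
  have TY: "tr.tree_edges \<union> Y \<subseteq> edges T" using tree_edges_subset Yd by blast
  have "X = edges T - (tr.tree_edges \<union> Y)" unfolding X_def by blast
  then have "int (card X) = int (card (edges T)) - int (card (tr.tree_edges \<union> Y))"
    using card_Diff_subset[OF finite_subset[OF TY fin_edges] TY] card_mono[OF fin_edges TY] by simp
  also have "card (tr.tree_edges \<union> Y) = card tr.tree_edges + card Y"
    using TY fin_edges Yd(1) finite_subset by (intro card_Un_disjoint) (blast+)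
  also have "card tr.tree_edges = card W - 1" by (rule tr.card_tree_edges[OF fin_W])
  finally have "int (card X) = int (card (edges T)) - int (card W - 1 + (card T - 1))"
    using cardY by simp
  moreover have "card W \<ge> 1" "card T \<ge> 1"
    using fin_W fin tr.root_in assms by (auto simp: Suc_le_eq card_gt_0_iff)
  ultimately have cX: "int (card X) = 2 - euler T"
    unfolding euler_def by (simp add: of_nat_diff)
  show ?thesis
  proof (rule that[of q D X])
    fix c assume c: "c \<in> T" "c \<noteq> f0"
    let ?A = "{h \<in> T. c \<in> co.up h}"
    show "bd ?A \<subseteq> tr.tree_edges \<union> insert (c \<inter> q c) X"
    proof
      fix e assume e: "e \<in> bd ?A"
      then have eT: "e \<in> edges T" by (simp add: bd_def)
      show "e \<in> tr.tree_edges \<union> insert (c \<inter> q c) X"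
      proof (rule ccontr)
        assume neg: "e \<notin> tr.tree_edges \<union> insert (c \<inter> q c) X"
        with eT have "e \<in> Y" unfolding X_def by blast
        then obtain h where h: "h \<in> T" "h \<noteq> f0" "e = h \<inter> q h" unfolding Y_def by auto
        have "h \<noteq> c" using neg h by auto
        then have "h \<in> ?A \<longleftrightarrow> q h \<in> ?A" using co.up_step[OF h(1,2)] h co.par_in by auto
        moreover have "h \<in> ?A \<longleftrightarrow> q h \<notin> ?A"
          using bd_iff[of ?A h "q h"] e h adj(1)[OF h(1,2)] co.par_in[OF h(1,2)] by auto
        ultimately show False by blast
      qed
    qed
  qed (use adj cX co.rooted_tree_axioms in \<open>auto simp: X_def\<close>)
qed

end

section \<open>The pursuit\<close>

text \<open>Stated with sums, because subtraction of natural numbers truncates.\<close>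

definition near :: "nat \<Rightarrow> nat \<Rightarrow> nat \<Rightarrow> bool" where
  "near R m n \<longleftrightarrow> m \<le> n + R \<and> n \<le> m + R"

lemma near_trans: "near a l m \<Longrightarrow> near b m n \<Longrightarrow> near (a + b) l n"
  unfolding near_def by linarith

lemma near_mono: "near a m n \<Longrightarrow> a \<le> b \<Longrightarrow> near b m n"
  unfolding near_def by linarith

lemma near_sym: "near a m n \<Longrightarrow> near a n m"
  unfolding near_def by linarith

text \<open>The cops keep descending in a rooted tree whose nodes \<open>f\<close> carry separators \<open>P f\<close>, always
  towards the branch \<open>c\<close> that contains the robber; he cannot leave the branch, because \<open>Pe c\<close> is
  occupied before and after his move wherever he can get to.\<close>

lemma cops_win_tree:
  fixes V :: "'a set" and E :: "'a set set" and \<pi> :: "'a \<Rightarrow> 'q" and D :: "'q \<Rightarrow> nat"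
    and F :: "'f set"
  assumes tree: "rooted_tree F f0 q rk" and finF: "finite F"
    and Pe: "\<And>c. c \<in> F - {f0} \<Longrightarrow> Pe c \<subseteq> P c \<inter> P (q c)"
    and start: "\<And>v. v \<in> V \<Longrightarrow> \<pi> v \<notin> P f0 \<Longrightarrow> \<exists>c\<in>F - {f0}. q c = f0 \<and> beyond c (\<pi> v)"
    and branch: "\<And>f v. f \<in> F - {f0} \<Longrightarrow> v \<in> V \<Longrightarrow> \<pi> v \<notin> P f \<Longrightarrow> beyond f (\<pi> v) \<Longrightarrow>
        \<exists>c\<in>F - {f0}. q c = f \<and> beyond c (\<pi> v)"
    and edge: "\<And>a b c. {a, b} \<in> E \<Longrightarrow> a \<in> V \<Longrightarrow> b \<in> V \<Longrightarrow> c \<in> F - {f0} \<Longrightarrow> \<pi> a \<notin> Pe c \<Longrightarrow> beyond c (\<pi> a) \<Longrightarrow>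
        (beyond c (\<pi> b) \<and> \<pi> b \<notin> Pe c) \<or>
        (\<exists>u\<in>Pe c. (a \<in> cops u \<or> b \<in> cops u) \<and> near L (D u) (D (\<pi> a)))"
    and level: "\<And>a b. {a, b} \<in> E \<Longrightarrow> a \<in> V \<Longrightarrow> b \<in> V \<Longrightarrow> near L (D (\<pi> a)) (D (\<pi> b))"
    and cops: "\<And>u. cops u \<subseteq> V" "\<And>u. finite (cops u) \<and> card (cops u) \<le> 2" "\<And>v. v \<in> V \<Longrightarrow> v \<in> cops (\<pi> v)"
    and fin: "\<And>f n. f \<in> F \<Longrightarrow> finite {u \<in> P f. near (2 * r * L) (D u) n}"
    and card: "\<And>f n. f \<in> F \<Longrightarrow> card {u \<in> P f. near (2 * r * L) (D u) n} \<le> M"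
  shows "cops_win V E r (2 * M)"
proof -
  interpret rooted_tree F f0 q rk by (rule tree)
  \<comment> \<open>\<open>guard f x\<close> is announced while the robber stands at
    \<open>x\<close>. It must still hold on the move after the coming one, which starts up to
    \<open>r * L\<close> levels away and covers \<open>r * L\<close> more; hence the radius
    \<open>2 * r * L\<close>.\<close>
  define guard where "guard f x = (\<Union>u\<in>{u \<in> P f. near (2 * r * L) (D u) (D (\<pi> x))}. cops u)" for f x
  have guard_V: "guard f x \<subseteq> V" for f x unfolding guard_def using cops by blast
  have guard_card: "card (guard f x) \<le> 2 * M" if "f \<in> F" for f x
  proof -
    have "card (guard f x) \<le> (\<Sum>u\<in>{u \<in> P f. near (2 * r * L) (D u) (D (\<pi> x))}. card (cops u))"
      unfolding guard_def by (rule card_UN_le) (rule fin[OF that])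
    also have "\<dots> \<le> (\<Sum>u\<in>{u \<in> P f. near (2 * r * L) (D u) (D (\<pi> x))}. 2)"
      by (rule sum_mono) (use cops in blast)
    also have "\<dots> \<le> 2 * M" using card[OF that, of "D (\<pi> x)"] by simp
    finally show ?thesis .
  qed
  \<comment> \<open>The default \<open>f0\<close> only keeps \<open>nxt f x\<close> inside
    \<open>F\<close>; in a play where the robber is never caught, a suitable child always
    exists.\<close>
  define nxt where "nxt f x = (if \<exists>c\<in>F - {f0}. q c = f \<and> beyond c (\<pi> x)
      then SOME c. c \<in> F - {f0} \<and> q c = f \<and> beyond c (\<pi> x) else f0)" for f x
  have nxt_F: "nxt f x \<in> F" for f x
  proof (cases "\<exists>c\<in>F - {f0}. q c = f \<and> beyond c (\<pi> x)")
    case True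
    then have "\<exists>c. c \<in> F - {f0} \<and> q c = f \<and> beyond c (\<pi> x)" by blast
    from someI_ex[OF this] True show ?thesis unfolding nxt_def by auto
  next
    case False
    then have "nxt f x = f0" unfolding nxt_def by (rule if_not_P)
    then show ?thesis using root_in by simp
  qed
  have nxt: "nxt f x \<in> F - {f0} \<and> q (nxt f x) = f \<and> beyond (nxt f x) (\<pi> x)"
    if "\<exists>c\<in>F - {f0}. q c = f \<and> beyond c (\<pi> x)" for f x
  proof -
    have "\<exists>c. c \<in> F - {f0} \<and> q c = f \<and> beyond c (\<pi> x)" using that by blast
    from someI_ex[OF this] that show ?thesis unfolding nxt_def by auto
  qed
  \<comment> \<open>\<open>tl\<close> drops the initial position of the robber: the first guard is
    the one of the root, and every later position causes one step down.\<close>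
  define node where "node h = foldl nxt f0 (tl h)" for h
  have node_F: "node h \<in> F" for h
  proof -
    have "foldl nxt f l \<in> F" if "f \<in> F" for f l
      using that by (induction l arbitrary: f) (auto simp: nxt_F)
    then show ?thesis unfolding node_def using root_in by blast
  qed
  define \<sigma> where "\<sigma> h = (if h = [] then {} else guard (node h) (last h))" for h
  have "\<exists>i. x i \<in> cop_position \<sigma> x i" if play: "robber_play V E r \<sigma> x" for x
  proof (rule ccontr)
    assume "\<not> ?thesis"
    then have free: "x i \<notin> cop_position \<sigma> x i" for i by blast
    define n where "n i = node (map x [0..<Suc i])" for i
    have pos: "cop_position \<sigma> x (Suc i) = guard (n i) (x i)" for i
      unfolding cop_position_def \<sigma>_def n_def by simp
    have nF: "n i \<in> F" for i unfolding n_def by (rule node_F)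
    have tl: "tl (map x [0..<Suc m]) = map x [1..<Suc m]" for m
      by (simp add: upt_conv_Cons del: upt_Suc)
    have n0: "n 0 = f0" unfolding n_def node_def by simp
    have nS: "n (Suc i) = nxt (n i) (x (Suc i))" for i
      unfolding n_def node_def tl by simp
    have V0: "x 0 \<in> V" and move: "robber_move V E r (cop_position \<sigma> x i) (cop_position \<sigma> x (Suc i)) (x i) (x (Suc i))" for i
      using play unfolding robber_play_def by auto
    have path_level: "near (i * L) (D (\<pi> (p ! i))) (D (\<pi> (p ! 0)))" if "graph_path V E p" "i < length p" for p i
      using that(2)
    proof (induction i)
      case (Suc i)
      have "near L (D (\<pi> (p ! Suc i))) (D (\<pi> (p ! i)))"
        using that(1) Suc.prems unfolding graph_path_def
        by (intro near_sym[OF level]) auto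
      from near_trans[OF this Suc.IH] Suc.prems show ?case by simp
    qed (simp add: near_def)
    have xV: "x i \<in> V" and step_near: "near (r * L) (D (\<pi> (x (Suc i)))) (D (\<pi> (x i)))" for i
    proof -
      obtain p where p: "graph_path V E p" "hd p = x i" "last p = x (Suc i)" "length p - 1 \<le> r"
        using move[of i] unfolding robber_move_def by blast
      then have "p \<noteq> []" "set p \<subseteq> V" by (auto simp: graph_path_def)
      with p show "x i \<in> V" by (metis hd_in_set subsetD)
      have "near ((length p - 1) * L) (D (\<pi> (p ! (length p - 1)))) (D (\<pi> (p ! 0)))"
        by (rule path_level[OF p(1)]) (use \<open>p \<noteq> []\<close> in auto)
      moreover have "p ! (length p - 1) = x (Suc i)" "p ! 0 = x i"
        using p \<open>p \<noteq> []\<close> by (auto simp: last_conv_nth hd_conv_nth)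
      ultimately show "near (r * L) (D (\<pi> (x (Suc i)))) (D (\<pi> (x i)))"
        using p(4) by (auto intro: near_mono)
    qed
    \<comment> \<open>The new position is within the window of the guard announced before the move,
      so on \<open>P (n i)\<close> the robber would be caught.\<close>
    have not_P: "\<pi> (x (Suc i)) \<notin> P (n i)" for i
    proof
      assume "\<pi> (x (Suc i)) \<in> P (n i)"
      moreover have "near (2 * r * L) (D (\<pi> (x (Suc i)))) (D (\<pi> (x i)))"
        by (rule near_mono[OF step_near]) simp
      ultimately have "x (Suc i) \<in> guard (n i) (x i)"
        unfolding guard_def using cops(3)[OF xV] by blast
      with free[of "Suc i"] pos show False by simp
    qed
    have inv: "n (Suc i) \<in> F - {f0} \<and> q (n (Suc i)) = n i \<and> beyond (n (Suc i)) (\<pi> (x (Suc i)))" for i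
    proof (induction i)
      case 0
      show ?case unfolding nS[of 0] n0
        by (rule nxt, rule start) (use xV not_P[of 0] n0 in auto)
    next
      case (Suc i)
      let ?c = "n (Suc i)"
      obtain p where p: "graph_path V E p" "hd p = x (Suc i)" "last p = x (Suc (Suc i))" "length p - 1 \<le> r"
        "set p \<inter> (cop_position \<sigma> x (Suc i) \<inter> cop_position \<sigma> x (Suc (Suc i))) = {}"
        using move[of "Suc i"] unfolding robber_move_def by blast
      then have ne: "p \<noteq> []" and pV: "set p \<subseteq> V" by (auto simp: graph_path_def)
      then have p0: "p ! 0 = x (Suc i)" and pl: "p ! (length p - 1) = x (Suc (Suc i))"
        using p by (auto simp: last_conv_nth hd_conv_nth)
      have c: "?c \<in> F - {f0}" "q ?c = n i" using Suc by auto
      have "beyond ?c (\<pi> (p ! j)) \<and> \<pi> (p ! j) \<notin> Pe ?c" if "j < length p" for j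
        using that
      proof (induction j)
        case 0
        have "\<pi> (x (Suc i)) \<notin> Pe ?c" using Pe[OF c(1)] c(2) not_P[of i] by auto
        then show ?case using Suc.IH p0 by simp
      next
        case (Suc j)
        let ?a = "p ! j" and ?b = "p ! Suc j"
        have ab: "{?a, ?b} \<in> E" "?a \<in> V" "?b \<in> V" "?a \<in> set p" "?b \<in> set p"
          using p(1) pV Suc.prems unfolding graph_path_def by auto
        \<comment> \<open>What is within \<open>L\<close> levels of a path vertex reached after
          \<open>j < r\<close> edges is within \<open>r * L\<close> of \<open>x (Suc i)\<close> and
          within \<open>2 * r * L\<close> of \<open>x i\<close>. Since \<open>Pe ?c\<close> belongs
          to both separators, the cops of \<open>u\<close> stand in two consecutive guards and block
          the path.\<close>
        have False if u: "u \<in> Pe ?c" "?a \<in> cops u \<or> ?b \<in> cops u" "near L (D u) (D (\<pi> ?a))" for u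
        proof -
          have "near (L + j * L) (D u) (D (\<pi> (x (Suc i))))"
            using near_trans[OF u(3) path_level[OF p(1), of j]] Suc.prems p0 by simp
          moreover have "L + j * L \<le> r * L"
          proof -
            have "Suc j \<le> r" using Suc.prems p(4) by linarith
            then have "Suc j * L \<le> r * L" by (rule mult_le_mono1)
            then show ?thesis by simp
          qed
          ultimately have n1: "near (r * L) (D u) (D (\<pi> (x (Suc i))))" by (rule near_mono)
          have n2: "near (2 * r * L) (D u) (D (\<pi> (x i)))"
            using near_trans[OF n1 step_near[of i]] by (simp add: mult_2 distrib_right)
          have "near (2 * r * L) (D u) (D (\<pi> (x (Suc i))))" by (rule near_mono[OF n1]) simp
          moreover have uP: "u \<in> P (n i)" "u \<in> P ?c" using u(1) Pe[OF c(1)] unfolding c(2) by auto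
          ultimately have "cops u \<subseteq> guard ?c (x (Suc i))" unfolding guard_def by auto
          moreover have "cops u \<subseteq> guard (n i) (x i)" using uP n2 unfolding guard_def by auto
          ultimately have "cops u \<subseteq> guard (n i) (x i) \<inter> guard ?c (x (Suc i))" by blast
          then have "cops u \<inter> set p = {}" using p(5) unfolding pos by blast
          then show False using u(2) ab(4,5) by blast
        qed
        then show ?case using edge[OF ab(1-3) c(1)] Suc by auto
      qed
      from this[of "length p - 1"] have "beyond ?c (\<pi> (x (Suc (Suc i))))"
        using ne pl by simp
      then have "\<exists>c\<in>F - {f0}. q c = ?c \<and> beyond c (\<pi> (x (Suc (Suc i))))"
        by (intro branch c xV not_P)
      from nxt[OF this] show ?case by (simp add: nS)
    qed
    \<comment> \<open>Every round descends along a tree edge, so a play without capture would make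
      the ranks on the finite set \<open>F\<close> unbounded.\<close>
    have grow: "rk (n i) < rk (n (Suc i))" for i using inv[of i] d_par[of "n (Suc i)"] by auto
    have "i \<le> rk (n i)" for i
    proof (induction i)
      case (Suc i) then show ?case using grow[of i] by linarith
    qed simp
    moreover have "rk (n i) \<le> Max (rk ` F)" for i using nF finF by simp
    ultimately have "Suc (Max (rk ` F)) \<le> Max (rk ` F)" by (meson le_trans)
    then show False by simp
  qed
  moreover have "\<sigma> h \<subseteq> V \<and> card (\<sigma> h) \<le> 2 * M" for h
    unfolding \<sigma>_def using guard_V guard_card node_F by simp
  ultimately show ?thesis unfolding cops_win_def by blast
qed

context rooted_tree begin

text \<open>The required child is the last vertex before \<open>f\<close> on the root path of
  \<open>v\<close>.\<close>

lemma child_towards: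
  assumes "v \<in> W" "f \<in> up v" "v \<noteq> f"
  shows "\<exists>c\<in>W - {rt}. par c = f \<and> c \<in> up v"
  using assms
proof (induction rule: tree_induct)
  case (step v)
  show ?case
  proof (cases "par v = f")
    case True
    then show ?thesis using step.hyps by auto
  next
    case False
    then have "\<exists>c\<in>W - {rt}. par c = f \<and> c \<in> up (par v)"
      using step by (auto simp: up_step)
    then show ?thesis using step.hyps by (auto simp: up_step)
  qed
qed (simp add: up_root)

end

text \<open>\<open>D\<close> is the distance to \<open>u0\<close> in the graph of \<open>R\<close>
  on \<open>Q\<close>.\<close>

lemma ex_level:
  assumes reach: "\<And>u. u \<in> Q \<Longrightarrow> (u, u0) \<in> {(u, v). u \<in> Q \<and> v \<in> Q \<and> R u v}\<^sup>*"
    and sym: "\<And>u v. R u v \<Longrightarrow> R v u"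
  shows "\<exists>D. (\<forall>u\<in>Q. \<forall>v\<in>Q. R u v \<longrightarrow> near 1 (D u) (D v)) \<and>
    (\<forall>u\<in>Q. u \<noteq> u0 \<longrightarrow> (\<exists>v\<in>Q. R u v \<and> D v < D u))"
proof -
  let ?N = "{(u, v). u \<in> Q \<and> v \<in> Q \<and> R u v}"
  define D where "D u = (LEAST n. (u, u0) \<in> ?N ^^ n)" for u
  have D: "(u, u0) \<in> ?N ^^ D u" if "u \<in> Q" for u
  proof -
    have "\<exists>n. (u, u0) \<in> ?N ^^ n" using reach[OF that] by (simp add: rtrancl_power)
    then show ?thesis unfolding D_def by (rule LeastI_ex)
  qed
  have le: "D u \<le> n" if "(u, u0) \<in> ?N ^^ n" for u n
    unfolding D_def by (rule Least_le) (rule that)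
  have one: "D u \<le> D v + 1" if "u \<in> Q" "v \<in> Q" "R u v" for u v
  proof -
    have "(u, v) \<in> ?N" using that by blast
    from relpow_Suc_I2[OF this D[OF that(2)]] have "D u \<le> Suc (D v)" by (rule le)
    then show ?thesis by simp
  qed
  have "\<exists>v\<in>Q. R u v \<and> D v < D u" if u: "u \<in> Q" "u \<noteq> u0" for u
  proof -
    obtain m where m: "D u = Suc m" using D[OF u(1)] u(2) by (cases "D u") auto
    then have "(u, u0) \<in> ?N ^^ Suc m" using D[OF u(1)] by simp
    then obtain v where v: "(u, v) \<in> ?N" "(v, u0) \<in> ?N ^^ m" by (rule relpow_Suc_E2)
    with le[OF v(2)] m show ?thesis by auto
  qed
  then show ?thesis using one sym by (intro exI[of _ D]) (auto simp: near_def)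
qed

text \<open>Here \<open>lam\<close> sends a vertex of the triangulation to the vertex of the
  planarisation whose part contains it, and \<open>route\<close> lists the vertices of the
  planarisation along an edge of the graph. Positions are measured in the quotient while separation
  takes place in the triangulation; connected fibres allow a whole part to be treated as lying on
  one side.\<close>

theorem cops_win_surface:
  fixes V :: "'a set" and E :: "'a set set" and \<pi> :: "'a \<Rightarrow> 'q" and T :: "'w set set" and lam :: "'w \<Rightarrow> 'q"
  assumes surf: "surface T" and genus: "2 - int g \<le> euler T"
    and fibre: "\<And>u. conn (vadj T) {w \<in> \<Union>T. lam w = u}"
    and \<pi>: "\<And>v. v \<in> V \<Longrightarrow> \<pi> v \<in> lam ` \<Union>T"
    and route: "\<And>a b. {a, b} \<in> E \<Longrightarrow> a \<in> V \<Longrightarrow> b \<in> V \<Longrightarrow> \<exists>us. us \<noteq> [] \<and> hd us = \<pi> a \<and> last us = \<pi> b \<and>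
      length us \<le> k + 2 \<and> (\<forall>u\<in>set us. a \<in> cops u \<or> b \<in> cops u) \<and>
      (\<forall>i. Suc i < length us \<longrightarrow> (\<exists>w w'. vadj T w w' \<and> lam w = us ! i \<and> lam w' = us ! Suc i))"
    and cops: "\<And>u. cops u \<subseteq> V" "\<And>u. finite (cops u) \<and> card (cops u) \<le> 2" "\<And>v. v \<in> V \<Longrightarrow> v \<in> cops (\<pi> v)"
  shows "cops_win V E r (2 * ((2 * g + 3) * (4 * r * (k + 1) + 1)))"
proof -
  interpret surface T by (rule surf)
  obtain f0 where f0: "f0 \<in> T" using ne by blast
  have "f0 \<noteq> {}" using card3[OF f0] by auto
  then obtain rt where rt: "rt \<in> W" using f0 by blast
  define Q where "Q = lam ` W"
  define qadj where "qadj u u' \<longleftrightarrow> (\<exists>w w'. vadj T w w' \<and> lam w = u \<and> lam w' = u')" for u u'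
  have vW: "w \<in> W \<and> w' \<in> W" if "vadj T w w'" for w w' using that unfolding vadj_def by blast
  have qsym: "qadj v u" if "qadj u v" for u v using that vadj_sym unfolding qadj_def by metis
  have "(u, lam rt) \<in> {(u, v). u \<in> Q \<and> v \<in> Q \<and> qadj u v}\<^sup>*" if "u \<in> Q" for u
  proof -
    from that obtain w where w: "w \<in> W" "u = lam w" unfolding Q_def by blast
    have "(lam w, lam z) \<in> {(u, v). u \<in> Q \<and> v \<in> Q \<and> qadj u v}\<^sup>*"
      if "(w, z) \<in> {(u, v). u \<in> W \<and> v \<in> W \<and> vadj T u v}\<^sup>*" for z
      using that
    proof induction
      case (step y z)
      then have "(lam y, lam z) \<in> {(u, v). u \<in> Q \<and> v \<in> Q \<and> qadj u v}"
        unfolding Q_def qadj_def by auto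
      with step.IH show ?case by (rule rtrancl_into_rtrancl)
    qed simp
    from this[OF conn_rtrancl[OF conn_verts w(1) rt]] w show ?thesis by simp
  qed
  from ex_level[of Q "lam rt" qadj, OF this qsym] obtain D :: "'q \<Rightarrow> nat" where
    D1: "\<And>u v. u \<in> Q \<Longrightarrow> v \<in> Q \<Longrightarrow> qadj u v \<Longrightarrow> near 1 (D u) (D v)" and
    D2: "\<And>u. u \<in> Q \<Longrightarrow> u \<noteq> lam rt \<Longrightarrow> \<exists>v\<in>Q. qadj u v \<and> D v < D u" by blast
  \<comment> \<open>Steps that stay in a part or enter one of lower level. A spanning tree made of
    such steps satisfies the condition of \<open>level_up\<close>.\<close>
  define N where "N = {(w, w'). vadj T w w' \<and> (lam w' = lam w \<or> D (lam w') < D (lam w))}"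
  have infib: "(w, w') \<in> N\<^sup>*" if "w \<in> W" "w' \<in> W" "lam w = lam w'" for w w'
  proof -
    have mem: "(w, w') \<in> {(x, y). x \<in> {z \<in> W. lam z = lam w} \<and> y \<in> {z \<in> W. lam z = lam w} \<and> vadj T x y}\<^sup>*"
      by (rule conn_rtrancl[OF fibre]) (use that in auto)
    have sub: "{(x, y). x \<in> {z \<in> W. lam z = lam w} \<and> y \<in> {z \<in> W. lam z = lam w} \<and> vadj T x y} \<subseteq> N"
      unfolding N_def by auto
    show ?thesis by (rule subsetD[OF rtrancl_mono[OF sub] mem])
  qed
  \<comment> \<open>Inside its part a vertex reaches one that has a neighbour in a part of lower
    level; repeating this leads to the part of \<open>rt\<close>.\<close>
  have "(w, rt) \<in> N\<^sup>*" if "w \<in> W" for w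
    using that
  proof (induction "D (lam w)" arbitrary: w rule: less_induct)
    case less
    show ?case
    proof (cases "lam w = lam rt")
      case True
      then show ?thesis using infib less.prems rt by blast
    next
      case False
      then obtain u where "u \<in> Q" "qadj (lam w) u" "D u < D (lam w)"
        using D2 less.prems unfolding Q_def by blast
      then obtain y z where yz: "vadj T y z" "lam y = lam w" "D (lam z) < D (lam w)"
        unfolding qadj_def by blast
      have "(w, y) \<in> N\<^sup>*" using infib[of w y] vW[OF yz(1)] less.prems yz(2) by simp
      moreover have "(y, z) \<in> N" using yz by (simp add: N_def)
      moreover have "(z, rt) \<in> N\<^sup>*" using less.hyps[OF yz(3)] vW[OF yz(1)] by simp
      ultimately show ?thesis by (rule rtrancl_trans[OF _ converse_rtrancl_into_rtrancl])
    qed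
  qed
  from ex_parent[where W = W and N = N, OF this] obtain par and d :: "'w \<Rightarrow> nat"
    where par: "\<And>w. w \<in> W \<Longrightarrow> w \<noteq> rt \<Longrightarrow> (w, par w) \<in> N \<and> d (par w) < d w" by blast
  have par_vadj: "vadj T w (par w)" if "w \<in> W" "w \<noteq> rt" for w
    using par[OF that] unfolding N_def by blast
  interpret surface_tree T rt par d
  proof unfold_locales
    show "rt \<in> W" by (rule rt)
    fix v assume v: "v \<in> W" "v \<noteq> rt"
    show "par v \<in> W" using vW[OF par_vadj[OF v]] by simp
    show "d (par v) < d v" using par[OF v] by simp
    show "{v, par v} \<in> edges T" using par_vadj[OF v] by (simp add: vadj_edges)
  qed
  obtain q rk X where
    co: "rooted_tree T f0 q rk" and
    qadj: "\<And>c. c \<in> T \<Longrightarrow> c \<noteq> f0 \<Longrightarrow> tadj c (q c)" and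
    X: "X \<subseteq> edges T" "int (card X) = 2 - euler T" and
    bdX: "\<And>c. c \<in> T \<Longrightarrow> c \<noteq> f0 \<Longrightarrow>
       bd {h \<in> T. c \<in> rooted_tree.up T f0 q h} \<subseteq> tr.tree_edges \<union> insert (c \<inter> q c) X"
    by (rule tree_cotree[OF f0]; rule that; assumption?; simp)
  interpret co: rooted_tree T f0 q rk by (rule co)
  define S0 where "S0 = \<Union>X"
  have S0W: "S0 \<subseteq> W" unfolding S0_def using X(1) edge_subset by blast
  have finX: "finite X" using X(1) fin_edges finite_subset by blast
  have cardS0: "card S0 \<le> 2 * g"
  proof -
    have "card S0 \<le> (\<Sum>e\<in>X. card e)" unfolding S0_def by (rule card_Union_le_sum_card)
    also have "\<dots> = (\<Sum>e\<in>X. 2)" by (rule sum.cong) (use X(1) in \<open>auto simp: edges_def\<close>)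
    also have "\<dots> \<le> 2 * g" using X(2) genus by simp
    finally show ?thesis .
  qed
  define Sub where "Sub c = {h \<in> T. c \<in> co.up h}" for c
  \<comment> \<open>The edge \<open>c \<inter> q c\<close> lies in both triangles, so
    \<open>Pe c\<close> is contained in both separators \<open>P c\<close> and
    \<open>P (q c)\<close>. \<open>beyond\<close> asks for all triangles at the part
    \<open>u\<close>: a part off \<open>Pe c\<close> is either beyond or has no triangle in the
    branch at all.\<close>
  define P where "P f = lam ` tr.UP (S0 \<union> f)" for f
  define Pe where "Pe c = lam ` tr.UP (S0 \<union> (c \<inter> q c))" for c
  define beyond where "beyond c u \<longleftrightarrow> (\<forall>w\<in>W. lam w = u \<longrightarrow> (\<forall>t\<in>T. w \<in> t \<longrightarrow> t \<in> Sub c))" for c u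
  have SubT: "Sub c \<subseteq> T" for c unfolding Sub_def by blast
  have bdS: "e \<subseteq> tr.UP (S0 \<union> (c \<inter> q c))" if "c \<in> T - {f0}" "e \<in> bd (Sub c)" for c e
    using bd_subset_UP[OF SubT, of c "insert (c \<inter> q c) X" e] bdX[of c] that
    unfolding Sub_def S0_def by (simp add: Un_commute)
  have star: "t \<in> Sub c" if c: "c \<in> T - {f0}" and w: "w \<in> W" "lam w \<notin> Pe c"
    and st: "s \<in> Sub c" "w \<in> s" "t \<in> T" "w \<in> t" for c w s t
    by (rule same_side_star[OF SubT w(1) _ st]) (use bdS[OF c] w(2) in \<open>auto simp: Pe_def\<close>)
  \<comment> \<open>The fibre of \<open>u\<close> is connected and misses the boundary of the
    branch, so a single triangle at it decides for all.\<close>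
  have fill: "beyond c u" if c: "c \<in> T - {f0}" and u: "u \<notin> Pe c"
    and w: "w \<in> W" "lam w = u" "s \<in> Sub c" "w \<in> s" for c u w s
  proof -
    let ?F = "{z \<in> W. lam z = u}"
    have "{z \<in> ?F. \<exists>t\<in>Sub c. z \<in> t} = ?F"
    proof (rule connD[OF fibre])
      show "{z \<in> ?F. \<exists>t\<in>Sub c. z \<in> t} \<noteq> {}" using w by blast
      fix x y assume x: "x \<in> {z \<in> ?F. \<exists>t\<in>Sub c. z \<in> t}" and y: "y \<in> ?F" and xy: "vadj T x y"
      from xy obtain t where "t \<in> T" "x \<in> t" "y \<in> t" unfolding vadj_def by blast
      moreover from this have "t \<in> Sub c" using star[OF c, of x _ t] x u by blast
      ultimately show "y \<in> {z \<in> ?F. \<exists>t\<in>Sub c. z \<in> t}" using y by blast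
    qed blast
    then have "t \<in> Sub c" if "z \<in> W" "lam z = u" "t \<in> T" "z \<in> t" for z t
      using star[OF c that(1) _ _ _ that(3,4)] that u by blast
    then show ?thesis unfolding beyond_def by blast
  qed
  have cross: "beyond c u'" if c: "c \<in> T - {f0}" and u: "u \<notin> Pe c" "u' \<notin> Pe c" "beyond c u"
    and ww: "vadj T w w'" "lam w = u" "lam w' = u'" for c u u' w w'
  proof -
    obtain t where t: "t \<in> T" "w \<in> t" "w' \<in> t" using ww unfolding vadj_def by blast
    then have "t \<in> Sub c" using u(3) ww vW unfolding beyond_def by blast
    then show ?thesis using fill[OF c u(2) _ ww(3)] t vW[OF ww(1)] by blast
  qed
  have Pe_P: "Pe c \<subseteq> P c \<inter> P (q c)" for c
    unfolding P_def Pe_def using tr.UP_mono[of "S0 \<union> (c \<inter> q c)"] by blast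
  \<comment> \<open>A triangle \<open>t\<close> at the part \<open>u\<close> differs from
    \<open>f\<close>, as \<open>u\<close> is off \<open>P f\<close>, and lies in the branch of
    \<open>f\<close>; the child of \<open>f\<close> towards \<open>t\<close> is the required
    one.\<close>
  have enter: "\<exists>c\<in>T - {f0}. q c = f \<and> beyond c u"
    if f: "f \<in> T" "f = f0 \<or> beyond f u" and u: "u \<in> Q" "u \<notin> P f" for f u
  proof -
    obtain w t where w: "w \<in> W" "lam w = u" "t \<in> T" "w \<in> t" using u(1) unfolding Q_def by blast
    have "t \<noteq> f" using u(2) w tr.subset_UP[of "S0 \<union> f"] unfolding P_def by blast
    moreover have "f \<in> co.up t"
      using f(2) w co.root_in_up unfolding beyond_def Sub_def by blast
    ultimately obtain c where c: "c \<in> T - {f0}" "q c = f" "c \<in> co.up t"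
      using co.child_towards[OF w(3)] by blast
    have "u \<notin> Pe c" using Pe_P[of c] c(2) u(2) by blast
    moreover have "t \<in> Sub c" using c(3) w(3) unfolding Sub_def by blast
    ultimately have "beyond c u" using fill[OF c(1) _ w(1,2)] w(4) by blast
    then show ?thesis using c by blast
  qed
  have \<pi>Q: "\<pi> v \<in> Q" if "v \<in> V" for v using \<pi>[OF that] unfolding Q_def .
  \<comment> \<open>At most \<open>k + 2\<close> vertices on a route mean at most
    \<open>k + 1\<close> steps, each changing the level by at most one.\<close>
  have route': "\<exists>us. us \<noteq> [] \<and> us ! 0 = \<pi> a \<and> us ! (length us - 1) = \<pi> b \<and> length us \<le> k + 2 \<and>
      (\<forall>u\<in>set us. a \<in> cops u \<or> b \<in> cops u) \<and>
      (\<forall>i. Suc i < length us \<longrightarrow> (\<exists>w w'. vadj T w w' \<and> lam w = us ! i \<and> lam w' = us ! Suc i)) \<and>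
      (\<forall>i<length us. near (k + 1) (D (us ! i)) (D (\<pi> a)))"
    if ab: "{a, b} \<in> E" "a \<in> V" "b \<in> V" for a b
  proof -
    from route[OF ab] obtain us where us: "us \<noteq> []" "hd us = \<pi> a" "last us = \<pi> b"
      "length us \<le> k + 2" "\<forall>u\<in>set us. a \<in> cops u \<or> b \<in> cops u"
      "\<And>i. Suc i < length us \<Longrightarrow> (\<exists>w w'. vadj T w w' \<and> lam w = us ! i \<and> lam w' = us ! Suc i)" by metis
    have "near i (D (us ! i)) (D (us ! 0))" if "i < length us" for i
      using that
    proof (induction i)
      case (Suc i)
      obtain w w' where ww: "vadj T w w'" "lam w = us ! i" "lam w' = us ! Suc i" using us(6) Suc by blast
      have "lam w \<in> Q" "lam w' \<in> Q" using vW[OF ww(1)] unfolding Q_def by blast+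
      moreover have "qadj (lam w) (lam w')" using ww(1) unfolding qadj_def by blast
      ultimately have "near 1 (D (lam w)) (D (lam w'))" by (rule D1)
      then have "near 1 (D (us ! Suc i)) (D (us ! i))" using ww near_sym by metis
      from near_trans[OF this Suc.IH] Suc.prems show ?case by simp
    qed (simp add: near_def)
    moreover have "i \<le> k + 1" if "i < length us" for i using that us(4) by linarith
    ultimately have "near (k + 1) (D (us ! i)) (D (\<pi> a))" if "i < length us" for i
      using that near_mono us(1,2) by (metis hd_conv_nth)
    then show ?thesis using us by (intro exI[of _ us]) (auto simp: hd_conv_nth last_conv_nth)
  qed
  have cardP: "finite {u \<in> P f. near R (D u) n}" "card {u \<in> P f. near R (D u) n} \<le> (2 * g + 3) * (2 * R + 1)"
    if f: "f \<in> T" for f R n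
  proof -
    have SW: "S0 \<union> f \<subseteq> W" using S0W f by blast
    have finS: "finite (S0 \<union> f)" using SW fin_W finite_subset by blast
    have "card (S0 \<union> f) \<le> card S0 + card f" by (rule card_Un_le)
    \<comment> \<open>Two ends for each of the at most \<open>g\<close> edges of \<open>X\<close>,
      and the three vertices of \<open>f\<close>.\<close>
    then have cS: "card (S0 \<union> f) \<le> 2 * g + 3" using cardS0 card3[OF f] by simp
    let ?A = "\<lambda>v. {u \<in> lam ` tr.up v. D u \<le> n + R \<and> n \<le> D u + R}"
    have eq: "{u \<in> P f. near R (D u) n} = (\<Union>v\<in>S0 \<union> f. ?A v)"
      unfolding P_def tr.UP_def near_def by blast
    have step: "lam (par y) = lam y \<or> D (lam (par y)) < D (lam y)" if "y \<in> W" "y \<noteq> rt" for y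
      using par[OF that] unfolding N_def by blast
    have A: "finite (?A v)" "card (?A v) \<le> 2 * R + 1" if "v \<in> S0 \<union> f" for v
      using tr.card_level_up[where lam = lam and D = D, OF _ step] that SW by blast+
    show "finite {u \<in> P f. near R (D u) n}" unfolding eq using finS A(1) by blast
    have "card {u \<in> P f. near R (D u) n} \<le> (\<Sum>v\<in>S0 \<union> f. card (?A v))"
      unfolding eq by (rule card_UN_le[OF finS])
    also have "\<dots> \<le> (\<Sum>v\<in>S0 \<union> f. 2 * R + 1)" by (rule sum_mono) (rule A(2))
    also have "\<dots> = card (S0 \<union> f) * (2 * R + 1)" by simp
    also have "\<dots> \<le> (2 * g + 3) * (2 * R + 1)" using cS by (rule mult_le_mono1)
    finally show "card {u \<in> P f. near R (D u) n} \<le> (2 * g + 3) * (2 * R + 1)" .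
  qed
  show ?thesis
  proof (rule cops_win_tree[where F = T and D = D and L = "k + 1" and P = P and Pe = Pe and beyond = beyond
        and \<pi> = \<pi> and cops = cops, OF co fin Pe_P])
    show "\<exists>c\<in>T - {f0}. q c = f0 \<and> beyond c (\<pi> v)" if "v \<in> V" "\<pi> v \<notin> P f0" for v
      using enter[OF f0] \<pi>Q that by blast
    show "\<exists>c\<in>T - {f0}. q c = f \<and> beyond c (\<pi> v)"
      if "f \<in> T - {f0}" "v \<in> V" "\<pi> v \<notin> P f" "beyond f (\<pi> v)" for f v
      using enter[of f] \<pi>Q that by blast
    show "near (k + 1) (D (\<pi> a)) (D (\<pi> b))" if ab: "{a, b} \<in> E" "a \<in> V" "b \<in> V" for a b
    proof -
      obtain us where "us \<noteq> []" "us ! (length us - 1) = \<pi> b" "\<forall>i<length us. near (k + 1) (D (us ! i)) (D (\<pi> a))"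
        using route'[OF ab] by blast
      then show ?thesis using near_sym by (metis diff_less length_greater_0_conv zero_less_one)
    qed
    show "(beyond c (\<pi> b) \<and> \<pi> b \<notin> Pe c) \<or>
        (\<exists>u\<in>Pe c. (a \<in> cops u \<or> b \<in> cops u) \<and> near (k + 1) (D u) (D (\<pi> a)))"
      if ab: "{a, b} \<in> E" "a \<in> V" "b \<in> V" and c: "c \<in> T - {f0}" and a: "\<pi> a \<notin> Pe c" "beyond c (\<pi> a)" for a b c
    \<comment> \<open>Every point of the route has \<open>a\<close> or \<open>b\<close> among its
      cops and is close in level. If the second alternative fails, the whole route therefore avoids
      \<open>Pe c\<close>, and \<open>cross\<close> carries \<open>beyond\<close> from one end to
      the other.\<close>
    proof (rule disjCI)
      assume none: "\<not> (\<exists>u\<in>Pe c. (a \<in> cops u \<or> b \<in> cops u) \<and> near (k + 1) (D u) (D (\<pi> a)))"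
      obtain us where us: "us \<noteq> []" "us ! 0 = \<pi> a" "us ! (length us - 1) = \<pi> b"
        "\<And>u. u \<in> set us \<Longrightarrow> a \<in> cops u \<or> b \<in> cops u"
        "\<And>i. Suc i < length us \<Longrightarrow> \<exists>w w'. vadj T w w' \<and> lam w = us ! i \<and> lam w' = us ! Suc i"
        "\<And>i. i < length us \<Longrightarrow> near (k + 1) (D (us ! i)) (D (\<pi> a))"
        using route'[OF ab] by blast
      have free: "us ! i \<notin> Pe c" if "i < length us" for i
        using none us(4)[OF nth_mem[OF that]] us(6)[OF that] by blast
      have "beyond c (us ! i)" if "i < length us" for i
        using that
      proof (induction i)
        case (Suc i)
        obtain w w' where ww: "vadj T w w'" "lam w = us ! i" "lam w' = us ! Suc i"
          using us(5)[OF Suc.prems] by blast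
        show ?case by (rule cross[OF c _ _ _ ww]) (use free Suc in auto)
      qed (use us a in simp)
      from this[of "length us - 1"] free[of "length us - 1"] us
      show "beyond c (\<pi> b) \<and> \<pi> b \<notin> Pe c" by simp
    qed
    show "finite {u \<in> P f. near (2 * r * (k + 1)) (D u) n}" if "f \<in> T" for f n by (rule cardP(1)[OF that])
    show "card {u \<in> P f. near (2 * r * (k + 1)) (D u) n} \<le> (2 * g + 3) * (4 * r * (k + 1) + 1)"
      if "f \<in> T" for f n using cardP(2)[OF that, of "2 * r * (k + 1)" n] by (simp add: algebra_simps)
  qed (use cops in auto)
qed

section \<open>Barycentric subdivision\<close>

lemma conn_image:
  assumes "conn R A" "\<And>x y. x \<in> A \<Longrightarrow> y \<in> A \<Longrightarrow> R x y \<Longrightarrow> R' (f x) (f y)"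
  shows "conn R' (f ` A)"
proof (rule connI)
  fix B assume B: "B \<subseteq> f ` A" "B \<noteq> {}" and cl: "\<And>x y. x \<in> B \<Longrightarrow> y \<in> f ` A \<Longrightarrow> R' x y \<Longrightarrow> y \<in> B"
  have "{x \<in> A. f x \<in> B} = A"
    by (rule connD[OF assms(1)]) (use B cl assms(2) in blast)+
  then show "B = f ` A" using B by blast
qed

lemma surface_relabel:
  assumes "surface T" and inj: "inj_on f (\<Union>T)"
  shows "surface ((`) f ` T)" "euler ((`) f ` T) = euler T"
proof -
  interpret surface T by (rule assms(1))
  let ?T = "(`) f ` T"
  have U: "\<Union>?T = f ` W" by blast
  have injt: "inj_on f t" if "t \<in> T" for t using inj that by (meson Union_upper inj_on_subset)
  have inje: "inj_on ((`) f) (Pow W)" using inj by (rule inj_on_image_Pow)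
  have injT: "inj_on ((`) f) T" by (rule inj_on_subset[OF inje]) blast
  have sub: "f ` a \<subseteq> f ` b \<longleftrightarrow> a \<subseteq> b" if "a \<subseteq> W" "b \<subseteq> W" for a b
    using inj_on_image_subset_iff[OF inj that] .
  have E: "edges ?T = (`) f ` edges T"
  proof (intro equalityI subsetI)
    fix e' assume "e' \<in> edges ?T"
    then obtain t where t: "card e' = 2" "t \<in> T" "e' \<subseteq> f ` t" unfolding edges_def by blast
    then obtain e where e: "e \<subseteq> t" "e' = f ` e" by (meson subset_imageE)
    moreover have "card e = 2" using t e card_image[OF inj_on_subset[OF injt[OF t(2)] e(1)]] by simp
    ultimately show "e' \<in> (`) f ` edges T" using t unfolding edges_def by blast
  next
    fix e' assume "e' \<in> (`) f ` edges T"
    then obtain e t where e: "e' = f ` e" "card e = 2" "t \<in> T" "e \<subseteq> t" unfolding edges_def by blast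
    then have "card e' = 2" using card_image[OF inj_on_subset[OF injt[OF e(3)] e(4)]] by simp
    then show "e' \<in> edges ?T" using e unfolding edges_def by blast
  qed
  have inter: "f ` s \<inter> f ` t = f ` (s \<inter> t)" if "s \<in> T" "t \<in> T" for s t
    using inj_on_image_Int[OF inj, of s t] that by blast
  have tadj: "tadj (f ` s) (f ` t)" if "tadj s t" "s \<in> T" "t \<in> T" for s t
    using that inter[of s t] card_image[OF inj_on_subset[OF injt[of s]], of "s \<inter> t"] unfolding tadj_def by auto
  show "surface ?T"
  proof
    show "finite ?T" using fin by simp
    show "?T \<noteq> {}" using ne by simp
    show "card t = 3" if "t \<in> ?T" for t using that card3 card_image[OF injt] by auto
    show "card {t \<in> ?T. e' \<subseteq> t} = 2" if "e' \<in> edges ?T" for e'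
    proof -
      from that obtain e where e: "e \<in> edges T" "e' = f ` e" unfolding E by (auto elim: imageE)
      have "e' \<subseteq> f ` t \<longleftrightarrow> e \<subseteq> t" if "t \<in> T" for t
        unfolding e(2) by (rule sub[OF edge_subset[OF e(1)]]) (use that in blast)
      then have "{t \<in> ?T. e' \<subseteq> t} = (`) f ` {t \<in> T. e \<subseteq> t}" by auto
      also have "card \<dots> = card {t \<in> T. e \<subseteq> t}"
        by (rule card_image, rule inj_on_subset[OF injT]) blast
      finally show ?thesis using two[OF e(1)] by simp
    qed
    show "conn tadj {t \<in> ?T. v' \<in> t}" if "v' \<in> \<Union>?T" for v'
    proof -
      from that obtain v where v: "v \<in> W" "v' = f v" by blast
      have "{t \<in> ?T. v' \<in> t} = (`) f ` {t \<in> T. v \<in> t}"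
      proof -
        have "v' \<in> f ` t \<longleftrightarrow> v \<in> t" if "t \<in> T" for t
          unfolding v(2) using inj v(1) by (rule inj_on_image_mem_iff) (use that in blast)
        then show ?thesis by blast
      qed
      then show ?thesis using conn_image[OF link[OF v(1)], of tadj "(`) f"] tadj by auto
    qed
    have "vadj ?T (f x) (f y)" if "vadj T x y" for x y
    proof -
      from that obtain t where t: "x \<noteq> y" "t \<in> T" "x \<in> t" "y \<in> t" unfolding vadj_def by blast
      then have "f x \<noteq> f y" using injt[OF t(2)] by (auto simp: inj_on_def)
      then show ?thesis using t unfolding vadj_def by blast
    qed
    then show "conn (vadj ?T) (\<Union>?T)"
      unfolding U by (intro conn_image[OF conn_verts])
  qed
  have "inj_on ((`) f) (edges T)" by (rule inj_on_subset[OF inje]) (use edge_subset in blast)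
  then show "euler ?T = euler T"
    unfolding euler_def U E by (simp add: card_image inj injT)
qed

lemma card_2_subset_3:
  assumes "card x = 2" "x \<subseteq> {p, q, r}"
  shows "x = {p, q} \<or> x = {p, r} \<or> x = {q, r}"
proof -
  obtain u v where uv: "x = {u, v}" "u \<noteq> v" using assms(1) by (metis card_2_iff)
  with assms(2) have "u \<in> {p, q, r}" "v \<in> {p, q, r}" by auto
  with uv show ?thesis by auto
qed

context surface begin

text \<open>Incident pairs are counted twice: two triangles per edge, three edges per triangle. This
  later removes the number of edges from the Euler characteristic.\<close>

lemma edge_count: "2 * card (edges T) = 3 * card T"
proof -
  have "(\<Sum>e\<in>edges T. card {t \<in> T. e \<subseteq> t}) = (\<Sum>t\<in>T. card {e \<in> edges T. e \<subseteq> t})"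
    using sum.swap_restrict[OF fin_edges fin, of "\<lambda>_ _. 1::nat" "\<lambda>e t. e \<subseteq> t"] by simp
  moreover have "card {e \<in> edges T. e \<subseteq> t} = 3" if "t \<in> T" for t
  proof -
    have "{e \<in> edges T. e \<subseteq> t} = {e. e \<subseteq> t \<and> card e = 2}" using that by (auto simp: edges_def)
    then show ?thesis using n_subsets[OF fin_t[OF that], of 2] card3[OF that]
      by (simp add: numeral_eq_Suc)
  qed
  ultimately show ?thesis using two by simp
qed

text \<open>A flag consists of a vertex of an edge of a triangle; the flags are the triangles of the
  barycentric subdivision.\<close>

definition flags :: "('b set \<times> 'b set \<times> 'b) set" where
  "flags = (SIGMA t : T. SIGMA e : {e. e \<subseteq> t \<and> card e = 2}. e)"

definition flag :: "'b set \<times> 'b set \<times> 'b \<Rightarrow> 'b set set" where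
  "flag = (\<lambda>(t, e, a). {{a}, e, t})"

definition sd :: "'b set set set" where
  "sd = flag ` flags"

lemma flags_iff: "(t, e, a) \<in> flags \<longleftrightarrow> t \<in> T \<and> e \<subseteq> t \<and> card e = 2 \<and> a \<in> e"
  unfolding flags_def by auto

lemma flag_cases:
  assumes "F \<in> sd"
  obtains t e a where "t \<in> T" "e \<subseteq> t" "card e = 2" "a \<in> e" "F = {{a}, e, t}"
  using assms unfolding sd_def flag_def flags_def by auto

lemma sdI: "t \<in> T \<Longrightarrow> e \<subseteq> t \<Longrightarrow> card e = 2 \<Longrightarrow> a \<in> e \<Longrightarrow> {{a}, e, t} \<in> sd"
  unfolding sd_def by (rule image_eqI[of _ _ "(t, e, a)"]) (auto simp: flags_iff flag_def)

text \<open>A vertex of the subdivision is a face, given as a set of old vertices; the cardinalities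
  1, 2, 3 tell the members of a flag apart.\<close>

lemma flag_mem:
  assumes "t \<in> T" "card e = 2"
  shows "{b} \<in> {{a}, e, t} \<longleftrightarrow> a = b"
    and "card f = 2 \<Longrightarrow> f \<in> {{a}, e, t} \<longleftrightarrow> f = e"
    and "s \<in> T \<Longrightarrow> s \<in> {{a}, e, t} \<longleftrightarrow> s = t"
  using card3[of t] card3[of s] assms by auto

lemma inj_flag: "inj_on flag flags"
proof (rule inj_onI)
  fix x y assume xy: "x \<in> flags" "y \<in> flags" "flag x = flag y"
  obtain t e a t' e' a' where x: "x = (t, e, a)" and y: "y = (t', e', a')" by (metis prod.exhaust)
  from xy have f: "(t, e, a) \<in> flags" "(t', e', a') \<in> flags" and eq: "flag (t, e, a) = flag (t', e', a')"
    unfolding x y by auto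
  from f have f': "t \<in> T" "card e = 2" "t' \<in> T" "card e' = 2" by (auto simp: flags_iff)
  have "{{a}, e, t} = {{a'}, e', t'}" using eq by (simp add: flag_def)
  then have "{a} \<in> {{a'}, e', t'}" "e \<in> {{a'}, e', t'}" "t \<in> {{a'}, e', t'}" by blast+
  with flag_mem[OF f'(3,4)] f' have "t = t' \<and> e = e' \<and> a = a'" by metis
  then show "x = y" unfolding x y by simp
qed

lemma card_flag: "t \<in> T \<Longrightarrow> card e = 2 \<Longrightarrow> card {{a}, e, t} = 3"
  using flag_mem[of t e] card3[of t] by (auto simp: card_insert_if)

text \<open>A triangle has three edges with two ends each, hence six flags.\<close>

lemma card_sd: "card sd = 6 * card T"
proof -
  have two_sub: "finite {e. e \<subseteq> t \<and> card e = 2}" "card {e. e \<subseteq> t \<and> card e = 2} = 3" if "t \<in> T" for t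
    using n_subsets[OF fin_t[OF that], of 2] card3[OF that] fin_t[OF that]
    by (auto simp: numeral_eq_Suc)
  have "card (SIGMA e : {e. e \<subseteq> t \<and> card e = 2}. e) = 6" if "t \<in> T" for t
  proof -
    have "card (SIGMA e : {e. e \<subseteq> t \<and> card e = 2}. e) = (\<Sum>e\<in>{e. e \<subseteq> t \<and> card e = 2}. card e)"
      using two_sub(1)[OF that] fin_t[OF that] finite_subset by (intro card_SigmaI) blast+
    then show ?thesis using two_sub(2)[OF that] by simp
  qed
  moreover have "finite (SIGMA e : {e. e \<subseteq> t \<and> card e = 2}. e)" if "t \<in> T" for t
    using two_sub(1)[OF that] fin_t[OF that] finite_subset by (intro finite_SigmaI) blast+
  ultimately have "card flags = 6 * card T"
    unfolding flags_def using fin by (subst card_SigmaI) auto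
  then show ?thesis unfolding sd_def using card_image[OF inj_flag] by simp
qed

lemma subedge:
  assumes "t \<in> T" "a \<in> t"
  obtains e where "e \<subseteq> t" "card e = 2" "a \<in> e"
proof -
  have "\<not> t \<subseteq> {a}" using card3[OF assms(1)] card_mono[of "{a}" t] by auto
  then obtain b where "b \<in> t" "b \<noteq> a" by blast
  then show ?thesis using assms by (intro that[of "{a, b}"]) auto
qed

lemma Union_sd: "\<Union>sd = (\<lambda>a. {a}) ` W \<union> edges T \<union> T"
proof (intro equalityI subsetI)
  fix s assume "s \<in> \<Union>sd"
  then show "s \<in> (\<lambda>a. {a}) ` W \<union> edges T \<union> T"
    by (auto elim!: flag_cases simp: edges_def)
next
  fix s assume "s \<in> (\<lambda>a. {a}) ` W \<union> edges T \<union> T"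
  then consider (v) a t where "s = {a}" "t \<in> T" "a \<in> t" | (e) t where "t \<in> T" "s \<subseteq> t" "card s = 2"
    | (t) "s \<in> T" unfolding edges_def by blast
  then show "s \<in> \<Union>sd"
  proof cases
    case v
    then show ?thesis by (metis subedge sdI insertI1 UnionI)
  next
    case e
    then obtain a where "a \<in> s" by fastforce
    with sdI[OF e(1,2,3)] show ?thesis by blast
  next
    case t
    then obtain a where a: "a \<in> s" using card3[OF t] by fastforce
    then obtain e where "e \<subseteq> s" "card e = 2" "a \<in> e" using subedge t by metis
    with sdI[OF t] show ?thesis by blast
  qed
qed

lemma Union_sd_cases:
  assumes "s \<in> \<Union>sd" shows "s \<subseteq> W" "s \<noteq> {}" "finite s"
proof -
  from assms consider a where "s = {a}" "a \<in> W" | "s \<in> edges T" | "s \<in> T" unfolding Union_sd by blast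
  then have "s \<subseteq> W \<and> s \<noteq> {}"
  proof cases
    case 2
    then have "card s = 2" unfolding edges_def by blast
    then show ?thesis using edge_subset[OF 2] by auto
  next
    case 3
    then show ?thesis using card3[OF 3] by auto
  qed auto
  then show "s \<subseteq> W" "s \<noteq> {}" "finite s" using fin_W finite_subset by auto
qed

lemma card_Union_sd: "card (\<Union>sd) = card W + card (edges T) + card T"
proof -
  have "(\<lambda>a. {a}) ` W \<inter> edges T = {}" by (auto simp: edges_def)
  moreover have "((\<lambda>a. {a}) ` W \<union> edges T) \<inter> T = {}" using card3 by (fastforce simp: edges_def)
  moreover have "card ((\<lambda>a. {a}) ` W) = card W" by (simp add: card_image)
  ultimately show ?thesis
    unfolding Union_sd using fin fin_W fin_edges by (simp add: card_Un_disjoint)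
qed

lemma triangle_eq:
  assumes "t \<in> T" "e \<subseteq> t" "card e = 2" "a \<in> e"
  obtains b c where "e = {a, b}" "t = {a, b, c}" "a \<noteq> b" "c \<noteq> a" "c \<noteq> b"
proof -
  obtain b where b: "e = {a, b}" "a \<noteq> b"
    using assms(3,4) by (metis card_2_iff insert_commute insertE singletonD)
  have "\<not> t \<subseteq> {a, b}" using card3[OF assms(1)] card_mono[of "{a, b}" t] b by auto
  then obtain c where c: "c \<in> t" "c \<noteq> a" "c \<noteq> b" by blast
  have "{a, b, c} \<subseteq> t" using b c assms by auto
  then have "t = {a, b, c}"
    using card_subset_eq[OF fin_t[OF assms(1)], of "{a, b, c}"] card3[OF assms(1)] b c by auto
  then show ?thesis using that[OF b(1) _ b(2) c(2,3)] by blast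
qed

text \<open>An edge of the subdivision is a flag with one member removed, and it can be completed by
  either triangle at \<open>e\<close>, by either edge of \<open>t\<close> at \<open>a\<close>, or by
  either end of \<open>e\<close>. The star of an old vertex inherits its connectedness from
  \<open>link\<close>; at an edge and at a triangle there are only four and six flags, in a
  ring.\<close>

lemma surface_sd: "surface sd"
proof
  show "finite sd" unfolding sd_def flags_def using fin fin_t
    by (intro finite_imageI finite_SigmaI) (auto intro: finite_subset)
  show "sd \<noteq> {}" using card_sd ne fin by fastforce
  show sd3: "card F = 3" if "F \<in> sd" for F
    using that by (auto elim!: flag_cases simp: card_flag)
  have adj: "tadj F F'" if "F \<in> sd" "F' \<in> sd" "F \<noteq> F'" "{x, y} \<subseteq> F \<inter> F'" "x \<noteq> y" for F F' x y
  proof -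
    have fin: "finite F" "finite F'" using sd3 that by (auto intro: card_ge_0_finite)
    have "card {x, y} \<le> card (F \<inter> F')" using that fin by (intro card_mono) auto
    moreover have "\<not> F \<subseteq> F'" using card_subset_eq[OF fin(2)] sd3 that by metis
    then have "card (F \<inter> F') < card F" using fin by (intro psubset_card_mono) auto
    ultimately show ?thesis unfolding tadj_def using sd3 that by simp
  qed
  show "card {F \<in> sd. x \<subseteq> F} = 2" if x: "x \<in> edges sd" for x
  proof -
    obtain F where F: "F \<in> sd" "card x = 2" "x \<subseteq> F" using x unfolding edges_def by auto
    then obtain t e a where f: "t \<in> T" "e \<subseteq> t" "card e = 2" "a \<in> e" "F = {{a}, e, t}"
      by (metis flag_cases)
    obtain b c where b: "e = {a, b}" and t: "t = {a, b, c}" and ne: "a \<noteq> b" "c \<noteq> a" "c \<noteq> b"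
      using triangle_eq[OF f(1-4)] .
    note b = b ne(1) and c = ne(2,3)
    have "e \<noteq> {a}" "t \<noteq> {a}" "t \<noteq> e" using b c t by auto
    then consider (ve) "x = {{a}, e}" | (vt) "x = {{a}, t}" | (et) "x = {e, t}"
      using card_2_subset_3[OF F(2) F(3)[unfolded f(5)]] by argo
    then show ?thesis
    proof cases
      case ve
      have "{F \<in> sd. x \<subseteq> F} = (\<lambda>t. {{a}, e, t}) ` {t \<in> T. e \<subseteq> t}"
      proof (intro equalityI subsetI)
        fix F assume F: "F \<in> {F \<in> sd. x \<subseteq> F}"
        then obtain t' e' a' where f': "t' \<in> T" "e' \<subseteq> t'" "card e' = 2" "a' \<in> e'" "F = {{a'}, e', t'}"
          by (metis flag_cases mem_Collect_eq)
        then have "a' = a" "e' = e" using F flag_mem[OF f'(1,3)] f(3) unfolding ve by auto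
        with f' show "F \<in> (\<lambda>t. {{a}, e, t}) ` {t \<in> T. e \<subseteq> t}" by blast
      qed (use f ve sdI in auto)
      moreover have "inj_on (\<lambda>t. {{a}, e, t}) {t \<in> T. e \<subseteq> t}"
      proof (rule inj_onI)
        fix s s' assume "s \<in> {t \<in> T. e \<subseteq> t}" "s' \<in> {t \<in> T. e \<subseteq> t}" "{{a}, e, s} = {{a}, e, s'}"
        then show "s = s'" using flag_mem(3)[of s' e s a] f by auto
      qed
      moreover have "e \<in> edges T" using f unfolding edges_def by blast
      ultimately show ?thesis using two by (simp add: card_image)
    next
      case vt
      have "{F \<in> sd. x \<subseteq> F} = {{{a}, {a, b}, t}, {{a}, {a, c}, t}}"
      proof (intro equalityI subsetI)
        fix F assume F: "F \<in> {F \<in> sd. x \<subseteq> F}"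
        then obtain t' e' a' where f': "t' \<in> T" "e' \<subseteq> t'" "card e' = 2" "a' \<in> e'" "F = {{a'}, e', t'}"
          by (metis flag_cases mem_Collect_eq)
        then have at: "a' = a" "t' = t" using F flag_mem[OF f'(1,3)] f(1) unfolding vt by auto
        then obtain d where "e' = {a, d}" "d \<noteq> a" using f' by (metis card_2_iff insert_commute insertE singletonD)
        then show "F \<in> {{{a}, {a, b}, t}, {{a}, {a, c}, t}}" using f' at t by auto
      qed (use f vt b c t sdI[OF f(1)] in auto)
      moreover have "{{a}, {a, b}, t} \<noteq> {{a}, {a, c}, t}"
      proof -
        have "{a, b} \<noteq> {a}" "{a, b} \<noteq> {a, c}" "{a, b} \<noteq> t" using b c t by auto
        then have "{a, b} \<notin> {{a}, {a, c}, t}" by simp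
        then show ?thesis by (metis insertI1 insertI2)
      qed
      ultimately show ?thesis by simp
    next
      case et
      have "{F \<in> sd. x \<subseteq> F} = {{{a}, e, t}, {{b}, e, t}}"
      proof (intro equalityI subsetI)
        fix F assume F: "F \<in> {F \<in> sd. x \<subseteq> F}"
        then obtain t' e' a' where f': "t' \<in> T" "e' \<subseteq> t'" "card e' = 2" "a' \<in> e'" "F = {{a'}, e', t'}"
          by (metis flag_cases mem_Collect_eq)
        then have "e' = e" "t' = t" using F flag_mem[OF f'(1,3)] f(1,3) unfolding et by auto
        then show "F \<in> {{{a}, e, t}, {{b}, e, t}}" using f' b by auto
      qed (use f et b sdI[OF f(1-3)] in auto)
      moreover have "{{a}, e, t} \<noteq> {{b}, e, t}"
        using flag_mem(1)[OF f(1,3), of a b] b by auto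
      ultimately show ?thesis by simp
    qed
  qed
  show "conn tadj {F \<in> sd. x \<in> F}" if x: "x \<in> \<Union>sd" for x
  proof (rule connI)
    fix B assume B: "B \<subseteq> {F \<in> sd. x \<in> F}" "B \<noteq> {}"
      and cl0: "\<And>F F'. F \<in> B \<Longrightarrow> F' \<in> {F \<in> sd. x \<in> F} \<Longrightarrow> tadj F F' \<Longrightarrow> F' \<in> B"
    have cl: "F' \<in> B" if "F \<in> B" "F' \<in> sd" "{x, y} \<subseteq> F \<inter> F'" "x \<noteq> y" for F F' y
      using cl0[of F F'] adj[of F F' x y] that B by (cases "F = F'") auto
    obtain F0 where F0: "F0 \<in> B" using B by blast
    then obtain t0 e0 a0 where f0: "t0 \<in> T" "e0 \<subseteq> t0" "card e0 = 2" "a0 \<in> e0" "F0 = {{a0}, e0, t0}" "x \<in> F0"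
      using B by (metis (no_types, lifting) flag_cases mem_Collect_eq subsetD)
    have "F \<in> B" if F: "F \<in> sd" "x \<in> F" for F
    proof -
      obtain t e a where f: "t \<in> T" "e \<subseteq> t" "card e = 2" "a \<in> e" "F = {{a}, e, t}"
        using F by (metis flag_cases)
      consider (v) "x = {a0}" | (e) "x = e0" | (t) "x = t0" using f0 by blast
      then show ?thesis
      proof cases
        case v
        have a: "a = a0" using F f v flag_mem[OF f(1,3)] by auto
        have all: "{{a0}, e', t'} \<in> B" if "{{a0}, e, t'} \<in> B" "t' \<in> T" "card e = 2" "e' \<subseteq> t'" "card e' = 2" "a0 \<in> e'" for t' e e'
        proof (rule cl[OF that(1) sdI[OF that(2,4,5,6)]])
          show "x \<noteq> t'" using card3[OF that(2)] v by auto
        qed (use v in auto)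
        \<comment> \<open>The old triangles at \<open>a0\<close> that own a flag in
          \<open>B\<close>. Within \<open>s\<close> the edge of the flag can be changed to
          \<open>s \<inter> s'\<close>, and then the triangle alone is exchanged for
          \<open>s'\<close>; so this set is closed under adjacency.\<close>
        let ?A = "{t \<in> T. a0 \<in> t \<and> (\<exists>e. card e = 2 \<and> {{a0}, e, t} \<in> B)}"
        have "?A = {t \<in> T. a0 \<in> t}"
        proof (rule connD[OF link])
          show "a0 \<in> W" using f0 by blast
          show "?A \<noteq> {}" using f0 F0 by blast
          fix s s' assume s: "s \<in> ?A" "s' \<in> {t \<in> T. a0 \<in> t}" "tadj s s'"
          then obtain e where e: "card e = 2" "{{a0}, e, s} \<in> B" by blast
          have ss: "card (s \<inter> s') = 2" using s unfolding tadj_def by simp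
          have "{{a0}, s \<inter> s', s} \<in> B" by (rule all[OF e(2) _ e(1) _ ss]) (use s in auto)
          moreover have "{{a0}, s \<inter> s', s'} \<in> sd" using s ss by (intro sdI) auto
          moreover have "s \<inter> s' \<noteq> {a0}" using ss by auto
          ultimately have "{{a0}, s \<inter> s', s'} \<in> B" using cl[of _ _ "s \<inter> s'"] v by auto
          then show "s' \<in> ?A" using s ss by blast
        qed blast
        then have "t \<in> ?A" using f a by blast
        then show ?thesis using all f a by blast
      next
        case e
        then have ee: "e = e0" using F f f0 flag_mem[OF f(1,3)] by auto
        have "{{a}, e0, t0} \<in> B"
          by (rule cl[OF F0 sdI, of _ _ _ t0]) (use f0 f ee e card3[OF f0(1)] in auto)
        then show ?thesis
          unfolding f(5) ee by (rule cl[OF _ sdI, of _ _ _ _ "{a}"]) (use f f0 ee e in auto)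
      next
        case t
        then have tt: "t = t0" using F f f0 flag_mem[OF f(1,3)] by auto
        \<comment> \<open>Disjoint edges would need four vertices in one triangle. A common end
          \<open>z\<close> links the two flags: first the end is changed to \<open>z\<close>, then
          the edge, then the end again.\<close>
        have "e \<inter> e0 \<noteq> {}"
        proof
          assume "e \<inter> e0 = {}"
          then have "card (e \<union> e0) = 4" using f(3) f0(3) by (subst card_Un_disjoint) (auto intro: card_ge_0_finite)
          moreover have "card (e \<union> e0) \<le> card t0" using f f0 tt fin_t by (intro card_mono) auto
          ultimately show False using card3 f0 by simp
        qed
        then obtain z where z: "z \<in> e" "z \<in> e0" by blast
        have ne: "t0 \<noteq> {z}" "t0 \<noteq> e" "t0 \<noteq> e0" using card3[OF f0(1)] f f0 by auto
        have "{{z}, e0, t0} \<in> B"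
          by (rule cl[OF F0 sdI, of _ _ _ e0]) (use f0 z t ne in auto)
        then have "{{z}, e, t0} \<in> B"
          by (rule cl[OF _ sdI, of _ _ _ _ "{z}"]) (use f f0 tt z t ne in auto)
        then show ?thesis
          unfolding f(5) tt by (rule cl[OF _ sdI, of _ _ _ _ e]) (use f f0 tt t ne in auto)
      qed
    qed
    then show "B = {F \<in> sd. x \<in> F}" using B by blast
  qed
  show "conn (vadj sd) (\<Union>sd)"
  proof (rule connI)
    fix B assume B: "B \<subseteq> \<Union>sd" "B \<noteq> {}"
      and cl: "\<And>x y. x \<in> B \<Longrightarrow> y \<in> \<Union>sd \<Longrightarrow> vadj sd x y \<Longrightarrow> y \<in> B"
    have fl: "y \<in> B" if "F \<in> sd" "x \<in> F" "y \<in> F" "x \<in> B" for F x y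
      using cl[of x y] that unfolding vadj_def by (cases "x = y") auto
    \<comment> \<open>A face and each of its vertices lie in a common flag, so \<open>B\<close> is
      determined by the old vertices in it.\<close>
    have vert: "{a} \<in> B \<longleftrightarrow> s \<in> B" if s: "s \<in> \<Union>sd" "a \<in> s" for s a
    proof -
      have "\<exists>F\<in>sd. {a} \<in> F \<and> s \<in> F"
      proof -
        from s obtain F where "F \<in> sd" "s \<in> F" by blast
        then obtain t e b where f: "t \<in> T" "e \<subseteq> t" "card e = 2" "b \<in> e" "s = {b} \<or> s = e \<or> s = t" "F = {{b}, e, t}"
          by (metis flag_cases insertE singletonD)
        from f(5) show ?thesis
        proof (elim disjE)
          assume "s = t"
          with s f obtain e' where "e' \<subseteq> t" "card e' = 2" "a \<in> e'" using subedge by metis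
          then have "{{a}, e', t} \<in> sd" by (intro sdI f(1))
          with \<open>s = t\<close> show ?thesis by (intro bexI[of _ "{{a}, e', t}"]) simp_all
        next
          assume "s = {b}"
          with s sdI[OF f(1-4)] show ?thesis by (intro bexI[of _ "{{b}, e, t}"]) simp_all
        next
          assume "s = e"
          with s sdI[OF f(1-3), of a] show ?thesis by (intro bexI[of _ "{{a}, e, t}"]) simp_all
        qed
      qed
      then show ?thesis using fl by blast
    qed
    let ?A = "{a \<in> W. {a} \<in> B}"
    have "?A = W"
    proof (rule connD[OF conn_verts])
      obtain s where sB: "s \<in> B" using B(2) by blast
      then have s: "s \<in> \<Union>sd" by (rule subsetD[OF B(1)])
      from Union_sd_cases(1,2)[OF s] obtain a where "a \<in> s" "a \<in> W" by blast
      then show "?A \<noteq> {}" using vert[OF s, of a] sB by blast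
      fix a b assume a: "a \<in> ?A" and b: "b \<in> W" and ab: "vadj T a b"
      then have ab': "{a, b} \<in> \<Union>sd" unfolding Union_sd vadj_edges by blast
      show "b \<in> ?A" using vert[OF ab', of a] vert[OF ab', of b] a b by simp
    qed blast
    then have A: "{a} \<in> B" if "a \<in> W" for a using that by blast
    have "s \<in> B" if s: "s \<in> \<Union>sd" for s
    proof -
      from Union_sd_cases(1,2)[OF s] obtain a where "a \<in> s" "a \<in> W" by blast
      then show ?thesis using vert[OF s, of a] A[of a] by simp
    qed
    then show "B = \<Union>sd" using B by blast
  qed
qed

text \<open>With V vertices, E edges and F triangles, \<open>edge_count\<close> turns the Euler
  characteristic into V - F/2. The subdivision has V + E + F vertices and 6F triangles, and V + E +
  F - 3F = V - F/2 because E = 3F/2.\<close>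

lemma euler_sd: "euler sd = euler T"
proof -
  have "2 * int (card (edges sd)) = 3 * int (card sd)"
    using surface.edge_count[OF surface_sd] by linarith
  moreover have "2 * int (card (edges T)) = 3 * int (card T)"
    using edge_count by linarith
  ultimately show ?thesis
    unfolding euler_def card_Union_sd using card_sd by simp
qed

end

section \<open>Fine triangulations\<close>

lemma continuous_on_Min_image:
  assumes "finite S" "S \<noteq> {}" "\<And>i. i \<in> S \<Longrightarrow> continuous_on M (f i)"
  shows "continuous_on M (\<lambda>x. Min ((\<lambda>i. f i x) ` S) :: real)"
  using assms
proof (induction rule: finite_ne_induct)
  case (insert a S)
  then show ?case by (auto intro!: continuous_intros)
qed simp

lemma continuous_on_Max_image:
  assumes "finite S" "S \<noteq> {}" "\<And>i. i \<in> S \<Longrightarrow> continuous_on M (f i)"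
  shows "continuous_on M (\<lambda>x. Max ((\<lambda>i. f i x) ` S) :: real)"
  using assms
proof (induction rule: finite_ne_induct)
  case (insert a S)
  then show ?case by (auto intro!: continuous_intros)
qed simp

lemma sorted_triple:
  fixes f :: "'b \<Rightarrow> real"
  assumes "card t = 3"
  obtains a b c where "t = {a, b, c}" "a \<noteq> b" "b \<noteq> c" "a \<noteq> c" "f b \<le> f a" "f c \<le> f b"
proof -
  obtain u v w where t: "t = {u, v, w}" "u \<noteq> v" "v \<noteq> w" "u \<noteq> w"
    using assms by (metis card_3_iff)
  consider "f w \<le> f v" "f v \<le> f u" | "f v \<le> f w" "f w \<le> f u" | "f w \<le> f u" "f u \<le> f v"
    | "f u \<le> f w" "f w \<le> f v" | "f v \<le> f u" "f u \<le> f w" | "f u \<le> f v" "f v \<le> f w" by linarith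
  then show ?thesis
  proof cases
    case 1 show ?thesis by (rule that[of u v w]) (use t 1 in auto)
  next
    case 2 show ?thesis by (rule that[of u w v]) (use t 2 in auto)
  next
    case 3 show ?thesis by (rule that[of v u w]) (use t 3 in auto)
  next
    case 4 show ?thesis by (rule that[of v w u]) (use t 4 in auto)
  next
    case 5 show ?thesis by (rule that[of w u v]) (use t 5 in auto)
  next
    case 6 show ?thesis by (rule that[of w v u]) (use t 6 in auto)
  qed
qed

text \<open>The functions \<open>\<beta> w\<close> are barycentric coordinates on the space \<open>M\<close> with respect to the
  vertex positions \<open>p w\<close>, and \<open>\<delta>\<close> bounds the mesh.\<close>

definition tri_cover :: "'b set set \<Rightarrow> ('b \<Rightarrow> 'e::real_normed_vector) \<Rightarrow> ('b \<Rightarrow> 'e \<Rightarrow> real) \<Rightarrow> 'e set \<Rightarrow> real \<Rightarrow> bool" where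
  "tri_cover T p \<beta> M \<delta> \<longleftrightarrow> surface T \<and> (\<forall>w\<in>\<Union>T. continuous_on M (\<beta> w)) \<and>
     (\<forall>x\<in>M. \<exists>t\<in>T. (\<forall>w\<in>\<Union>T - t. \<beta> w x = 0) \<and> (\<forall>w\<in>t. 0 \<le> \<beta> w x) \<and>
        (\<Sum>w\<in>t. \<beta> w x) = 1 \<and> (\<Sum>w\<in>t. \<beta> w x *\<^sub>R p w) = x) \<and>
     (\<forall>t\<in>T. \<forall>v\<in>t. \<forall>w\<in>t. norm (p v - p w) \<le> \<delta>)"

lemma tri_cover_mono: "tri_cover T p \<beta> M \<delta> \<Longrightarrow> \<delta> \<le> \<epsilon> \<Longrightarrow> tri_cover T p \<beta> M \<epsilon>"
  unfolding tri_cover_def by (meson order_trans)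

lemma tri_cover_relabel:
  assumes tc: "tri_cover T p \<beta> M \<delta>" and inj: "inj_on f (\<Union>T)"
  shows "tri_cover ((`) f ` T) (\<lambda>n. p (inv_into (\<Union>T) f n)) (\<lambda>n. \<beta> (inv_into (\<Union>T) f n)) M \<delta>"
proof -
  have g: "inv_into (\<Union>T) f (f w) = w" if "w \<in> \<Union>T" for w
    using inj that by (rule inv_into_f_f)
  have U: "\<Union>((`) f ` T) = f ` \<Union>T" by blast
  have "\<exists>t\<in>(`) f ` T. (\<forall>w\<in>\<Union>((`) f ` T) - t. \<beta> (inv_into (\<Union>T) f w) x = 0) \<and>
      (\<forall>w\<in>t. 0 \<le> \<beta> (inv_into (\<Union>T) f w) x) \<and> (\<Sum>w\<in>t. \<beta> (inv_into (\<Union>T) f w) x) = 1 \<and>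
      (\<Sum>w\<in>t. \<beta> (inv_into (\<Union>T) f w) x *\<^sub>R p (inv_into (\<Union>T) f w)) = x" if x: "x \<in> M" for x
  proof -
    from tc x obtain t where t: "t \<in> T" "\<forall>w\<in>\<Union>T - t. \<beta> w x = 0" "\<forall>w\<in>t. 0 \<le> \<beta> w x"
      "(\<Sum>w\<in>t. \<beta> w x) = 1" "(\<Sum>w\<in>t. \<beta> w x *\<^sub>R p w) = x"
      unfolding tri_cover_def by meson
    have tW: "t \<subseteq> \<Union>T" using t(1) by blast
    have injt: "inj_on f t" using inj_on_subset[OF inj tW] .
    have gt: "inv_into (\<Union>T) f (f w) = w" if "w \<in> t" for w using g that tW by blast
    have "(\<Sum>w\<in>f ` t. \<beta> (inv_into (\<Union>T) f w) x) = 1"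
      using t(4) gt by (simp add: sum.reindex[OF injt])
    moreover have "(\<Sum>w\<in>f ` t. \<beta> (inv_into (\<Union>T) f w) x *\<^sub>R p (inv_into (\<Union>T) f w)) = x"
      using t(5) gt by (simp add: sum.reindex[OF injt])
    moreover have "\<forall>w\<in>f ` t. 0 \<le> \<beta> (inv_into (\<Union>T) f w) x" using t(3) gt by simp
    moreover have "\<beta> (inv_into (\<Union>T) f n) x = 0" if n: "n \<in> f ` \<Union>T - f ` t" for n
    proof -
      from n obtain w where "w \<in> \<Union>T" "n = f w" "w \<notin> t" by blast
      then show ?thesis using t(2) g by simp
    qed
    ultimately show ?thesis unfolding U using t(1) by blast
  qed
  moreover have "norm (p (inv_into (\<Union>T) f v) - p (inv_into (\<Union>T) f w)) \<le> \<delta>"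
    if vw: "t' \<in> (`) f ` T" "v \<in> t'" "w \<in> t'" for t' v w
  proof -
    from vw obtain t v0 w0 where "t \<in> T" "v0 \<in> t" "w0 \<in> t" "v = f v0" "w = f w0" by blast
    moreover from this have "inv_into (\<Union>T) f v = v0" "inv_into (\<Union>T) f w = w0" using g by blast+
    ultimately show ?thesis using tc unfolding tri_cover_def by simp
  qed
  ultimately show ?thesis
    using tc surface_relabel(1)[OF _ inj] g unfolding tri_cover_def U by auto
qed

section \<open>Coordinates and mesh of the barycentric subdivision\<close>

context surface begin

definition sd_pos :: "('b \<Rightarrow> 'e::real_normed_vector) \<Rightarrow> 'b set \<Rightarrow> 'e" where
  "sd_pos p s = (1 / card s) *\<^sub>R sum p s"

text \<open>If the coordinates of \<open>x\<close> are \<open>x\<^sub>a \<ge> x\<^sub>b \<ge> x\<^sub>c\<close>, then the coordinates of \<open>x\<close> in the barycentric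
  subdivision are \<open>x\<^sub>a - x\<^sub>b\<close>, \<open>2 (x\<^sub>b - x\<^sub>c)\<close>, \<open>3 x\<^sub>c\<close> on the flag \<open>a, ab, abc\<close>.\<close>

definition sd_coord :: "('b \<Rightarrow> 'e \<Rightarrow> real) \<Rightarrow> 'b set \<Rightarrow> 'e \<Rightarrow> real" where
  "sd_coord \<beta> s x = real (card s) * max 0 (Min ((\<lambda>i. \<beta> i x) ` s) - Max (insert 0 ((\<lambda>j. \<beta> j x) ` (W - s))))"

text \<open>The definition of \<open>sd_coord\<close> mentions neither a triangle nor an order of
  the coordinates, which makes continuity immediate; here it is evaluated where the order is known.
  A face outside the flag has a vertex whose coordinate is 0 or at most that of a vertex outside the
  face, so the cut-off at 0 applies.\<close>

lemma sd_coord_flag: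
  assumes "t \<in> T" and zero: "\<forall>w\<in>W - t. \<beta> w x = 0" and t: "t = {a, b, c}" "a \<noteq> b" "b \<noteq> c" "a \<noteq> c"
    and le: "\<beta> b x \<le> \<beta> a x" "\<beta> c x \<le> \<beta> b x" "0 \<le> \<beta> c x"
  shows "sd_coord \<beta> {a} x = \<beta> a x - \<beta> b x" "sd_coord \<beta> {a, b} x = 2 * (\<beta> b x - \<beta> c x)"
    "sd_coord \<beta> t x = 3 * \<beta> c x"
    "s \<in> \<Union>sd \<Longrightarrow> s \<notin> {{a}, {a, b}, t} \<Longrightarrow> sd_coord \<beta> s x = 0"
proof -
  have abc: "a \<in> W" "b \<in> W" "c \<in> W" using assms(1) t(1) by blast+
  have rest: "\<beta> w x \<le> \<beta> c x" if "w \<in> W" "w \<noteq> a" "w \<noteq> b" for w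
    using that zero t(1) le(3) by (cases "w = c") auto
  have "Max (insert 0 ((\<lambda>j. \<beta> j x) ` (W - {a}))) = \<beta> b x"
  proof (rule Max_eqI)
    fix y assume "y \<in> insert 0 ((\<lambda>j. \<beta> j x) ` (W - {a}))"
    then consider "y = 0" | j where "y = \<beta> j x" "j \<in> W" "j \<noteq> a" by blast
    then show "y \<le> \<beta> b x"
    proof cases
      case 2
      then show ?thesis using rest[of j] le by (cases "j = b") auto
    qed (use le in simp)
  qed (use fin_W abc t in auto)
  then show "sd_coord \<beta> {a} x = \<beta> a x - \<beta> b x" unfolding sd_coord_def using le by simp
  have "Max (insert 0 ((\<lambda>j. \<beta> j x) ` (W - {a, b}))) = \<beta> c x"
  proof (rule Max_eqI)
    fix y assume "y \<in> insert 0 ((\<lambda>j. \<beta> j x) ` (W - {a, b}))"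
    then show "y \<le> \<beta> c x" using rest le by auto
  qed (use fin_W abc t in auto)
  then show "sd_coord \<beta> {a, b} x = 2 * (\<beta> b x - \<beta> c x)"
    unfolding sd_coord_def using le t(2) by simp
  have "Max (insert 0 ((\<lambda>j. \<beta> j x) ` (W - t))) = 0"
    by (rule Max_eqI) (use fin_W zero in auto)
  then show "sd_coord \<beta> t x = 3 * \<beta> c x"
    unfolding sd_coord_def using le t by simp
  assume s: "s \<in> \<Union>sd" and sF: "s \<notin> {{a}, {a, b}, t}"
  note sW = Union_sd_cases[OF s]
  have "\<exists>i\<in>s. \<beta> i x = 0 \<or> (\<exists>j\<in>W - s. \<beta> i x \<le> \<beta> j x)"
  proof (cases "s \<subseteq> t")
    case False
    then show ?thesis using zero sW by blast
  next
    case True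
    consider (a) i where "a \<notin> s" "i \<in> s" | (b) "a \<in> s" "b \<notin> s" "c \<in> s" | (c) "a \<in> s" "b \<in> s" "c \<in> s"
      using sW(2) True sF unfolding t(1) by blast
    then show ?thesis
    proof cases
      case a
      then have "\<beta> i x \<le> \<beta> a x" using True le unfolding t(1) by auto
      then show ?thesis using a abc by blast
    next
      case b then show ?thesis using abc le by blast
    next
      case c then show ?thesis using True sF unfolding t(1) by blast
    qed
  qed
  then obtain i where i: "i \<in> s" "\<beta> i x = 0 \<or> (\<exists>j\<in>W - s. \<beta> i x \<le> \<beta> j x)" by blast
  have "Min ((\<lambda>i. \<beta> i x) ` s) \<le> \<beta> i x" using i sW by simp
  also have "\<beta> i x \<le> Max (insert 0 ((\<lambda>j. \<beta> j x) ` (W - s)))"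
    using i(2)
  proof
    assume "\<exists>j\<in>W - s. \<beta> i x \<le> \<beta> j x"
    then obtain j where j: "j \<in> W - s" "\<beta> i x \<le> \<beta> j x" by blast
    have "\<beta> j x \<le> Max (insert 0 ((\<lambda>j. \<beta> j x) ` (W - s)))" by (rule Max_ge) (use j fin_W in auto)
    with j show ?thesis by linarith
  qed (use fin_W in simp)
  finally show "sd_coord \<beta> s x = 0" unfolding sd_coord_def by simp
qed

text \<open>Differences of these barycentres are half of one edge vector, a third of a sum of two,
  or a sixth of a sum of two. The worst factor is 2/3.\<close>

lemma sd_pos_mesh:
  assumes mesh: "\<forall>v\<in>t. \<forall>w\<in>t. norm (p v - p w) \<le> \<delta>" and F: "t \<in> T" "e \<subseteq> t" "card e = 2" "a \<in> e"
    and s: "s \<in> {{a}, e, t}" "s' \<in> {{a}, e, t}"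
  shows "norm (sd_pos p s - sd_pos p s') \<le> 2 / 3 * \<delta>"
proof -
  obtain b c where b: "e = {a, b}" and t: "t = {a, b, c}" and ne: "a \<noteq> b" "c \<noteq> a" "c \<noteq> b"
    using triangle_eq[OF F] .
  have ab: "norm (p a - p b) \<le> \<delta>" and ac: "norm (p a - p c) \<le> \<delta>" and bc: "norm (p b - p c) \<le> \<delta>"
    using mesh t by auto
  then have \<delta>: "0 \<le> \<delta>" using norm_ge_zero order_trans by blast
  have pos: "sd_pos p {a} = p a" "sd_pos p e = (1/2) *\<^sub>R (p a + p b)" "sd_pos p t = (1/3) *\<^sub>R (p a + p b + p c)"
    using b ne unfolding t by (auto simp: sd_pos_def algebra_simps)
  have ae: "norm (sd_pos p {a} - sd_pos p e) \<le> 2 / 3 * \<delta>"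
  proof -
    have "sd_pos p {a} - sd_pos p e = (1/2) *\<^sub>R (p a - p b)"
      unfolding pos by (simp add: algebra_simps flip: scaleR_left_distrib)
    then show ?thesis using ab \<delta> by simp
  qed
  have at: "norm (sd_pos p {a} - sd_pos p t) \<le> 2 / 3 * \<delta>"
  proof -
    have "sd_pos p {a} - sd_pos p t = (1/3) *\<^sub>R ((p a - p b) + (p a - p c))"
      unfolding pos by (simp add: algebra_simps flip: scaleR_left_distrib)
    then show ?thesis using norm_triangle_ineq[of "p a - p b" "p a - p c"] ab ac by simp
  qed
  have et: "norm (sd_pos p e - sd_pos p t) \<le> 2 / 3 * \<delta>"
  proof -
    have "sd_pos p e - sd_pos p t = (1/6) *\<^sub>R ((p a - p c) + (p b - p c))"
      unfolding pos by (simp add: algebra_simps flip: scaleR_left_distrib)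
    then show ?thesis using norm_triangle_ineq[of "p a - p c" "p b - p c"] ac bc \<delta> by simp
  qed
  have "norm (sd_pos p s - sd_pos p s) \<le> 2 / 3 * \<delta>" for s using \<delta> by simp
  then show ?thesis using s ae at et norm_minus_commute[of "sd_pos p s"] by auto
qed

lemma tri_cover_sd:
  assumes tc: "tri_cover T p \<beta> M \<delta>"
  shows "tri_cover sd (sd_pos p) (sd_coord \<beta>) M (2 / 3 * \<delta>)"
proof -
  have cont: "continuous_on M (sd_coord \<beta> s)" if s: "s \<in> \<Union>sd" for s
  proof -
    note sW = Union_sd_cases[OF s]
    have c\<beta>: "continuous_on M (\<beta> w)" if "t \<in> T" "w \<in> t" for t w using tc that unfolding tri_cover_def by blast
    have "continuous_on M (\<lambda>x. Min ((\<lambda>i. \<beta> i x) ` s))"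
      by (rule continuous_on_Min_image) (use sW c\<beta> in auto)
    moreover have "continuous_on M (\<lambda>x. Max (insert 0 ((\<lambda>j. \<beta> j x) ` (W - s))))"
    proof -
      \<comment> \<open>The constant 0 is treated as one more member of the family, indexed by
        \<open>None\<close>.\<close>
      have "(\<lambda>x. Max (insert 0 ((\<lambda>j. \<beta> j x) ` (W - s)))) =
        (\<lambda>x. Max ((\<lambda>j. case j of None \<Rightarrow> 0 | Some j \<Rightarrow> \<beta> j x) ` (insert None (Some ` (W - s)))))"
        by (simp add: image_image)
      moreover have "continuous_on M \<dots>"
        by (rule continuous_on_Max_image) (use fin_W c\<beta> in \<open>auto split: option.split\<close>)
      ultimately show ?thesis by (simp only:)
    qed
    ultimately show ?thesis unfolding sd_coord_def by (intro continuous_intros)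
  qed
  have "\<exists>F\<in>sd. (\<forall>s\<in>\<Union>sd - F. sd_coord \<beta> s x = 0) \<and> (\<forall>s\<in>F. 0 \<le> sd_coord \<beta> s x) \<and>
        (\<Sum>s\<in>F. sd_coord \<beta> s x) = 1 \<and> (\<Sum>s\<in>F. sd_coord \<beta> s x *\<^sub>R sd_pos p s) = x" if x: "x \<in> M" for x
  proof -
    from tc x obtain t where t: "t \<in> T" "\<forall>w\<in>W - t. \<beta> w x = 0" "\<forall>w\<in>t. 0 \<le> \<beta> w x"
      "(\<Sum>w\<in>t. \<beta> w x) = 1" "(\<Sum>w\<in>t. \<beta> w x *\<^sub>R p w) = x"
      unfolding tri_cover_def by meson
    obtain a b c where abc: "t = {a, b, c}" "a \<noteq> b" "b \<noteq> c" "a \<noteq> c" "\<beta> b x \<le> \<beta> a x" "\<beta> c x \<le> \<beta> b x"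
      using sorted_triple[OF card3[OF t(1)], of "\<lambda>w. \<beta> w x"] by metis
    have c0: "0 \<le> \<beta> c x" using t(3) abc by simp
    note co = sd_coord_flag[of t \<beta> x a b c, OF t(1,2) abc c0]
    let ?F = "{{a}, {a, b}, t}"
    have F: "?F \<in> sd" using abc t(1) by (intro sdI) auto
    have dist: "{a} \<noteq> {a, b}" "{a} \<noteq> t" "{a, b} \<noteq> t" using abc by auto
    have sums: "(\<Sum>s\<in>?F. h s) = h {a} + h {a, b} + h t" for h :: "'b set \<Rightarrow> 'c::comm_monoid_add"
      using dist by (simp add: add.assoc)
    have sumt: "(\<Sum>w\<in>t. h w) = h a + h b + h c" for h :: "'b \<Rightarrow> 'c::comm_monoid_add"
      using abc by (simp add: add.assoc)
    have "(\<Sum>s\<in>?F. sd_coord \<beta> s x) = 1"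
      using t(4) unfolding sums sumt co(1-3) by simp
    moreover have "(\<Sum>s\<in>?F. sd_coord \<beta> s x *\<^sub>R sd_pos p s) = x"
    proof -
      have pos: "sd_pos p {a} = p a" "sd_pos p {a, b} = (1/2) *\<^sub>R (p a + p b)" "sd_pos p t = (1/3) *\<^sub>R (p a + p b + p c)"
        using abc by (auto simp: sd_pos_def algebra_simps)
      have "(\<Sum>s\<in>?F. sd_coord \<beta> s x *\<^sub>R sd_pos p s) = \<beta> a x *\<^sub>R p a + \<beta> b x *\<^sub>R p b + \<beta> c x *\<^sub>R p c"
        unfolding sums co(1-3) pos by (simp add: algebra_simps)
      then show ?thesis using t(5) unfolding sumt by simp
    qed
    moreover have "\<forall>s\<in>?F. 0 \<le> sd_coord \<beta> s x" using abc(5,6) c0 by (auto simp: co(1-3))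
    moreover have "\<forall>s\<in>\<Union>sd - ?F. sd_coord \<beta> s x = 0" using co(4) by blast
    ultimately show ?thesis using F by blast
  qed
  moreover have "norm (sd_pos p s - sd_pos p s') \<le> 2 / 3 * \<delta>" if "F \<in> sd" "s \<in> F" "s' \<in> F" for F s s'
  proof -
    from that(1) obtain t e a where f: "t \<in> T" "e \<subseteq> t" "card e = 2" "a \<in> e" "F = {{a}, e, t}"
      by (metis flag_cases)
    show ?thesis
      by (rule sd_pos_mesh[OF _ f(1-4)]) (use tc f that in \<open>auto simp: tri_cover_def\<close>)
  qed
  ultimately show ?thesis using cont surface_sd unfolding tri_cover_def by blast
qed

end

text \<open>Subdivision turns vertices into sets of vertices, so its iterates live in different
  types; numbering the vertices brings each iterate back to \<open>nat\<close>.\<close>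

lemma tri_cover_nat:
  fixes S :: "'c set set" and q :: "'c \<Rightarrow> 'e::real_normed_vector"
  assumes tc: "tri_cover S q \<gamma> M \<eta>"
  shows "\<exists>(T' :: nat set set) p' \<beta>'. tri_cover T' p' \<beta>' M \<eta> \<and> euler T' = euler S"
proof -
  have S: "surface S" using tc unfolding tri_cover_def by blast
  obtain f :: "'c \<Rightarrow> nat" where "inj_on f (\<Union>S)"
    using finite_imp_inj_to_nat_seg[OF surface.fin_W[OF S]] by blast
  from tri_cover_relabel[OF tc this] surface_relabel(2)[OF S this] show ?thesis by blast
qed

theorem tri_cover_fine:
  fixes T :: "'b set set" and p :: "'b \<Rightarrow> 'e::real_normed_vector"
  assumes tc: "tri_cover T p \<beta> M \<delta>" and "0 < \<epsilon>"
  shows "\<exists>(T' :: nat set set) p' \<beta>'. tri_cover T' p' \<beta>' M \<epsilon> \<and> euler T' = euler T"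
proof -
  have it: "\<exists>(T' :: nat set set) p' \<beta>'. tri_cover T' p' \<beta>' M ((2 / 3) ^ n * \<delta>) \<and> euler T' = euler T" for n
  proof (induction n)
    case 0
    then show ?case using tri_cover_nat[OF tc] by simp
  next
    case (Suc n)
    then obtain T' :: "nat set set" and p' \<beta>' where T': "tri_cover T' p' \<beta>' M ((2 / 3) ^ n * \<delta>)" "euler T' = euler T"
      by blast
    then interpret T': surface T' unfolding tri_cover_def by blast
    show ?case
      using tri_cover_nat[OF T'.tri_cover_sd[OF T'(1)]] T'.euler_sd T'(2) by (simp add: mult.assoc)
  qed
  have "\<exists>n. (2 / 3) ^ n * \<delta> \<le> \<epsilon>"
  proof (cases "\<delta> \<le> 0")
    case True
    then show ?thesis using assms(2) by (intro exI[of _ 0]) simp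
  next
    case False
    obtain n where "(2 / 3) ^ n < \<epsilon> / \<delta>"
      using real_arch_pow_inv[of "\<epsilon> / \<delta>" "2 / 3"] assms(2) False by auto
    then show ?thesis using False by (intro exI[of _ n]) (simp add: field_simps)
  qed
  then show ?thesis using it tri_cover_mono by metis
qed

section \<open>Triangulated closed surfaces\<close>

text \<open>A simplex is represented by its vertex set, so that faces are subsets and the empty
  simplex is the empty set. The dimension is not prescribed; \<open>chart\<close> determines
  it.\<close>

locale simplicial_surface =
  fixes VS :: "'e::euclidean_space set set"
  assumes finVS: "finite VS"
    and indep: "C \<in> VS \<Longrightarrow> \<not> affine_dependent C"
    and sub: "C \<in> VS \<Longrightarrow> D \<subseteq> C \<Longrightarrow> D \<in> VS"
    and inter: "C \<in> VS \<Longrightarrow> D \<in> VS \<Longrightarrow> convex hull C \<inter> convex hull D \<subseteq> convex hull (C \<inter> D)"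
    and connM: "connected (\<Union>C\<in>VS. convex hull C)"
    and neM: "(\<Union>C\<in>VS. convex hull C) \<noteq> {}"
    and chart: "x \<in> (\<Union>C\<in>VS. convex hull C) \<Longrightarrow>
      \<exists>U. openin (top_of_set (\<Union>C\<in>VS. convex hull C)) U \<and> x \<in> U \<and> U homeomorphic (UNIV :: (real^2) set)"
begin

definition "M = (\<Union>C\<in>VS. convex hull C)"

lemma finC: "C \<in> VS \<Longrightarrow> finite C"
  using indep aff_independent_finite by blast

lemma hull_M: "C \<in> VS \<Longrightarrow> convex hull C \<subseteq> M"
  unfolding M_def by blast

lemma closed_hull: "C \<in> VS \<Longrightarrow> closed (convex hull C)"
  using finC finite_imp_compact_convex_hull compact_imp_closed by blast

text \<open>Coordinates are functions on the whole space, zero off \<open>C\<close>, so that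
  representations over different simplices can be compared as functions.\<close>

definition rep :: "'e set \<Rightarrow> ('e \<Rightarrow> real) \<Rightarrow> 'e \<Rightarrow> bool" where
  "rep C u x \<longleftrightarrow> C \<in> VS \<and> (\<forall>v\<in>C. 0 \<le> u v) \<and> (\<forall>v. v \<notin> C \<longrightarrow> u v = 0) \<and> sum u C = 1 \<and> (\<Sum>v\<in>C. u v *\<^sub>R v) = x"

lemma ex_rep:
  assumes "C \<in> VS" "x \<in> convex hull C" shows "\<exists>u. rep C u x"
proof -
  obtain u where u: "\<forall>v\<in>C. 0 \<le> u v" "sum u C = 1" "(\<Sum>v\<in>C. u v *\<^sub>R v) = x"
    using assms convex_hull_finite[OF finC[OF assms(1)]] by auto
  then show ?thesis
    using assms(1) by (intro exI[of _ "\<lambda>v. if v \<in> C then u v else 0"]) (simp add: rep_def)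
qed

lemma rep_hull: "rep C u x \<Longrightarrow> x \<in> convex hull C"
  unfolding rep_def using convex_hull_finite[OF finC] by auto

lemma rep_mono:
  assumes "rep D u x" "D \<subseteq> C" "C \<in> VS" shows "rep C u x"
proof -
  have zero: "\<forall>v\<in>C - D. u v = 0" using assms(1) unfolding rep_def by blast
  have "sum u C = sum u D"
    by (rule sum.mono_neutral_right[OF finC[OF assms(3)] assms(2) zero])
  moreover have "(\<Sum>v\<in>C. u v *\<^sub>R v) = (\<Sum>v\<in>D. u v *\<^sub>R v)"
    by (rule sum.mono_neutral_right[OF finC[OF assms(3)] assms(2)]) (use zero in simp)
  moreover have "0 \<le> u v" for v using assms(1) unfolding rep_def by (cases "v \<in> D") auto
  ultimately show ?thesis using assms unfolding rep_def by auto
qed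

lemma rep_unique_same:
  assumes "rep C u x" "rep C u' x" shows "u = u'"
proof (rule ccontr)
  assume "u \<noteq> u'"
  then obtain w where "u w \<noteq> u' w" by blast
  moreover from this have "w \<in> C" using assms unfolding rep_def by metis
  ultimately have w: "w \<in> C" "u w - u' w \<noteq> 0" by auto
  have C: "C \<in> VS" using assms unfolding rep_def by blast
  have "sum (\<lambda>v. u v - u' v) C = 0" using assms by (simp add: rep_def sum_subtractf)
  moreover have "(\<Sum>v\<in>C. (u v - u' v) *\<^sub>R v) = 0"
    using assms by (simp add: rep_def scaleR_left_diff_distrib sum_subtractf)
  ultimately have "affine_dependent C"
    using w affine_dependent_explicit_finite[OF finC[OF C]] by blast
  then show False using indep[OF C] by blast
qed

text \<open>By \<open>inter\<close> the point lies in the hull of the common face; its coordinates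
  there extend by zero to both simplices, where affine independence makes them unique.\<close>

lemma rep_unique:
  assumes "rep C u x" "rep D u' x" shows "u = u'"
proof -
  have CD: "C \<in> VS" "D \<in> VS" using assms unfolding rep_def by auto
  have "x \<in> convex hull (C \<inter> D)" using inter[OF CD] rep_hull assms by blast
  then obtain u'' where "rep (C \<inter> D) u'' x" using ex_rep sub CD by (meson Int_lower1)
  then have "rep C u'' x" "rep D u'' x" using rep_mono CD by (meson Int_lower1 Int_lower2)+
  then show ?thesis using rep_unique_same assms by metis
qed

definition bary :: "'e \<Rightarrow> 'e \<Rightarrow> real" where
  "bary w x = (THE u. \<exists>C. rep C u x) w"

lemma bary_eq: "rep C u x \<Longrightarrow> bary w x = u w"
proof -
  assume r: "rep C u x"
  have "(THE u. \<exists>C. rep C u x) = u"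
    by (rule the_equality) (use r rep_unique in blast)+
  then show ?thesis unfolding bary_def by simp
qed

lemma bary_rep: "C \<in> VS \<Longrightarrow> x \<in> convex hull C \<Longrightarrow> rep C (\<lambda>w. bary w x) x"
  using ex_rep bary_eq by (metis ext)

text \<open>On one simplex \<open>bary w\<close> is affine. If \<open>a\<close> is a vertex other
  than \<open>w\<close>, the vectors \<open>v - a\<close> for the vertices \<open>v\<close> other
  than \<open>a\<close> are independent, and \<open>f\<close> is a linear functional with value 1 at
  \<open>w - a\<close> and 0 at the others.\<close>

lemma continuous_bary_hull:
  assumes C: "C \<in> VS" shows "continuous_on (convex hull C) (bary w)"
proof (cases "w \<in> C")
  case False
  have "continuous_on (convex hull C) (\<lambda>x. 0 :: real)" by simp
  moreover have "bary w x = 0" if "x \<in> convex hull C" for x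
    using bary_rep[OF C that] False unfolding rep_def by simp
  ultimately show ?thesis by (metis (no_types, lifting) continuous_on_eq)
next
  case True
  show ?thesis
  proof (cases "C = {w}")
    case True
    then show ?thesis by simp
  next
    case False
    then obtain a where a: "a \<in> C" "a \<noteq> w" using True by blast
    let ?S = "(\<lambda>x. - a + x) ` (C - {a})"
    have "independent ?S"
      using indep[OF C] affine_dependent_iff_dependent2[OF a(1)] by simp
    then obtain f :: "'e \<Rightarrow> real" where f: "linear f" "\<forall>y\<in>?S. f y = (if y = - a + w then 1 else 0)"
      using linear_independent_extend[of ?S "\<lambda>y. if y = - a + w then 1 else 0"] by blast
    have "bary w x = f (- a + x)" if x: "x \<in> convex hull C" for x
    proof -
      let ?u = "\<lambda>w. bary w x"
      have r: "rep C ?u x" by (rule bary_rep[OF C x])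
      have "- a + x = (\<Sum>v\<in>C. ?u v *\<^sub>R (- a + v))"
        using r by (simp add: rep_def scaleR_right_diff_distrib sum_subtractf flip: scaleR_sum_left)
      then have "f (- a + x) = (\<Sum>v\<in>C. ?u v * f (- a + v))"
        using f(1) by (simp add: linear_sum linear_scale)
      also have "\<dots> = (\<Sum>v\<in>C. if v = w then ?u v else 0)"
      proof (rule sum.cong)
        fix v assume v: "v \<in> C"
        show "?u v * f (- a + v) = (if v = w then ?u v else 0)"
        proof (cases "v = a")
          case True
          then show ?thesis using a linear_0[OF f(1)] by simp
        next
          case False
          then show ?thesis using v f(2) by simp
        qed
      qed simp
      also have "\<dots> = ?u w" using \<open>w \<in> C\<close> finC[OF C] by simp
      finally show ?thesis by simp
    qed
    note eq = this
    have "continuous_on (convex hull C) (\<lambda>x. f (- a + x))"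
      by (rule linear_continuous_on_compose[OF _ f(1)]) (intro continuous_intros)
    then show ?thesis by (rule continuous_on_eq) (simp only: eq)
  qed
qed

lemma continuous_bary: "continuous_on M (bary w)"
  unfolding M_def
  by (rule continuous_on_closed_Union[OF finVS closed_hull continuous_bary_hull])

text \<open>The points with positive coordinates at \<open>C\<close> form the open star of the simplex \<open>C\<close>.\<close>

lemma openin_bary_pos:
  assumes "finite C" shows "openin (top_of_set M) {x \<in> M. \<forall>w\<in>C. 0 < bary w x}"
proof -
  have one: "openin (top_of_set M) {x \<in> M. 0 < bary w x}" for w
  proof -
    have "{x \<in> M. 0 < bary w x} = M \<inter> bary w -` {0<..}" by auto
    then show ?thesis using continuous_openin_preimage_gen[OF continuous_bary[of w], of "{0<..}"] by simp
  qed
  show ?thesis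
    using assms
  proof induction
    case empty
    then show ?case by simp
  next
    case (insert a C)
    have "{x \<in> M. \<forall>w\<in>insert a C. 0 < bary w x} = {x \<in> M. 0 < bary a x} \<inter> {x \<in> M. \<forall>w\<in>C. 0 < bary w x}" by auto
    then show ?case using insert one by (simp add: openin_Int)
  qed
qed

lemma bary_pos_subset: "x \<in> convex hull D \<Longrightarrow> D \<in> VS \<Longrightarrow> 0 < bary w x \<Longrightarrow> w \<in> D"
  using bary_rep[of D x] unfolding rep_def by force

text \<open>A chart may leave the star of a simplex. Shrunk to a ball around the preimage of
  \<open>x\<close> it stays in \<open>N\<close>, and a ball remains connected without its
  centre.\<close>

lemma small_chart:
  assumes "openin (top_of_set M) N" "x \<in> N"
  obtains f g c \<rho> U where "0 < \<rho>" "homeomorphism (ball (c :: real^2) \<rho>) U f g"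
    "openin (top_of_set M) U" "U \<subseteq> N" "f c = x"
proof -
  have "x \<in> M" using assms openin_imp_subset by blast
  then obtain U where U: "openin (top_of_set M) U" "x \<in> U" "U homeomorphic (UNIV :: (real^2) set)"
    using chart unfolding M_def by blast
  from U(3) have "(UNIV :: (real^2) set) homeomorphic U" using homeomorphic_sym by blast
  then obtain f g where fg: "homeomorphism (UNIV :: (real^2) set) U f g"
    unfolding homeomorphic_def by blast
  have contf: "continuous_on UNIV f" using fg by (simp add: homeomorphism_def)
  have fU: "f ` UNIV = U" using fg by (simp add: homeomorphism_def)
  have NU: "openin (top_of_set U) (N \<inter> U)"
    using assms(1) U(1) openin_imp_subset[OF U(1)] by (meson inf_le2 openin_Int openin_subset_trans)
  have "open (f -` (N \<inter> U))"
    using continuous_openin_preimage[OF contf _ NU] fU by auto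
  moreover have "f (g x) = x" using fg U(2) by (simp add: homeomorphism_def)
  ultimately obtain \<rho> where \<rho>: "0 < \<rho>" "ball (g x) \<rho> \<subseteq> f -` (N \<inter> U)"
    using assms(2) U(2) by (metis IntI openE vimageI)
  have hom: "homeomorphism (ball (g x) \<rho>) (f ` ball (g x) \<rho>) f g"
    by (rule homeomorphism_of_subsets[OF fg]) (use fU in auto)
  have "openin (top_of_set U) (f ` ball (g x) \<rho>)"
    using homeomorphism_imp_open_map[OF fg] by simp
  then have "openin (top_of_set M) (f ` ball (g x) \<rho>)" using U(1) openin_trans by blast
  then show ?thesis using that[OF \<rho>(1) hom] \<rho>(2) \<open>f (g x) = x\<close> by auto
qed

lemma barycentre:
  assumes "C \<in> VS" "C \<noteq> {}"
  defines "x \<equiv> (\<Sum>v\<in>C. (1 / card C) *\<^sub>R v)"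
  shows "rep C (\<lambda>v. if v \<in> C then 1 / card C else 0) x" "x \<in> M" "\<forall>w\<in>C. 0 < bary w x"
proof -
  have fc: "finite C" "card C \<noteq> 0" using finC assms by auto
  show r: "rep C (\<lambda>v. if v \<in> C then 1 / card C else 0) x"
    using assms(1) fc unfolding rep_def x_def by simp
  show "x \<in> M" using rep_hull[OF r] hull_M assms(1) by blast
  show "\<forall>w\<in>C. 0 < bary w x" using bary_eq[OF r] fc by auto
qed

section \<open>Local structure: triangles, two of them at every edge, connected links\<close>

text \<open>The open star of a maximal simplex is its relative interior. A chart inside it embeds a
  disc into the affine hull and an open piece of that hull into the plane, so invariance of
  dimension gives both inequalities.\<close>

lemma card_maximal:
  assumes C: "C \<in> VS" "C \<noteq> {}" and max: "\<And>D. D \<in> VS \<Longrightarrow> C \<subseteq> D \<Longrightarrow> D = C"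
  shows "card C = 3"
proof -
  let ?R = "{x \<in> M. \<forall>w\<in>C. 0 < bary w x}"
  define x where "x = (\<Sum>v\<in>C. (1 / card C) *\<^sub>R v)"
  have xR: "x \<in> ?R" using barycentre[OF C] unfolding x_def by blast
  have R_hull: "?R \<subseteq> convex hull C"
  proof
    fix y assume y: "y \<in> ?R"
    then obtain D where D: "D \<in> VS" "y \<in> convex hull D" unfolding M_def by blast
    then have "C \<subseteq> D" using y bary_pos_subset by blast
    then show "y \<in> convex hull C" using max D by blast
  qed
  have R_rel: "?R = rel_interior (convex hull C)"
  proof (intro equalityI subsetI)
    fix y assume y: "y \<in> ?R"
    then have "rep C (\<lambda>w. bary w y) y" using bary_rep[OF C(1)] R_hull by blast
    then have "(\<forall>w\<in>C. 0 < bary w y) \<and> (\<Sum>w\<in>C. bary w y) = 1 \<and> (\<Sum>w\<in>C. bary w y *\<^sub>R w) = y"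
      using y unfolding rep_def by simp
    then show "y \<in> rel_interior (convex hull C)"
      unfolding rel_interior_convex_hull_explicit[OF indep[OF C(1)]] mem_Collect_eq
      by (rule exI[of _ "\<lambda>w. bary w y"])
  next
    fix y assume "y \<in> rel_interior (convex hull C)"
    then obtain u where u: "\<forall>v\<in>C. 0 < u v" "sum u C = 1" "(\<Sum>v\<in>C. u v *\<^sub>R v) = y"
      unfolding rel_interior_convex_hull_explicit[OF indep[OF C(1)]] by blast
    then have r: "rep C (\<lambda>v. if v \<in> C then u v else 0) y"
      unfolding rep_def using C(1) by (auto intro: less_imp_le)
    then show "y \<in> ?R" using bary_eq[OF r] u(1) rep_hull[OF r] hull_M[OF C(1)] by auto
  qed
  obtain f g c \<rho> U where ch: "0 < \<rho>" "homeomorphism (ball (c :: real^2) \<rho>) U f g"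
    "openin (top_of_set M) U" "U \<subseteq> ?R" "f c = x"
    using small_chart[OF openin_bary_pos[OF finC[OF C(1)]] xR] .
  have U: "f ` ball c \<rho> = U" "g ` U = ball c \<rho>" "continuous_on (ball c \<rho>) f" "continuous_on U g"
    "inj_on f (ball c \<rho>)" "inj_on g U"
    using ch(2) by (auto simp: homeomorphism_def intro: inj_on_inverseI)
  have "aff_dim (UNIV :: (real^2) set) \<le> aff_dim (affine hull C)"
  proof (rule invariance_of_dimension_affine_sets[of UNIV "ball c \<rho>" "affine hull C" f])
    show "f \<in> ball c \<rho> \<rightarrow> affine hull C"
      using U(1) ch(4) R_hull convex_hull_subset_affine_hull by blast
  qed (use U ch(1) in \<open>auto simp: affine_affine_hull\<close>)
  moreover have "aff_dim (affine hull C) \<le> aff_dim (UNIV :: (real^2) set)"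
  proof (rule invariance_of_dimension_affine_sets[of "affine hull C" U UNIV g])
    have "openin (top_of_set ?R) U" by (rule openin_subset_trans[OF ch(3,4)]) auto
    moreover have "openin (top_of_set (affine hull (convex hull C))) ?R"
      unfolding R_rel by (rule openin_rel_interior)
    ultimately show "openin (top_of_set (affine hull C)) U"
      by (simp add: affine_hull_convex_hull) (rule openin_trans)
    show "U \<noteq> {}" using U(1) ch(1) by (metis centre_in_ball image_is_empty empty_iff)
  qed (use U in \<open>auto simp: affine_affine_hull\<close>)
  ultimately have "aff_dim C = 2" by simp
  then show ?thesis using affine_independent_iff_card[of C] indep[OF C(1)] by auto
qed

definition "T = {C \<in> VS. card C = 3}"

lemma in_triangle:
  assumes "C \<in> VS" shows "\<exists>t\<in>T. C \<subseteq> t"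
proof -
  obtain D where D: "D \<in> VS" "C \<subseteq> D" and max: "\<And>D'. D' \<in> VS \<Longrightarrow> D \<subseteq> D' \<Longrightarrow> D' = D"
    using finite_has_maximal2[OF finVS assms] by metis
  obtain x C' where "C' \<in> VS" "x \<in> convex hull C'" using neM by blast
  then have "C' \<noteq> {}" by auto
  \<comment> \<open>The empty simplex is not maximal, because \<open>M\<close> is nonempty.\<close>
  then have "D \<noteq> {}" using max[of C'] \<open>C' \<in> VS\<close> by auto
  then have "card D = 3" using card_maximal[OF D(1) _ max] by blast
  then show ?thesis using D unfolding T_def by blast
qed

lemma T_VS: "t \<in> T \<Longrightarrow> t \<in> VS" and T_card: "t \<in> T \<Longrightarrow> card t = 3" and T_fin: "finite T"
  unfolding T_def using finVS by auto

lemma M_T: "M = (\<Union>t\<in>T. convex hull t)"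
proof -
  have "convex hull C \<subseteq> (\<Union>t\<in>T. convex hull t)" if "C \<in> VS" for C
    using in_triangle[OF that] hull_mono by blast
  then show ?thesis unfolding M_def using T_VS by blast
qed

lemma edge_VS: "e \<in> edges T \<Longrightarrow> e \<in> VS"
  unfolding edges_def using sub T_VS by blast

lemma in_hull_T:
  assumes "x \<in> M" "\<forall>w\<in>C. 0 < bary w x"
  obtains t where "t \<in> T" "C \<subseteq> t" "x \<in> convex hull t"
  using assms bary_pos_subset T_VS unfolding M_T by blast

text \<open>If \<open>t\<close> is the only triangle at \<open>e\<close>, the open star of
  \<open>e\<close> lies in the hull of \<open>t\<close>. By invariance of domain a chart at the
  midpoint of \<open>e\<close> is open in the plane of \<open>t\<close>, so the midpoint is in the
  relative interior of \<open>t\<close>, although its coordinate at the third vertex is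
  zero.\<close>

lemma edge_not_one:
  assumes e: "e \<in> edges T" and one: "{t \<in> T. e \<subseteq> t} = {t}"
  shows False
proof -
  have eVS: "e \<in> VS" "card e = 2" using e edge_VS by (auto simp: edges_def)
  then have ne: "e \<noteq> {}" by auto
  have t: "t \<in> T" "e \<subseteq> t" using one by auto
  let ?R = "{x \<in> M. \<forall>w\<in>e. 0 < bary w x}"
  define p where "p = (\<Sum>v\<in>e. (1 / card e) *\<^sub>R v)"
  have pR: "p \<in> ?R" using barycentre[OF eVS(1) ne] unfolding p_def by blast
  have pe: "p \<in> convex hull e" using rep_hull[OF barycentre(1)[OF eVS(1) ne]] unfolding p_def .
  have R: "?R \<subseteq> convex hull t"
  proof
    fix y assume "y \<in> ?R"
    then obtain s where s: "s \<in> T" "e \<subseteq> s" "y \<in> convex hull s" using in_hull_T[of y e] by blast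
    then have "s \<in> {t \<in> T. e \<subseteq> t}" by simp
    then have "s = t" unfolding one by simp
    then show "y \<in> convex hull t" using s by simp
  qed
  obtain f g c \<rho> U where ch: "0 < \<rho>" "homeomorphism (ball (c :: real^2) \<rho>) U f g"
    "openin (top_of_set M) U" "U \<subseteq> ?R" "f c = p"
    using small_chart[OF openin_bary_pos[OF finC[OF eVS(1)]] pR] .
  have U: "f ` ball c \<rho> = U" "continuous_on (ball c \<rho>) f" "inj_on f (ball c \<rho>)"
    using ch(2) by (auto simp: homeomorphism_def intro: inj_on_inverseI)
  have "aff_dim t = 2"
    using affine_independent_iff_card[of t] indep[OF T_VS[OF t(1)]] T_card[OF t(1)] by auto
  then have "openin (top_of_set (affine hull t)) (f ` ball c \<rho>)"
  proof (intro invariance_of_domain_affine_sets[of UNIV])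
    show "f \<in> ball c \<rho> \<rightarrow> affine hull t"
      using U(1) ch(4) R convex_hull_subset_affine_hull by blast
  qed (use U in \<open>auto simp: affine_affine_hull\<close>)
  then have "openin (top_of_set (affine hull (convex hull t))) U"
    unfolding U(1) by (simp add: affine_hull_convex_hull)
  moreover have "U \<subseteq> convex hull t" using ch(4) R by blast
  ultimately have "U \<subseteq> rel_interior (convex hull t)" by (intro rel_interior_maximal)
  moreover have "p \<in> U" using U(1) ch(1,5) by (metis centre_in_ball imageI)
  ultimately have "p \<in> rel_interior (convex hull t)" by blast
  then obtain u where u: "\<forall>v\<in>t. 0 < u v" "sum u t = 1" "(\<Sum>v\<in>t. u v *\<^sub>R v) = p"
    unfolding rel_interior_convex_hull_explicit[OF indep[OF T_VS[OF t(1)]]] by blast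
  then have r: "rep t (\<lambda>v. if v \<in> t then u v else 0) p"
    unfolding rep_def using T_VS[OF t(1)] by (auto intro: less_imp_le)
  have "t \<subseteq> e"
  proof
    fix v assume "v \<in> t"
    then have "0 < bary v p" using bary_eq[OF r] u(1) by simp
    then show "v \<in> e" using bary_pos_subset[OF pe eVS(1)] by blast
  qed
  then show False using t T_card[OF t(1)] eVS(2) by auto
qed

lemma third_vertex:
  assumes "t \<in> T" "e \<subseteq> t" "card e = 2"
  obtains c where "c \<notin> e" "t = insert c e"
proof -
  have fe: "finite t" using T_card[OF assms(1)] by (metis card.infinite zero_neq_numeral)
  have "card (t - e) = 1" using assms T_card[OF assms(1)] fe by (simp add: card_Diff_subset finite_subset)
  then obtain c where "t - e = {c}" by (auto simp: card_1_singleton_iff)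
  then show ?thesis using that[of c] assms(2) by blast
qed

text \<open>Two triangles at an edge unfold to a disc, which is open in \<open>M\<close> by invariance of domain; hence
  there is no room for a third one.\<close>

lemma edge_not_three:
  assumes e: "e \<in> edges T" and t: "t1 \<in> T" "t2 \<in> T" "t3 \<in> T" "e \<subseteq> t1" "e \<subseteq> t2" "e \<subseteq> t3"
    and d: "t1 \<noteq> t2" "t1 \<noteq> t3" "t2 \<noteq> t3"
  shows False
proof -
  have eVS: "e \<in> VS" "card e = 2" using e edge_VS by (auto simp: edges_def)
  obtain a b where ab: "e = {a, b}" "a \<noteq> b" using eVS(2) by (metis card_2_iff)
  obtain c1 where c1: "c1 \<notin> e" "t1 = insert c1 e" using third_vertex[OF t(1,4) eVS(2)] .
  obtain c2 where c2: "c2 \<notin> e" "t2 = insert c2 e" using third_vertex[OF t(2,5) eVS(2)] .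
  obtain c3 where c3: "c3 \<notin> e" "t3 = insert c3 e" using third_vertex[OF t(3,6) eVS(2)] .
  have cd: "c1 \<noteq> c2" "c1 \<noteq> c3" "c2 \<noteq> c3" using d c1 c2 c3 by auto
  let ?p = "(1/2) *\<^sub>R (a + b)"
  \<comment> \<open>The unfolded disc: \<open>z$2 = 0\<close> goes to the edge,
    \<open>z$2 > 0\<close> into \<open>t1\<close> with weight \<open>z$2\<close> at
    \<open>c1\<close>, and \<open>z$2 < 0\<close> into \<open>t2\<close>. Half of this weight is
    taken from each of \<open>a\<close> and \<open>b\<close>, and \<open>z$1\<close> shifts weight
    from \<open>a\<close> to \<open>b\<close>.\<close>
  define \<phi> :: "real^2 \<Rightarrow> 'e" where "\<phi> z = (1/2 - z$1 - max 0 (z$2) / 2 - max 0 (- z$2) / 2) *\<^sub>R a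
    + (1/2 + z$1 - max 0 (z$2) / 2 - max 0 (- z$2) / 2) *\<^sub>R b + max 0 (z$2) *\<^sub>R c1 + max 0 (- z$2) *\<^sub>R c2" for z
  have cont\<phi>: "continuous_on S \<phi>" for S
    unfolding \<phi>_def by (intro continuous_intros) simp_all
  define u where "u z v = (if v = a then 1/2 - z$1 - max 0 (z$2) / 2 - max 0 (- z$2) / 2
    else if v = b then 1/2 + z$1 - max 0 (z$2) / 2 - max 0 (- z$2) / 2
    else if v = c1 then max 0 (z$2) else if v = c2 then max 0 (- z$2) else 0)" for z :: "real^2" and v
  \<comment> \<open>Radius 1/4 keeps the weights of \<open>a\<close> and \<open>b\<close> at 1/2 -
    1/4 - 1/8 or more.\<close>
  have rep\<phi>: "\<exists>t. rep t (u z) (\<phi> z)" if z: "z \<in> ball 0 (1/4)" for z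
  proof -
    have z1: "\<bar>z$1\<bar> \<le> 1/4" "\<bar>z$2\<bar> \<le> 1/4"
      using z component_le_norm_cart[of z 1] component_le_norm_cart[of z 2] by auto
    show ?thesis
    proof (cases "0 \<le> z$2")
      case True
      have "rep t1 (u z) (\<phi> z)"
        unfolding rep_def using T_VS[OF t(1)] c1 ab z1 True cd
        by (auto simp: u_def \<phi>_def algebra_simps)
      then show ?thesis by blast
    next
      case False
      have "rep t2 (u z) (\<phi> z)"
        unfolding rep_def using T_VS[OF t(2)] c2 c1 ab z1 False cd
        by (auto simp: u_def \<phi>_def algebra_simps)
      then show ?thesis by blast
    qed
  qed
  have bary\<phi>: "bary v (\<phi> z) = u z v" if "z \<in> ball 0 (1/4)" for z v
    using rep\<phi>[OF that] bary_eq by blast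
  have \<phi>M: "\<phi> z \<in> M" if "z \<in> ball 0 (1/4)" for z
    using rep\<phi>[OF that] rep_hull hull_M unfolding rep_def by blast
  have inj\<phi>: "inj_on \<phi> (ball 0 (1/4))"
  proof (rule inj_onI)
    fix z w assume zw: "z \<in> ball 0 (1/4)" "w \<in> ball 0 (1/4)" "\<phi> z = \<phi> w"
    then have u: "u z v = u w v" for v using bary\<phi> by metis
    have "c1 \<noteq> a" "c1 \<noteq> b" "c2 \<noteq> a" "c2 \<noteq> b" using c1 c2 ab by auto
    with u[of c1] u[of c2] u[of a] u[of b] cd ab
    have "max 0 (z$2) = max 0 (w$2)" "max 0 (- z$2) = max 0 (- w$2)" "z$1 = w$1"
      by (auto simp: u_def)
    then have "z$2 = w$2" "z$1 = w$1" by (auto simp: max_def split: if_splits)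
    then show "z = w" by (simp add: vec_eq_iff forall_2)
  qed
  have p0: "\<phi> 0 \<in> M" by (rule \<phi>M) simp
  obtain f g c \<rho> U where ch: "0 < \<rho>" "homeomorphism (ball (c :: real^2) \<rho>) U f g"
    "openin (top_of_set M) U" "U \<subseteq> M" "f c = \<phi> 0"
    using small_chart[OF openin_subtopology_self p0] .
  have hom: "f ` ball c \<rho> = U" "g ` U = ball c \<rho>" "continuous_on (ball c \<rho>) f" "continuous_on U g"
     "inj_on g U"
    using ch(2) by (auto simp: homeomorphism_def intro: inj_on_inverseI)
  define B where "B = {z \<in> ball 0 (1/4). \<phi> z \<in> U}"
  have "openin (top_of_set (ball 0 (1/4))) (ball 0 (1/4) \<inter> \<phi> -` U)"
    by (rule continuous_openin_preimage[OF cont\<phi> _ ch(3)]) (use \<phi>M in auto)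
  then have openB: "open B" unfolding B_def
    by (simp add: openin_open_eq vimage_def Int_def conj_commute)
  \<comment> \<open>Invariance of domain is applied in the plane: the disc is read in the chart by
    \<open>g\<close>, and the open image is carried back by \<open>f\<close>.\<close>
  have "open ((g \<circ> \<phi>) ` B)"
  proof (rule invariance_of_domain)
    show "continuous_on B (g \<circ> \<phi>)"
      by (rule continuous_on_compose[OF cont\<phi> continuous_on_subset[OF hom(4)]]) (auto simp: B_def)
    show "inj_on (g \<circ> \<phi>) B"
      by (rule comp_inj_on[OF inj_on_subset[OF inj\<phi>] inj_on_subset[OF hom(5)]]) (auto simp: B_def)
  qed (rule openB)
  then have "openin (top_of_set (ball c \<rho>)) ((g \<circ> \<phi>) ` B)"
    using hom(2) by (intro open_subset) (auto simp: B_def)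
  then have "openin (top_of_set U) (f ` (g \<circ> \<phi>) ` B)"
    by (rule homeomorphism_imp_open_map[OF ch(2)])
  moreover have "f ` (g \<circ> \<phi>) ` B = \<phi> ` B"
  proof -
    have "f (g y) = y" if "y \<in> U" for y using ch(2) that by (simp add: homeomorphism_def)
    then have "f (g (\<phi> z)) = \<phi> z" if "z \<in> B" for z using that unfolding B_def by simp
    then have "(\<lambda>z. f (g (\<phi> z))) ` B = \<phi> ` B" by (rule image_cong[OF refl])
    then show ?thesis by (simp add: image_image)
  qed
  ultimately have op: "openin (top_of_set M) (\<phi> ` B)" using ch(3) openin_trans by metis
  have "\<phi> 0 \<in> U" using hom(1) ch(1,5) by (metis centre_in_ball imageI)
  then have "\<phi> 0 \<in> \<phi> ` B" unfolding B_def by simp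
  then obtain \<epsilon> where \<epsilon>: "0 < \<epsilon>" "ball (\<phi> 0) \<epsilon> \<inter> M \<subseteq> \<phi> ` B"
    using op unfolding openin_contains_ball by blast
  \<comment> \<open>\<open>?y\<close> lies on the way from the midpoint of \<open>e\<close> to
    \<open>c3\<close>, so close to the midpoint that it is in the image of the disc. Its weight
    \<open>s\<close> at \<open>c3\<close> is positive, while on that image this weight is zero. The
    summand 1 keeps the denominator positive.\<close>
  define s where "s = min 1 (\<epsilon> / (2 * (1 + norm (c3 - \<phi> 0))))"
  have s: "0 < s" "s \<le> 1" using \<epsilon>(1) by (auto simp: s_def add_pos_nonneg)
  let ?y = "\<phi> 0 + s *\<^sub>R (c3 - \<phi> 0)"
  have \<phi>0: "\<phi> 0 = (1/2) *\<^sub>R a + (1/2) *\<^sub>R b" by (simp add: \<phi>_def)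
  have r: "rep t3 (\<lambda>v. if v = a \<or> v = b then (1 - s) / 2 else if v = c3 then s else 0) ?y"
  proof -
    have t3: "t3 = {c3, a, b}" and ne: "c3 \<noteq> a" "c3 \<noteq> b" using c3 ab by auto
    have "?y = s *\<^sub>R c3 + ((1 - s) / 2) *\<^sub>R a + ((1 - s) / 2) *\<^sub>R b"
      unfolding \<phi>0 by (simp add: algebra_simps diff_divide_distrib)
    then show ?thesis
      unfolding rep_def using T_VS[OF t(3)] ne ab(2) s unfolding t3 by (simp add: add.assoc diff_divide_distrib)
  qed
  have "?y \<in> M" using rep_hull[OF r] hull_M T_VS[OF t(3)] by blast
  moreover have "norm (s *\<^sub>R (c3 - \<phi> 0)) < \<epsilon>"
  proof -
    have "s * norm (c3 - \<phi> 0) \<le> \<epsilon> / (2 * (1 + norm (c3 - \<phi> 0))) * norm (c3 - \<phi> 0)"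
      unfolding s_def by (rule mult_right_mono) auto
    also have "\<dots> < \<epsilon>" using \<epsilon>(1) by (simp add: divide_simps add_pos_nonneg) (simp add: algebra_simps add_pos_nonneg)
    finally show ?thesis using s by simp
  qed
  ultimately have "?y \<in> \<phi> ` B" using \<epsilon>(2) by (auto simp: dist_norm)
  then obtain z where z: "z \<in> ball 0 (1/4)" "?y = \<phi> z" unfolding B_def by blast
  have "bary c3 ?y = s" using bary_eq[OF r] c3 ab by auto
  moreover have "bary c3 (\<phi> z) = 0" using bary\<phi>[OF z(1)] cd c3 ab by (auto simp: u_def)
  ultimately show False using z(2) s by simp
qed

lemma edge_two:
  assumes e: "e \<in> edges T" shows "card {t \<in> T. e \<subseteq> t} = 2"
proof -
  let ?S = "{t \<in> T. e \<subseteq> t}"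
  have fin: "finite ?S" using T_fin by simp
  obtain t where t: "t \<in> ?S" using e unfolding edges_def by blast
  have "card ?S \<noteq> 1" using edge_not_one[OF e] by (metis card_1_singletonE)
  moreover have "card ?S \<noteq> 0" using t fin by auto
  moreover have "\<not> 3 \<le> card ?S"
  proof
    assume "3 \<le> card ?S"
    then obtain S where "S \<subseteq> ?S" "card S = 3" by (metis obtain_subset_with_card_n)
    then obtain t1 t2 t3 where "S = {t1, t2, t3}" "t1 \<noteq> t2" "t1 \<noteq> t3" "t2 \<noteq> t3" by (metis card_3_iff)
    with \<open>S \<subseteq> ?S\<close> show False using edge_not_three[OF e, of t1 t2 t3] by auto
  qed
  ultimately show ?thesis by linarith
qed

lemma vertex_VS: "v \<in> \<Union>T \<Longrightarrow> {v} \<in> VS"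
  using T_VS sub by blast

lemma hull_subset_diff: "t \<in> T \<Longrightarrow> s \<in> T \<Longrightarrow> t \<inter> s = {} \<Longrightarrow> convex hull t \<inter> convex hull s = {}"
  using inter[OF T_VS T_VS, of t s] by simp

text \<open>If the triangles at \<open>v\<close> fell into two classes without adjacency, hulls from
  different classes would meet only in \<open>v\<close>, and the two unions would split a punctured
  disc around \<open>v\<close> into nonempty closed parts.\<close>

lemma link_conn:
  assumes v: "v \<in> \<Union>T" shows "conn tadj {t \<in> T. v \<in> t}"
proof (rule connI, rule ccontr)
  fix A assume A: "A \<subseteq> {t \<in> T. v \<in> t}" "A \<noteq> {}"
    and cl: "\<And>x y. x \<in> A \<Longrightarrow> y \<in> {t \<in> T. v \<in> t} \<Longrightarrow> tadj x y \<Longrightarrow> y \<in> A"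
    and neq: "A \<noteq> {t \<in> T. v \<in> t}"
  let ?B = "{t \<in> T. v \<in> t} - A"
  have B: "?B \<noteq> {}" using A neq by blast
  let ?N = "{x \<in> M. \<forall>w\<in>{v}. 0 < bary w x}"
  have rv: "rep {v} (\<lambda>w. if w = v then 1 else 0) v" using vertex_VS[OF v] by (simp add: rep_def)
  have vN: "v \<in> ?N" using bary_eq[OF rv] rep_hull[OF rv] hull_M[OF vertex_VS[OF v]] by auto
  obtain f g c \<rho> U where ch: "0 < \<rho>" "homeomorphism (ball (c :: real^2) \<rho>) U f g"
    "openin (top_of_set M) U" "U \<subseteq> ?N" "f c = v"
    using small_chart[OF openin_bary_pos[OF finite.intros(2)[OF finite.intros(1)]] vN] .
  have U: "f ` ball c \<rho> = U" "continuous_on (ball c \<rho>) f" "inj_on f (ball c \<rho>)"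
    using ch(2) by (auto simp: homeomorphism_def intro: inj_on_inverseI)
  have "connected (f ` (ball c \<rho> - {c}))"
  proof (rule connected_continuous_image)
    show "continuous_on (ball c \<rho> - {c}) f" by (rule continuous_on_subset[OF U(2)]) blast
    show "connected (ball c \<rho> - {c})" by (rule connected_punctured_ball) simp
  qed
  moreover have "f ` (ball c \<rho> - {c}) = U - {v}"
    using inj_on_image_set_diff[OF U(3), of "ball c \<rho>" "{c}"] U(1) ch(1,5) by simp
  ultimately have con: "connected (U - {v})" by simp
  let ?P = "\<lambda>A. \<Union>t\<in>A. convex hull t"
  have cov: "U - {v} \<subseteq> ?P A \<union> ?P ?B"
  proof
    fix x assume "x \<in> U - {v}"
    then obtain t where "t \<in> T" "{v} \<subseteq> t" "x \<in> convex hull t" using in_hull_T[of x "{v}"] ch(4) by blast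
    then show "x \<in> ?P A \<union> ?P ?B" by blast
  qed
  have closed: "closed (?P A')" if "A' \<subseteq> T" for A'
    using that T_fin T_VS closed_hull by (intro closed_UN) (auto intro: finite_subset)
  have disj: "?P A \<inter> ?P ?B \<inter> (U - {v}) = {}"
  proof -
    have "convex hull t \<inter> convex hull s \<subseteq> {v}" if ts: "t \<in> A" "s \<in> ?B" for t s
    proof -
      have tsT: "t \<in> T" "s \<in> T" "v \<in> t \<inter> s" using ts A by auto
      have ft: "finite (t \<inter> s)" using finC[OF T_VS[OF tsT(1)]] by simp
      have "t \<noteq> s" using ts by auto
      then have "\<not> t \<subseteq> s" using card_subset_eq[OF finC[OF T_VS[OF tsT(2)]]] T_card tsT by metis
      then have "card (t \<inter> s) < card t" using finC[OF T_VS[OF tsT(1)]] by (intro psubset_card_mono) auto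
      moreover have "card (t \<inter> s) \<noteq> 2" using cl[of t s] ts by (auto simp: tadj_def)
      ultimately have "card (t \<inter> s) \<le> 1" using T_card[OF tsT(1)] by linarith
      then have "t \<inter> s = {v}" using tsT(3) ft by (metis One_nat_def card_le_Suc0_iff_eq empty_iff insertI1 is_singletonI' is_singletonE singletonD)
      then show ?thesis using inter[OF T_VS T_VS, OF tsT(1,2)] by simp
    qed
    then show ?thesis by blast
  qed
  have meets: "?P A' \<inter> (U - {v}) \<noteq> {}" if A': "A' \<subseteq> {t \<in> T. v \<in> t}" "A' \<noteq> {}" for A'
  proof -
    from A' obtain t where t: "t \<in> A'" "t \<in> T" "v \<in> t" by blast
    have "card (t - {v}) = 2" using T_card[OF t(2)] t(3) finC[OF T_VS[OF t(2)]] by simp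
    then obtain w where w: "w \<in> t" "w \<noteq> v" by (metis card.empty DiffE all_not_in_conv insertI1 zero_neq_numeral)
    have "v \<in> U" using U(1) ch(1,5) by (metis centre_in_ball imageI)
    then obtain \<epsilon> where \<epsilon>: "0 < \<epsilon>" "ball v \<epsilon> \<inter> M \<subseteq> U"
      using ch(3) unfolding openin_contains_ball by blast
    define s where "s = min 1 (\<epsilon> / (2 * norm (w - v)))"
    have nw: "0 < norm (w - v)" using w by simp
    have s: "0 < s" "s \<le> 1" using \<epsilon>(1) nw by (auto simp: s_def)
    let ?y = "v + s *\<^sub>R (w - v)"
    have "?y = (1 - s) *\<^sub>R v + s *\<^sub>R w" by (simp add: algebra_simps)
    then have yt: "?y \<in> convex hull t"
      using t w s convex_convex_hull[of t] hull_inc[of _ t convex] by (simp add: convexD)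
    have "s * norm (w - v) \<le> \<epsilon> / (2 * norm (w - v)) * norm (w - v)"
      unfolding s_def using nw by (intro mult_right_mono) auto
    also have "\<dots> < \<epsilon>" using nw \<epsilon>(1) by simp
    finally have "?y \<in> ball v \<epsilon>" using s by (simp add: dist_norm)
    moreover have "?y \<in> M" using yt hull_M T_VS[OF t(2)] by blast
    moreover have "?y \<noteq> v" using s w by simp
    ultimately show ?thesis using yt t(1) \<epsilon>(2) by blast
  qed
  have "?P A \<inter> (U - {v}) = {} \<or> ?P ?B \<inter> (U - {v}) = {}"
    by (rule connected_closedD[OF con disj cov closed closed]) (use A in auto)
  then show False using meets[OF A] meets[OF _ B] by blast
qed

text \<open>If \<open>B\<close> is closed under \<open>vadj\<close>, a triangle lies inside
  \<open>B\<close> or misses it; the hulls of the two kinds form disjoint closed sets covering the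
  connected space \<open>M\<close>.\<close>

lemma verts_conn: "conn (vadj T) (\<Union>T)"
proof (rule connI, rule ccontr)
  fix B assume B: "B \<subseteq> \<Union>T" "B \<noteq> {}" and cl: "\<And>x y. x \<in> B \<Longrightarrow> y \<in> \<Union>T \<Longrightarrow> vadj T x y \<Longrightarrow> y \<in> B"
    and neq: "B \<noteq> \<Union>T"
  have sub: "t \<subseteq> B" if t: "t \<in> T" "t \<inter> B \<noteq> {}" for t
  proof
    fix y assume y: "y \<in> t"
    from t(2) obtain x where x: "x \<in> t" "x \<in> B" by blast
    show "y \<in> B"
    proof (cases "x = y")
      case False
      then have "vadj T x y" using x y t(1) unfolding vadj_def by blast
      then show ?thesis using cl[OF x(2)] y t(1) by blast
    qed (use x in simp)
  qed
  let ?P1 = "\<Union>t\<in>{t \<in> T. t \<subseteq> B}. convex hull t" and ?P2 = "\<Union>t\<in>{t \<in> T. t \<inter> B = {}}. convex hull t"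
  have closed: "closed (\<Union>t\<in>A'. convex hull t)" if "A' \<subseteq> T" for A'
    using that T_fin T_VS closed_hull by (intro closed_UN) (auto intro: finite_subset)
  have cov: "M \<subseteq> ?P1 \<union> ?P2" unfolding M_T using sub by blast
  have disj: "?P1 \<inter> ?P2 \<inter> M = {}"
  proof -
    have "convex hull t \<inter> convex hull s = {}" if "t \<in> T" "t \<subseteq> B" "s \<in> T" "s \<inter> B = {}" for t s
      by (rule hull_subset_diff) (use that in blast)+
    then show ?thesis by blast
  qed
  have con: "connected M" using connM unfolding M_def .
  have "?P1 \<inter> M = {} \<or> ?P2 \<inter> M = {}"
    by (rule connected_closedD[OF con disj cov closed closed]) auto
  moreover have "x \<in> convex hull t \<and> x \<in> M" if "x \<in> t" "t \<in> T" for x t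
    using that hull_inc[of x t convex] hull_M[OF T_VS[OF that(2)]] by blast
  moreover obtain x t where "x \<in> B" "x \<in> t" "t \<in> T" using B by blast
  moreover from this have "t \<subseteq> B" using sub by blast
  moreover obtain y s where "y \<notin> B" "y \<in> s" "s \<in> T" using B neq by blast
  moreover from this have "s \<inter> B = {}" using sub by blast
  ultimately show False by blast
qed

lemma surface_T: "surface T"
proof
  show "T \<noteq> {}" using neM unfolding M_def[symmetric] M_T by blast
qed (use T_fin T_card edge_two link_conn verts_conn in auto)

lemma tri_cover_T: "\<exists>\<delta>. tri_cover T (\<lambda>v. v) bary M \<delta>"
proof -
  have "finite (\<Union>T)" using T_fin finC T_VS by blast
  then obtain b where b: "\<forall>v\<in>\<Union>T. norm v \<le> b" using finite_imp_bounded bounded_iff by metis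
  have "norm (v - w) \<le> 2 * b" if "v \<in> \<Union>T" "w \<in> \<Union>T" for v w
    using norm_triangle_ineq4[of v w] bspec[OF b that(1)] bspec[OF b that(2)] by linarith
  moreover have "\<exists>t\<in>T. (\<forall>w\<in>\<Union>T - t. bary w x = 0) \<and> (\<forall>w\<in>t. 0 \<le> bary w x) \<and>
        (\<Sum>w\<in>t. bary w x) = 1 \<and> (\<Sum>w\<in>t. bary w x *\<^sub>R w) = x" if "x \<in> M" for x
  proof -
    from that obtain t where t: "t \<in> T" "x \<in> convex hull t" unfolding M_T by blast
    then show ?thesis using bary_rep[OF T_VS[OF t(1)] t(2)] unfolding rep_def by blast
  qed
  ultimately show ?thesis unfolding tri_cover_def using surface_T continuous_bary by blast
qed

end

text \<open>The vertices of a simplex are its extreme points, so the hull determines them.\<close>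

lemma inj_on_convex_hull: "inj_on (\<lambda>C. convex hull C) {C :: 'e::euclidean_space set. \<not> affine_dependent C}"
proof (rule inj_onI)
  fix C D :: "'e set" assume "C \<in> {C. \<not> affine_dependent C}" "D \<in> {C. \<not> affine_dependent C}"
    "convex hull C = convex hull D"
  then show "C = D" by (metis extreme_point_of_convex_hull_affine_independent mem_Collect_eq subsetI subset_antisym)
qed

theorem simplicial_surface_tri_cover:
  fixes K :: "(real^5) set set"
  assumes K: "simplicial_complex K" and conn: "connected (\<Union>K)" and ne: "\<Union>K \<noteq> {}"
    and chart: "\<And>x. x \<in> \<Union>K \<Longrightarrow> \<exists>U. openin (top_of_set (\<Union>K)) U \<and> x \<in> U \<and> U homeomorphic (UNIV :: (real^2) set)"
  shows "\<exists>(T :: (real^5) set set) p \<beta> \<delta>. tri_cover T p \<beta> (\<Union>K) \<delta> \<and> euler T = euler_char_2 K"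
proof -
  define VS where "VS = {C. \<not> affine_dependent C \<and> convex hull C \<in> K}"
  have finK: "finite K" and Ksimplex: "\<And>S. S \<in> K \<Longrightarrow> \<exists>n. n simplex S"
    and Kface: "\<And>F S. S \<in> K \<Longrightarrow> F face_of S \<Longrightarrow> F \<in> K"
    and Kint: "\<And>S S'. S \<in> K \<Longrightarrow> S' \<in> K \<Longrightarrow> (S \<inter> S') face_of S"
    using K unfolding simplicial_complex_def by blast+
  have VS: "\<not> affine_dependent C" "convex hull C \<in> K" if "C \<in> VS" for C
    using that unfolding VS_def by blast+
  have KVS: "K = (\<lambda>C. convex hull C) ` VS"
  proof (intro equalityI subsetI)
    fix S assume S: "S \<in> K"
    then obtain n where "n simplex S" using Ksimplex by blast
    then obtain C where "\<not> affine_dependent C" "S = convex hull C" unfolding simplex_def by blast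
    with S show "S \<in> (\<lambda>C. convex hull C) ` VS" unfolding VS_def by blast
  qed (use VS in blast)
  then have M: "\<Union>K = (\<Union>C\<in>VS. convex hull C)" by simp
  have injVS: "inj_on (\<lambda>C. convex hull C) VS"
    by (rule inj_on_subset[OF inj_on_convex_hull]) (auto simp: VS_def)
  have face: "\<exists>c. c \<subseteq> C \<and> F = convex hull c" if "F face_of convex hull C" "C \<in> VS" for F C
    using that(1) face_of_convex_hull_affine_independent[OF VS(1)[OF that(2)]] by simp
  have sub: "D \<in> VS" if "C \<in> VS" "D \<subseteq> C" for C D
  proof -
    have "convex hull D face_of convex hull C"
      using that(2) face_of_convex_hull_affine_independent[OF VS(1)[OF that(1)]] by auto
    then have "convex hull D \<in> K" by (rule Kface[OF VS(2)[OF that(1)]])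
    moreover have "\<not> affine_dependent D" using VS(1)[OF that(1)] affine_dependent_subset[OF _ that(2)] by blast
    ultimately show ?thesis unfolding VS_def by blast
  qed
  interpret S: simplicial_surface VS
  proof
    show "finite VS" by (rule finite_imageD[OF finK[unfolded KVS] injVS])
    show "\<not> affine_dependent C" if "C \<in> VS" for C by (rule VS(1)[OF that])
    show "D \<in> VS" if "C \<in> VS" "D \<subseteq> C" for C D by (rule sub[OF that])
    show "convex hull C \<inter> convex hull D \<subseteq> convex hull (C \<inter> D)" if CD: "C \<in> VS" "D \<in> VS" for C D
    proof -
      have f: "(convex hull C \<inter> convex hull D) face_of convex hull C" "(convex hull D \<inter> convex hull C) face_of convex hull D"
        using Kint VS(2)[OF CD(1)] VS(2)[OF CD(2)] by auto
      obtain c where c: "c \<subseteq> C" "convex hull C \<inter> convex hull D = convex hull c" using face[OF f(1) CD(1)] by blast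
      obtain d where d: "d \<subseteq> D" "convex hull D \<inter> convex hull C = convex hull d" using face[OF f(2) CD(2)] by blast
      \<comment> \<open>The intersection is a face of both simplices. Its hull determines its vertex
        set, which is thus contained in \<open>C\<close> and in \<open>D\<close>.\<close>
      have "c = d" using inj_onD[OF injVS, of c d] sub c d CD by (metis Int_commute)
      then have "c \<subseteq> C \<inter> D" using c d by blast
      then show ?thesis using c(2) hull_mono by metis
    qed
  qed (use conn ne chart in \<open>simp_all add: M\<close>)
  have SM: "S.M = \<Union>K" unfolding S.M_def M ..
  have simp: "card {S \<in> K. n simplex S} = card {C \<in> VS. int (card C) = n + 1}" for n
  proof -
    have "{S \<in> K. n simplex S} = (\<lambda>C. convex hull C) ` {C \<in> VS. int (card C) = n + 1}"
      unfolding VS_def simplex_def by blast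
    moreover have "inj_on (\<lambda>C. convex hull C) {C \<in> VS. int (card C) = n + 1}"
      by (rule inj_on_subset[OF injVS]) blast
    ultimately show ?thesis by (simp only: card_image)
  qed
  \<comment> \<open>Every simplex lies in a triangle, so the vertices and edges counted in
    \<open>K\<close> are exactly those of \<open>S.T\<close>.\<close>
  have "{C \<in> VS. int (card C) = 0 + 1} = (\<lambda>v. {v}) ` \<Union>S.T"
  proof (intro equalityI subsetI)
    fix C assume C: "C \<in> {C \<in> VS. int (card C) = 0 + 1}"
    then obtain v where "C = {v}" by (auto simp: card_1_singleton_iff)
    then show "C \<in> (\<lambda>v. {v}) ` \<Union>S.T" using C S.in_triangle[of C] by auto
  qed (use S.vertex_VS in auto)
  then have n0: "card {S \<in> K. 0 simplex S} = card (\<Union>S.T)"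
    unfolding simp by (simp add: card_image)
  have "{C \<in> VS. int (card C) = 1 + 1} = edges S.T"
    using S.in_triangle S.edge_VS unfolding edges_def by auto
  then have n1: "card {S \<in> K. 1 simplex S} = card (edges S.T)" unfolding simp by simp
  have "{C \<in> VS. int (card C) = 2 + 1} = S.T" unfolding S.T_def by auto
  then have n2: "card {S \<in> K. 2 simplex S} = card S.T" unfolding simp by simp
  have "euler S.T = euler_char_2 K" unfolding euler_def euler_char_2_def n0 n1 n2 ..
  then show ?thesis using S.tri_cover_T unfolding SM by blast
qed

section \<open>Extending a labelling over a triangulation\<close>

lemma conn_insert:
  assumes A: "conn R A" and z: "z \<in> A" "R z y" "R y z" shows "conn R (insert y A)"
proof (rule connI)
  fix B assume B: "B \<subseteq> insert y A" "B \<noteq> {}"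
    and cl: "\<And>x x'. x \<in> B \<Longrightarrow> x' \<in> insert y A \<Longrightarrow> R x x' \<Longrightarrow> x' \<in> B"
  have "B \<inter> A \<noteq> {}"
  proof
    assume "B \<inter> A = {}"
    then have "y \<in> B" using B by blast
    then have "z \<in> B" using cl z by blast
    with \<open>B \<inter> A = {}\<close> z show False by blast
  qed
  then have "B \<inter> A = A"
    by (intro connD[OF A]) (use cl in blast)+
  then have "A \<subseteq> B" by blast
  moreover from this have "y \<in> B" using cl z by blast
  ultimately show "B = insert y A" using B by blast
qed

text \<open>As long as an unlabelled \<open>y\<close> has a neighbour labelled \<open>q\<close> and
  \<open>L y q\<close> permits it, \<open>y\<close> receives \<open>q\<close>. Classes stay
  connected, finiteness ends the process, and the last clause records that no permitted step is
  left.\<close>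

lemma grow_labelling:
  assumes "finite W" and sym: "\<forall>x y. R x y \<longrightarrow> R y x"
    and "\<forall>y q. lam y = Some q \<longrightarrow> y \<in> W" and "\<forall>q. conn R {y. lam y = Some q}"
  shows "\<exists>lam'. (\<forall>y q. lam y = Some q \<longrightarrow> lam' y = Some q) \<and> (\<forall>y q. lam' y = Some q \<longrightarrow> y \<in> W) \<and>
    (\<forall>q. conn R {y. lam' y = Some q}) \<and> (\<forall>y q. lam' y = Some q \<longrightarrow> lam y = Some q \<or> L y q) \<and>
    (\<forall>z y q. lam' z = Some q \<longrightarrow> y \<in> W \<longrightarrow> R z y \<longrightarrow> L y q \<longrightarrow> lam' y \<noteq> None)"
  using assms(3,4)
proof (induction "card {y \<in> W. lam y = None}" arbitrary: lam rule: less_induct)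
  case less
  show ?case
  proof (cases "\<exists>z y q. lam z = Some q \<and> y \<in> W \<and> R z y \<and> L y q \<and> lam y = None")
    case False
    show ?thesis
    proof (intro exI[of _ lam] conjI allI impI)
      show "y \<in> W" if "lam y = Some q" for y q using less.prems(1) that by blast
      show "conn R {y. lam y = Some q}" for q using less.prems(2) by blast
      show "lam y \<noteq> None" if "lam z = Some q" "y \<in> W" "R z y" "L y q" for z y q
        using False that by metis
    qed auto
  next
    case True
    then obtain z y q where zy: "lam z = Some q" "y \<in> W" "R z y" "L y q" "lam y = None" by blast
    let ?lam = "lam(y := Some q)"
    have lt: "card {x \<in> W. ?lam x = None} < card {x \<in> W. lam x = None}"
      using assms(1) zy by (intro psubset_card_mono) auto
    have dom: "\<forall>x q'. ?lam x = Some q' \<longrightarrow> x \<in> W" using less.prems(1) zy(2) by auto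
    have con': "conn R {x. ?lam x = Some q'}" for q'
    proof (cases "q' = q")
      case True
      have "{x. ?lam x = Some q'} = insert y {x. lam x = Some q}" using True by auto
      then show ?thesis using conn_insert[OF less.prems(2)[rule_format, of q], of z y] zy sym by auto
    next
      case False
      then have "{x. ?lam x = Some q'} = {x. lam x = Some q'}" using zy(5) by auto
      then show ?thesis using less.prems(2) by simp
    qed
    have con: "\<forall>q'. conn R {x. ?lam x = Some q'}" using con' by blast
    obtain lam' where l: "\<forall>y q'. ?lam y = Some q' \<longrightarrow> lam' y = Some q'" "\<forall>y q. lam' y = Some q \<longrightarrow> y \<in> W"
      "\<forall>q. conn R {y. lam' y = Some q}" "\<forall>y q'. lam' y = Some q' \<longrightarrow> ?lam y = Some q' \<or> L y q'"
      "\<forall>z y q. lam' z = Some q \<longrightarrow> y \<in> W \<longrightarrow> R z y \<longrightarrow> L y q \<longrightarrow> lam' y \<noteq> None"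
      using less.hyps[OF lt dom con] by (elim exE conjE) (rule that)
    show ?thesis
    proof (intro exI[of _ lam'] conjI)
      show "\<forall>x q'. lam x = Some q' \<longrightarrow> lam' x = Some q'" using l(1) zy(5) by (metis fun_upd_apply option.distinct(1))
      show "\<forall>x q'. lam' x = Some q' \<longrightarrow> lam x = Some q' \<or> L x q'"
        using l(4) zy(4) by (metis fun_upd_apply option.inject)
    qed (use l in blast)+
  qed
qed

text \<open>The labels grow in two phases. The first fills only the sets \<open>P m\<close>, with
  the labels of their two ends, so that the classes of \<open>s m\<close> and \<open>t m\<close>
  become adjacent inside \<open>P m\<close>. The second fills the rest of \<open>W\<close> without
  restriction; without the first phase, foreign labels could cut through some
  \<open>P m\<close>.\<close>

lemma ex_labelling:
  fixes R :: "'b \<Rightarrow> 'b \<Rightarrow> bool" and N :: "'q \<Rightarrow> 'b set"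
  assumes fin: "finite W" and sym: "\<And>x y. R x y \<Longrightarrow> R y x" and W: "conn R W" and Q: "Q \<noteq> {}"
    and N: "\<And>q. q \<in> Q \<Longrightarrow> N q \<subseteq> W" "\<And>q. q \<in> Q \<Longrightarrow> N q \<noteq> {}" "\<And>q. q \<in> Q \<Longrightarrow> conn R (N q)"
      "\<And>q q'. q \<in> Q \<Longrightarrow> q' \<in> Q \<Longrightarrow> q \<noteq> q' \<Longrightarrow> N q \<inter> N q' = {}"
    and P: "\<And>m. m \<in> A \<Longrightarrow> P m \<subseteq> W" "\<And>m. m \<in> A \<Longrightarrow> conn R (P m)"
      "\<And>m m'. m \<in> A \<Longrightarrow> m' \<in> A \<Longrightarrow> m \<noteq> m' \<Longrightarrow> P m \<inter> P m' = {}"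
    and ends: "\<And>m. m \<in> A \<Longrightarrow> s m \<in> Q \<and> P m \<inter> N (s m) \<noteq> {}" "\<And>m. m \<in> A \<Longrightarrow> t m \<in> Q \<and> P m \<inter> N (t m) \<noteq> {}"
      "\<And>m q. m \<in> A \<Longrightarrow> q \<in> Q \<Longrightarrow> P m \<inter> N q \<noteq> {} \<Longrightarrow> q = s m \<or> q = t m"
  shows "\<exists>lam. (\<forall>q\<in>Q. \<forall>w\<in>N q. lam w = q) \<and> (\<forall>q. conn R {w \<in> W. lam w = q}) \<and>
    (\<forall>m\<in>A. s m \<noteq> t m \<longrightarrow> (\<exists>w w'. R w w' \<and> lam w = s m \<and> lam w' = t m))"
proof -
  define lam0 where "lam0 y = (if \<exists>q\<in>Q. y \<in> N q then Some (SOME q. q \<in> Q \<and> y \<in> N q) else None)" for y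
  have lam0: "lam0 y = Some q \<longleftrightarrow> q \<in> Q \<and> y \<in> N q" for y q
  proof (cases "\<exists>q\<in>Q. y \<in> N q")
    case True
    then have "\<exists>q. q \<in> Q \<and> y \<in> N q" by blast
    from someI_ex[OF this] have *: "(SOME q. q \<in> Q \<and> y \<in> N q) \<in> Q" "y \<in> N (SOME q. q \<in> Q \<and> y \<in> N q)" by auto
    have "lam0 y = Some (SOME q. q \<in> Q \<and> y \<in> N q)" unfolding lam0_def using True by simp
    moreover have "q = (SOME q. q \<in> Q \<and> y \<in> N q)" if "q \<in> Q" "y \<in> N q"
      using N(4)[OF that(1) *(1)] that(2) *(2) by blast
    ultimately show ?thesis using * by auto
  next
    case False
    then show ?thesis unfolding lam0_def by auto
  qed
  have sym': "\<forall>x y. R x y \<longrightarrow> R y x" using sym by blast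
  have dom0: "\<forall>y q. lam0 y = Some q \<longrightarrow> y \<in> W" using N(1) unfolding lam0 by blast
  have con0: "\<forall>q. conn R {y. lam0 y = Some q}"
  proof
    fix q show "conn R {y. lam0 y = Some q}"
  proof (cases "q \<in> Q")
    case True
    then have "{y. lam0 y = Some q} = N q" unfolding lam0 by blast
    then show ?thesis using N(3)[OF True] by simp
  next
    case False
    then have "{y. lam0 y = Some q} = {}" unfolding lam0 by blast
    then show ?thesis by (simp add: conn_def)
  qed
  qed
  define L where "L y q \<longleftrightarrow> (\<exists>m\<in>A. y \<in> P m \<and> (q = s m \<or> q = t m))" for y q
  obtain lam1 where l1': "\<forall>y q. lam0 y = Some q \<longrightarrow> lam1 y = Some q" "\<forall>y q. lam1 y = Some q \<longrightarrow> y \<in> W"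
    "\<forall>q. conn R {y. lam1 y = Some q}" "\<forall>y q. lam1 y = Some q \<longrightarrow> lam0 y = Some q \<or> L y q"
    "\<forall>z y q. lam1 z = Some q \<longrightarrow> y \<in> W \<longrightarrow> R z y \<longrightarrow> L y q \<longrightarrow> lam1 y \<noteq> None"
    using grow_labelling[where R = R and W = W and lam = lam0 and L = L, OF fin sym' dom0 con0]
    by (elim exE conjE) (rule that)
  note l1 = l1'[rule_format]
  have ends1: "q = s m \<or> q = t m" if m: "m \<in> A" "z \<in> P m" "lam1 z = Some q" for m z q
    using l1(4)[OF m(3)]
  proof
    assume "lam0 z = Some q"
    then show ?thesis using ends(3)[OF m(1), of q] m(2) unfolding lam0 by blast
  next
    assume "L z q"
    then obtain m' where "m' \<in> A" "z \<in> P m'" "q = s m' \<or> q = t m'" unfolding L_def by blast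
    then show ?thesis using P(3)[OF m(1), of m'] m(2) by blast
  qed
  have adj1: "\<exists>w w'. R w w' \<and> lam1 w = Some (s m) \<and> lam1 w' = Some (t m)" if m: "m \<in> A" "s m \<noteq> t m" for m
  proof -
    obtain a where a: "a \<in> P m" "lam1 a = Some (s m)" using ends(1)[OF m(1)] l1(1) lam0 by blast
    obtain b where b: "b \<in> P m" "lam1 b = Some (t m)" using ends(2)[OF m(1)] l1(1) lam0 by blast
    \<comment> \<open>Only the two end labels occur on \<open>P m\<close>, and both are permitted
      everywhere on it, so the connected set \<open>P m\<close> is filled completely. Somewhere on
      it the label \<open>s m\<close> is then adjacent to another label, which must be
      \<open>t m\<close>.\<close>
    have B: "{z \<in> P m. lam1 z \<noteq> None} = P m"
    proof (rule connD[OF P(2)[OF m(1)]])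
      fix x y assume x: "x \<in> {z \<in> P m. lam1 z \<noteq> None}" and y: "y \<in> P m" "R x y"
      from x obtain q where q: "lam1 x = Some q" by blast
      have "L y q" using ends1[OF m(1) _ q] x y(1) m(1) unfolding L_def by blast
      moreover have "y \<in> W" using P(1)[OF m(1)] y(1) by blast
      ultimately have "lam1 y \<noteq> None" using l1'(5) q y(2) by metis
      with y show "y \<in> {z \<in> P m. lam1 z \<noteq> None}" by blast
    qed (use a in auto)
    let ?C = "{z \<in> P m. lam1 z = Some (s m)}"
    have "\<exists>x\<in>?C. \<exists>y\<in>P m - ?C. R x y"
    proof (rule ccontr)
      assume "\<not> ?thesis"
      then have "?C = P m" by (intro connD[OF P(2)[OF m(1)]]) (use a in auto)
      then have "lam1 b = Some (s m)" using b by blast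
      with b m show False by simp
    qed
    then obtain x y where xy: "lam1 x = Some (s m)" "y \<in> P m" "lam1 y \<noteq> Some (s m)" "R x y" by blast
    have "lam1 y \<noteq> None" using B xy(2) by blast
    then obtain q where q: "lam1 y = Some q" by blast
    have "q = t m" using ends1[OF m(1) xy(2) q] q xy(3) by simp
    with xy q show ?thesis by blast
  qed
  obtain lam2 where l2': "\<forall>y q. lam1 y = Some q \<longrightarrow> lam2 y = Some q" "\<forall>y q. lam2 y = Some q \<longrightarrow> y \<in> W"
    "\<forall>q. conn R {y. lam2 y = Some q}" "\<forall>y q. lam2 y = Some q \<longrightarrow> lam1 y = Some q \<or> True"
    "\<forall>z y q. lam2 z = Some q \<longrightarrow> y \<in> W \<longrightarrow> R z y \<longrightarrow> True \<longrightarrow> lam2 y \<noteq> None"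
    using grow_labelling[where R = R and W = W and lam = lam1 and L = "\<lambda>_ _. True", OF fin sym' l1'(2,3)]
    by (elim exE conjE) (rule that)
  note l2 = l2'(1-3)[rule_format] l2'(5)[rule_format, OF _ _ _ TrueI]
  have total: "{y \<in> W. lam2 y \<noteq> None} = W"
  proof (rule connD[OF W])
    obtain q where "q \<in> Q" using Q by blast
    then obtain w where "w \<in> N q" using N(2) by blast
    then have "lam2 w = Some q" "w \<in> W" using l2(1) l1(1) lam0 N(1) \<open>q \<in> Q\<close> by blast+
    then show "{y \<in> W. lam2 y \<noteq> None} \<noteq> {}" by force
    show "y \<in> {y \<in> W. lam2 y \<noteq> None}" if "x \<in> {y \<in> W. lam2 y \<noteq> None}" "y \<in> W" "R x y" for x y
      using l2(4)[of x _ y] that by blast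
  qed blast
  have fib: "{w \<in> W. the (lam2 w) = q} = {w. lam2 w = Some q}" for q
    using total l2(2) by force
  show ?thesis
  proof (intro exI[of _ "\<lambda>w. the (lam2 w)"] conjI ballI allI impI)
    show "the (lam2 w) = q" if "q \<in> Q" "w \<in> N q" for q w
      using that l2(1) l1(1) lam0 by (metis option.sel)
    show "conn R {w \<in> W. the (lam2 w) = q}" for q unfolding fib by (rule l2(3))
    show "\<exists>w w'. R w w' \<and> the (lam2 w) = s m \<and> the (lam2 w') = t m" if "m \<in> A" "s m \<noteq> t m" for m
      using adj1[OF that] l2(1) by (metis option.sel)
  qed
qed

lemma finite_uniform_pos:
  fixes P :: "'i \<Rightarrow> real \<Rightarrow> bool"
  assumes "finite A" "\<And>a. a \<in> A \<Longrightarrow> \<exists>d>0. P a d" "\<And>a d d'. P a d \<Longrightarrow> 0 < d' \<Longrightarrow> d' \<le> d \<Longrightarrow> P a d'"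
  shows "\<exists>d>0. \<forall>a\<in>A. P a d"
  using assms(1,2)
proof (induction rule: finite_induct)
  case empty
  then show ?case by (intro exI[of _ 1]) simp
next
  case (insert a A)
  then obtain d where d: "0 < d" "\<forall>a\<in>A. P a d" by auto
  obtain d' where d': "0 < d'" "P a d'" using insert.prems by blast
  show ?case
    by (intro exI[of _ "min d d'"]) (use d d' assms(3) in auto)
qed

section \<open>From subsets of the space to sets of vertices\<close>

text \<open>The vertices whose open stars meet \<open>S\<close>: the discrete substitute for
  \<open>S\<close>.\<close>

definition star_nbhd :: "'b set set \<Rightarrow> ('b \<Rightarrow> 'e \<Rightarrow> real) \<Rightarrow> 'e set \<Rightarrow> 'b set" where
  "star_nbhd T \<beta> S = {w \<in> \<Union>T. \<exists>x\<in>S. 0 < \<beta> w x}"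

context
  fixes T :: "'b set set" and p :: "'b \<Rightarrow> 'e::real_normed_vector" and \<beta> M \<delta>
  assumes tc: "tri_cover T p \<beta> M \<delta>"
begin

lemma tri_coverE:
  assumes "x \<in> M"
  obtains t where "t \<in> T" "\<And>w. w \<in> \<Union>T \<Longrightarrow> w \<notin> t \<Longrightarrow> \<beta> w x = 0" "\<And>w. w \<in> t \<Longrightarrow> 0 \<le> \<beta> w x"
    "(\<Sum>w\<in>t. \<beta> w x) = 1" "(\<Sum>w\<in>t. \<beta> w x *\<^sub>R p w) = x"
proof -
  have "\<exists>t\<in>T. (\<forall>w\<in>\<Union>T - t. \<beta> w x = 0) \<and> (\<forall>w\<in>t. 0 \<le> \<beta> w x) \<and>
        (\<Sum>w\<in>t. \<beta> w x) = 1 \<and> (\<Sum>w\<in>t. \<beta> w x *\<^sub>R p w) = x"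
    using tc assms unfolding tri_cover_def by blast
  then show ?thesis using that by blast
qed

lemma tri_cover_pos:
  assumes "x \<in> M" obtains w where "w \<in> \<Union>T" "0 < \<beta> w x"
proof -
  obtain t where t: "t \<in> T" "\<And>w. w \<in> t \<Longrightarrow> 0 \<le> \<beta> w x" "(\<Sum>w\<in>t. \<beta> w x) = 1"
    using tri_coverE[OF assms] by metis
  have "\<exists>w\<in>t. 0 < \<beta> w x"
  proof (rule ccontr)
    assume "\<not> ?thesis"
    then have "\<forall>w\<in>t. \<beta> w x = 0" using t(2) by force
    then show False using t(3) by simp
  qed
  then show ?thesis using that t(1) by blast
qed

text \<open>\<open>x\<close> is a convex combination of the vertices of a triangle containing
  \<open>w\<close>, all of them within \<open>\<delta>\<close> of \<open>p w\<close>.\<close>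

lemma star_near:
  assumes "x \<in> M" "w \<in> \<Union>T" "0 < \<beta> w x" shows "dist x (p w) \<le> \<delta>"
proof -
  obtain t where t: "t \<in> T" "\<And>w. w \<in> \<Union>T \<Longrightarrow> w \<notin> t \<Longrightarrow> \<beta> w x = 0" "\<And>w. w \<in> t \<Longrightarrow> 0 \<le> \<beta> w x"
    "(\<Sum>w\<in>t. \<beta> w x) = 1" "(\<Sum>w\<in>t. \<beta> w x *\<^sub>R p w) = x"
    using tri_coverE[OF assms(1)] by blast
  have wt: "w \<in> t" using t(2)[OF assms(2)] assms(3) by force
  have "x - p w = (\<Sum>v\<in>t. \<beta> v x *\<^sub>R (p v - p w))"
    using t(4,5) by (simp add: scaleR_right_diff_distrib sum_subtractf flip: scaleR_sum_left)
  then have "norm (x - p w) \<le> (\<Sum>v\<in>t. norm (\<beta> v x *\<^sub>R (p v - p w)))"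
    by (simp only: norm_sum)
  also have "\<dots> \<le> (\<Sum>v\<in>t. \<beta> v x * \<delta>)"
  proof (rule sum_mono)
    fix v assume v: "v \<in> t"
    have "norm (p v - p w) \<le> \<delta>" using tc t(1) v wt unfolding tri_cover_def by blast
    then show "norm (\<beta> v x *\<^sub>R (p v - p w)) \<le> \<beta> v x * \<delta>"
      using t(3)[OF v] by (simp add: mult_left_mono)
  qed
  also have "\<dots> = \<delta>" using t(4) by (simp flip: sum_distrib_right)
  finally show ?thesis by (simp add: dist_norm)
qed

lemma star_nbhd_disjoint:
  assumes "S \<subseteq> M" "S' \<subseteq> M" "\<And>x y. x \<in> S \<Longrightarrow> y \<in> S' \<Longrightarrow> 2 * \<delta> < dist x y"
  shows "star_nbhd T \<beta> S \<inter> star_nbhd T \<beta> S' = {}"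
proof (rule ccontr)
  assume "\<not> ?thesis"
  then obtain w x y where w: "w \<in> \<Union>T" "x \<in> S" "0 < \<beta> w x" "y \<in> S'" "0 < \<beta> w y"
    unfolding star_nbhd_def by blast
  then have "dist x (p w) \<le> \<delta>" "dist y (p w) \<le> \<delta>" using star_near assms by blast+
  then have "dist x y \<le> 2 * \<delta>" using dist_triangle2[of x y "p w"] by linarith
  with assms(3) w show False by fastforce
qed

lemma star_nbhd_meets:
  assumes "x \<in> S" "x \<in> S'" "x \<in> M" shows "star_nbhd T \<beta> S \<inter> star_nbhd T \<beta> S' \<noteq> {}"
proof -
  obtain w where "w \<in> \<Union>T" "0 < \<beta> w x" using tri_cover_pos[OF assms(3)] .
  then have "w \<in> star_nbhd T \<beta> S \<inter> star_nbhd T \<beta> S'" using assms unfolding star_nbhd_def by auto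
  then show ?thesis by blast
qed

lemma star_nbhd_nonempty:
  assumes "S \<subseteq> M" "S \<noteq> {}" shows "star_nbhd T \<beta> S \<noteq> {}"
proof -
  obtain x where "x \<in> S" "x \<in> M" using assms by blast
  then show ?thesis using star_nbhd_meets[of x S S] by simp
qed

text \<open>A splitting of the vertices would split \<open>S\<close> into the relatively open sets
  of points with a positive coordinate in \<open>B\<close> and outside it. They are disjoint,
  because vertices with positive coordinates at one point lie in one triangle and are
  adjacent.\<close>

lemma star_nbhd_conn:
  assumes S: "S \<subseteq> M" "connected S" shows "conn (vadj T) (star_nbhd T \<beta> S)"
proof (rule connI, rule ccontr)
  fix B assume B: "B \<subseteq> star_nbhd T \<beta> S" "B \<noteq> {}"
    and cl: "\<And>x y. x \<in> B \<Longrightarrow> y \<in> star_nbhd T \<beta> S \<Longrightarrow> vadj T x y \<Longrightarrow> y \<in> B"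
    and neq: "B \<noteq> star_nbhd T \<beta> S"
  let ?O = "\<lambda>B. \<Union>w\<in>B. {x \<in> S. 0 < \<beta> w x}"
  let ?C = "star_nbhd T \<beta> S - B"
  have op: "openin (top_of_set S) (?O B')" if "B' \<subseteq> \<Union>T" for B'
  proof (rule openin_Union)
    fix U assume "U \<in> (\<lambda>w. {x \<in> S. 0 < \<beta> w x}) ` B'"
    then obtain w where U: "U = {x \<in> S. 0 < \<beta> w x}" and "w \<in> B'" by (rule imageE)
    then have w: "w \<in> \<Union>T" using that by (simp only: subsetD)
    have "\<forall>w\<in>\<Union>T. continuous_on M (\<beta> w)" using tc unfolding tri_cover_def by (elim conjE)
    then have "continuous_on M (\<beta> w)" using w by (rule bspec)
    then have "continuous_on S (\<beta> w)" by (rule continuous_on_subset[OF _ S(1)])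
    then have "openin (top_of_set S) (S \<inter> \<beta> w -` {0<..})" by (rule continuous_openin_preimage_gen) simp
    moreover have "S \<inter> \<beta> w -` {0<..} = {x \<in> S. 0 < \<beta> w x}" by auto
    ultimately show "openin (top_of_set S) U" unfolding U by simp
  qed
  have sub: "star_nbhd T \<beta> S \<subseteq> \<Union>T" unfolding star_nbhd_def by blast
  have ne: "?O B' \<noteq> {}" if "B' \<subseteq> star_nbhd T \<beta> S" "B' \<noteq> {}" for B'
    using that unfolding star_nbhd_def by blast
  have cov: "S \<subseteq> ?O B \<union> ?O ?C"
  proof
    fix x assume x: "x \<in> S"
    then have "x \<in> M" by (rule subsetD[OF S(1)])
    then obtain w where w: "w \<in> \<Union>T" "0 < \<beta> w x" by (rule tri_cover_pos)
    then have "w \<in> star_nbhd T \<beta> S" using x unfolding star_nbhd_def by auto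
    then have "w \<in> B \<or> w \<in> ?C" by simp
    moreover have "x \<in> {x \<in> S. 0 < \<beta> w x}" using x w(2) by simp
    ultimately show "x \<in> ?O B \<union> ?O ?C" by (elim disjE) (rule UnI1, erule UN_I, assumption, rule UnI2, erule UN_I, assumption)
  qed
  have disj: "?O B \<inter> ?O ?C = {}"
  proof (rule ccontr)
    assume "\<not> ?thesis"
    then obtain x where "x \<in> ?O B" "x \<in> ?O ?C" by blast
    then obtain w w' where x: "x \<in> S" "w \<in> B" "0 < \<beta> w x" "w' \<in> ?C" "0 < \<beta> w' x"
      by (elim UN_E CollectE conjE) (rule that)
    have "x \<in> M" by (rule subsetD[OF S(1) x(1)])
    then obtain t where t: "t \<in> T" "\<And>w. w \<in> \<Union>T \<Longrightarrow> w \<notin> t \<Longrightarrow> \<beta> w x = 0"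
      using tri_coverE[of x] by metis
    have wN: "w \<in> star_nbhd T \<beta> S" "w' \<in> star_nbhd T \<beta> S" using x B by auto
    then have "w \<in> \<Union>T" "w' \<in> \<Union>T" using subsetD[OF sub] by simp_all
    then have "w \<in> t" "w' \<in> t" using t(2)[of w] t(2)[of w'] x by fastforce+
    moreover have "w \<noteq> w'" using x by auto
    ultimately have "vadj T w w'" using t(1) unfolding vadj_def by auto
    then have "w' \<in> B" by (rule cl[OF x(2) wN(2)])
    then show False using x(4) by simp
  qed
  have "openin (top_of_set S) (?O B)" "openin (top_of_set S) (?O ?C)" "?O B \<noteq> {}" "?O ?C \<noteq> {}"
    using op[of B] op[of ?C] ne[of B] ne[of ?C] B sub neq by auto
  then show False using S(2) cov disj unfolding connected_openin by blast
qed

end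

section \<open>Drawings\<close>

text \<open>The drawing after its transport into Euclidean space, where disjoint compact sets have
  positive distance.\<close>

locale drawn_graph =
  fixes M :: "'e::euclidean_space set" and V :: "'a set" and E :: "'a set set"
    and \<pi> :: "'a \<Rightarrow> 'e" and c :: "'a set \<Rightarrow> real \<Rightarrow> 'e" and k :: nat
  assumes graph: "simple_graph V E"
    and inj_\<pi>: "inj_on \<pi> V" and \<pi>_M: "\<pi> ` V \<subseteq> M"
    and cont: "e \<in> E \<Longrightarrow> continuous_on {0..1} (c e)"
    and in_M: "e \<in> E \<Longrightarrow> c e ` {0..1} \<subseteq> M"
    and inj: "e \<in> E \<Longrightarrow> inj_on (c e) {0..1}"
    and ends: "e \<in> E \<Longrightarrow> {c e 0, c e 1} = \<pi> ` e"
    and avoid: "e \<in> E \<Longrightarrow> edge_interior c e \<inter> \<pi> ` V = {}"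
    and fin_cross: "e \<in> E \<Longrightarrow> f \<in> E \<Longrightarrow> e \<noteq> f \<Longrightarrow> finite (edge_interior c e \<inter> edge_interior c f)"
    and no_three: "e \<in> E \<Longrightarrow> f \<in> E \<Longrightarrow> h \<in> E \<Longrightarrow> e \<noteq> f \<Longrightarrow> f \<noteq> h \<Longrightarrow> e \<noteq> h \<Longrightarrow>
      edge_interior c e \<inter> edge_interior c f \<inter> edge_interior c h = {}"
    and few: "e \<in> E \<Longrightarrow> card (crossings E c e) \<le> k"
begin

lemma finV: "finite V" and finE: "finite E" and edge_V: "e \<in> E \<Longrightarrow> e \<subseteq> V" and edge_2: "e \<in> E \<Longrightarrow> card e = 2"
proof -
  show finV: "finite V" using graph by (simp add: simple_graph_def)
  show edge: "e \<subseteq> V" if "e \<in> E" for e using graph that by (simp add: simple_graph_def)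
  show "card e = 2" if "e \<in> E" for e using graph that by (simp add: simple_graph_def)
  show "finite E" by (rule finite_subset[of _ "Pow V"]) (use edge finV in auto)
qed

text \<open>\<open>Q\<close> is the vertex set of the planarisation.\<close>

definition "Q = \<pi> ` V \<union> (\<Union>e\<in>E. \<Union>f\<in>E - {e}. edge_interior c e \<inter> edge_interior c f)"

definition "params e = {t \<in> {0..1}. c e t \<in> Q}"

text \<open>The edges of the planarisation, as pieces of a curve between consecutive parameters at
  which it passes through \<open>Q\<close>.\<close>

definition "arcs = {(e, s, t). e \<in> E \<and> s \<in> params e \<and> t \<in> params e \<and> s < t \<and> (\<forall>u\<in>params e. u \<le> s \<or> t \<le> u)}"

lemma finQ: "finite Q"
  unfolding Q_def by (intro finite_UnI finite_imageI finite_UN_I finite_Diff finV finE fin_cross) auto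

lemma Q_M: "Q \<subseteq> M"
proof -
  have "edge_interior c e \<subseteq> M" if "e \<in> E" for e
    using in_M[OF that] unfolding edge_interior_def by (auto simp: image_subset_iff)
  then show ?thesis unfolding Q_def using \<pi>_M by blast
qed

lemma params_01: "params e \<subseteq> {0..1}"
  unfolding params_def by blast

lemma fin_params: "e \<in> E \<Longrightarrow> finite (params e)"
proof -
  assume e: "e \<in> E"
  have "params e = c e -` Q \<inter> {0..1}" unfolding params_def by auto
  then show ?thesis using finite_vimage_IntI[OF finQ inj[OF e]] by simp
qed

lemma endpoint_params: "e \<in> E \<Longrightarrow> 0 \<in> params e" "e \<in> E \<Longrightarrow> 1 \<in> params e"
proof -
  assume e: "e \<in> E"
  have "{c e 0, c e 1} \<subseteq> \<pi> ` V" using ends[OF e] edge_V[OF e] by auto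
  then show "0 \<in> params e" "1 \<in> params e" unfolding params_def Q_def by auto
qed

lemma meet_Q:
  assumes "e \<in> E" "f \<in> E" "u \<in> {0..1}" "u' \<in> {0..1}" "c e u = c f u'"
  shows "(e = f \<and> u = u') \<or> c e u \<in> Q"
proof (cases "e = f")
  case True
  then show ?thesis using inj[OF assms(1)] assms by (auto simp: inj_on_def)
next
  case False
  have Qe: "c e u \<in> Q" if "u = 0 \<or> u = 1"
    using endpoint_params[OF assms(1)] that unfolding params_def by auto
  have Qf: "c f u' \<in> Q" if "u' = 0 \<or> u' = 1"
    using endpoint_params[OF assms(2)] that unfolding params_def by auto
  show ?thesis
  proof (cases "u = 0 \<or> u = 1 \<or> u' = 0 \<or> u' = 1")
    case True
    then show ?thesis using Qe Qf assms(5) by auto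
  next
    case False
    then have "u \<in> {0<..<1}" "u' \<in> {0<..<1}" using assms(3,4) by auto
    then have "c e u \<in> edge_interior c e" "c f u' \<in> edge_interior c f"
      unfolding edge_interior_def by (simp_all only: imageI)
    then have "c e u \<in> edge_interior c e" "c e u \<in> edge_interior c f"
      using assms(5) by simp_all
    then show ?thesis using assms(1,2) \<open>e \<noteq> f\<close> unfolding Q_def by blast
  qed
qed

text \<open>Apart from the two ends of \<open>e\<close>, a point of \<open>Q\<close> on its curve is
  no vertex by \<open>avoid\<close>, so some edge other than \<open>e\<close> passes through it;
  each such parameter accounts for a crossing of its own.\<close>

lemma card_params:
  assumes e: "e \<in> E" shows "card (params e) \<le> k + 2"
proof -
  let ?I = "params e \<inter> {0<..<1}"
  have fin: "finite (crossings E c e)"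
    unfolding crossings_def using finE fin_cross[OF e] by (intro finite_SigmaI) auto
  have "c e ` ?I \<subseteq> snd ` crossings E c e"
  proof
    fix x assume "x \<in> c e ` ?I"
    then obtain t where t: "t \<in> ?I" "x = c e t" by blast
    have xe: "x \<in> edge_interior c e" using t unfolding edge_interior_def by auto
    then have "x \<notin> \<pi> ` V" using avoid[OF e] by blast
    moreover have "x \<in> Q" using t unfolding params_def by simp
    ultimately obtain f h where fh: "f \<in> E" "h \<in> E" "f \<noteq> h" "x \<in> edge_interior c f" "x \<in> edge_interior c h"
      unfolding Q_def by blast
    obtain f' where f': "f' \<in> E" "f' \<noteq> e" "x \<in> edge_interior c f'"
    proof (cases "f = e")
      case True
      then show ?thesis using that[of h] fh by auto
    next
      case False
      then show ?thesis using that[of f] fh by auto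
    qed
    then have "(f', x) \<in> crossings E c e" unfolding crossings_def using xe by auto
    then show "x \<in> snd ` crossings E c e" by force
  qed
  then have "card (c e ` ?I) \<le> card (snd ` crossings E c e)" using fin by (intro card_mono) auto
  also have "\<dots> \<le> k" using card_image_le[OF fin, of snd] few[OF e] by linarith
  also have "card (c e ` ?I) = card ?I"
    by (rule card_image, rule inj_on_subset[OF inj[OF e]]) (use params_01 in auto)
  finally have I: "card ?I \<le> k" .
  have "params e \<subseteq> {0, 1} \<union> ?I" using params_01[of e] by force
  then have "card (params e) \<le> card ({0, 1} \<union> ?I)" using fin_params[OF e] by (intro card_mono) auto
  also have "\<dots> \<le> card {0 :: real, 1} + card ?I" by (rule card_Un_le)
  finally show ?thesis using I by simp
qed

section \<open>Stars and arcs of the planarisation\<close>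

text \<open>The factor 2 makes the intervals of radius \<open>\<eta>\<close> around the parameters
  of an edge disjoint and leaves a nonempty arc between consecutive ones.\<close>

definition gap :: "real \<Rightarrow> bool" where
  "gap \<eta> \<longleftrightarrow> 0 < \<eta> \<and> (\<forall>e\<in>E. \<forall>s\<in>params e. \<forall>t\<in>params e. s \<noteq> t \<longrightarrow> 2 * \<eta> < \<bar>s - t\<bar>)"

lemma ex_gap: "\<exists>\<eta>. gap \<eta>"
proof -
  let ?A = "SIGMA e : E. {(s, t). s \<in> params e \<and> t \<in> params e \<and> s \<noteq> t}"
  let ?P = "\<lambda>(e :: 'a set, s :: real, t) \<eta>. 2 * \<eta> < \<bar>s - t\<bar>"
  have "finite {(s, t). s \<in> params e \<and> t \<in> params e \<and> s \<noteq> t}" if "e \<in> E" for e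
    by (rule finite_subset[of _ "params e \<times> params e"]) (use fin_params[OF that] in auto)
  then have fin: "finite ?A" using finE by (intro finite_SigmaI)
  have "\<exists>d>0. \<forall>a\<in>?A. ?P a d"
  proof (rule finite_uniform_pos[OF fin])
    fix a assume "a \<in> ?A"
    then obtain e s t where "a = (e, s, t)" "s \<noteq> t" by auto
    then show "\<exists>d>0. ?P a d" by (intro exI[of _ "\<bar>s - t\<bar> / 4"]) auto
  qed auto
  then obtain d where "0 < d" "\<forall>a\<in>?A. ?P a d" by blast
  then have "gap d" unfolding gap_def by fastforce
  then show ?thesis ..
qed

text \<open>The point \<open>q\<close> with short pieces of all curves through it;
  \<open>insert {q}\<close> provides for isolated vertices. \<open>arc\<close> is what remains of an
  edge of the planarisation. Both include the points of the cut, so they are compact and an arc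
  still meets the stars of its two ends.\<close>

definition star :: "real \<Rightarrow> 'e \<Rightarrow> 'e set" where
  "star \<eta> q = \<Union>(insert {q} ((\<lambda>(e, t). c e ` ({t - \<eta>..t + \<eta>} \<inter> {0..1})) ` (SIGMA e : E. {t \<in> params e. c e t = q})))"

definition arc :: "real \<Rightarrow> 'a set \<times> real \<times> real \<Rightarrow> 'e set" where
  "arc \<eta> = (\<lambda>(e, s, t). c e ` {s + \<eta>..t - \<eta>})"

lemma star_iff: "x \<in> star \<eta> q \<longleftrightarrow>
    x = q \<or> (\<exists>e\<in>E. \<exists>t\<in>params e. \<exists>u\<in>{0..1}. \<bar>u - t\<bar> \<le> \<eta> \<and> c e t = q \<and> x = c e u)"
proof
  assume "x \<in> star \<eta> q"
  then consider "x = q" | e t where "e \<in> E" "t \<in> params e" "c e t = q" "x \<in> c e ` ({t - \<eta>..t + \<eta>} \<inter> {0..1})"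
    unfolding star_def by blast
  then show "x = q \<or> (\<exists>e\<in>E. \<exists>t\<in>params e. \<exists>u\<in>{0..1}. \<bar>u - t\<bar> \<le> \<eta> \<and> c e t = q \<and> x = c e u)"
  proof cases
    case 2
    then obtain u where "u \<in> {t - \<eta>..t + \<eta>} \<inter> {0..1}" "x = c e u" by blast
    moreover from this have "\<bar>u - t\<bar> \<le> \<eta>" "u \<in> {0..1}" by auto
    ultimately show ?thesis using 2 by blast
  qed simp
next
  assume "x = q \<or> (\<exists>e\<in>E. \<exists>t\<in>params e. \<exists>u\<in>{0..1}. \<bar>u - t\<bar> \<le> \<eta> \<and> c e t = q \<and> x = c e u)"
  then consider "x = q" | e t u where "e \<in> E" "t \<in> params e" "u \<in> {0..1}" "\<bar>u - t\<bar> \<le> \<eta>" "c e t = q" "x = c e u"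
    by blast
  then show "x \<in> star \<eta> q"
  proof cases
    case 2
    then have "u \<in> {t - \<eta>..t + \<eta>} \<inter> {0..1}" by auto
    then have "x \<in> c e ` ({t - \<eta>..t + \<eta>} \<inter> {0..1})" unfolding 2(6) by (rule imageI)
    then show ?thesis using 2(1,2,5) unfolding star_def by blast
  qed (simp add: star_def)
qed

context
  fixes \<eta> :: real
  assumes \<eta>: "gap \<eta>"
begin

lemma eta_pos: "0 < \<eta>"
  using \<eta> unfolding gap_def by blast

lemma gapD: "e \<in> E \<Longrightarrow> s \<in> params e \<Longrightarrow> t \<in> params e \<Longrightarrow> \<bar>s - t\<bar> \<le> 2 * \<eta> \<Longrightarrow> s = t"
  using \<eta> unfolding gap_def by force

lemma star_Q:
  assumes "x \<in> star \<eta> q" "x \<in> Q" shows "x = q"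
proof (rule ccontr)
  assume "x \<noteq> q"
  then obtain e t u where e: "e \<in> E" "t \<in> params e" "u \<in> {0..1}" "\<bar>u - t\<bar> \<le> \<eta>" "c e t = q" "x = c e u"
    using assms(1) unfolding star_iff by blast
  have "u \<in> params e" using e assms(2) unfolding params_def by simp
  then have "u = t" using gapD[OF e(1) _ e(2), of u] e(4) eta_pos by simp
  then show False using e \<open>x \<noteq> q\<close> by simp
qed

text \<open>A common point of two stars is off \<open>Q\<close>, so by \<open>meet_Q\<close> it lies
  on one curve at one parameter. This parameter would be within \<open>\<eta>\<close> of two
  different members of \<open>params\<close>.\<close>

lemma star_disjoint:
  assumes "q \<in> Q" "q' \<in> Q" "q \<noteq> q'" shows "star \<eta> q \<inter> star \<eta> q' = {}"
proof (rule ccontr)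
  assume "\<not> ?thesis"
  then obtain x where x: "x \<in> star \<eta> q" "x \<in> star \<eta> q'" by blast
  then have xQ: "x \<notin> Q" using star_Q assms by blast
  obtain e t u where e: "e \<in> E" "t \<in> params e" "u \<in> {0..1}" "\<bar>u - t\<bar> \<le> \<eta>" "c e t = q" "x = c e u"
    using x(1) xQ assms(1) unfolding star_iff by blast
  obtain f t' u' where f: "f \<in> E" "t' \<in> params f" "u' \<in> {0..1}" "\<bar>u' - t'\<bar> \<le> \<eta>" "c f t' = q'" "x = c f u'"
    using x(2) xQ assms(2) unfolding star_iff by blast
  have eq: "e = f" "u = u'" using meet_Q[OF e(1) f(1) e(3) f(3)] e(6) f(6) xQ by auto
  have "\<bar>t - t'\<bar> \<le> 2 * \<eta>" using e(4) f(4) eq by linarith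
  then have "t = t'" using gapD e(1,2) f(2) eq by blast
  then show False using e(5) f(5) eq assms(3) by simp
qed

lemma arcsD:
  assumes "(e, s, t) \<in> arcs"
  shows "e \<in> E" "s \<in> params e" "t \<in> params e" "s + \<eta> < t - \<eta>" "{s + \<eta>..t - \<eta>} \<subseteq> {0..1}"
    "\<And>u. u \<in> params e \<Longrightarrow> u \<le> s \<or> t \<le> u"
proof -
  show a: "e \<in> E" "s \<in> params e" "t \<in> params e" "\<And>u. u \<in> params e \<Longrightarrow> u \<le> s \<or> t \<le> u"
    using assms unfolding arcs_def by auto
  have "s < t" using assms unfolding arcs_def by auto
  then show "s + \<eta> < t - \<eta>" using gapD[OF a(1-3)] by fastforce
  show "{s + \<eta>..t - \<eta>} \<subseteq> {0..1}" using a(2,3) params_01[of e] eta_pos by fastforce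
qed

lemma arc_not_Q:
  assumes m: "(e, s, t) \<in> arcs" and u: "u \<in> {s + \<eta>..t - \<eta>}" shows "c e u \<notin> Q"
proof
  assume "c e u \<in> Q"
  then have "u \<in> params e" using u arcsD(5)[OF m] unfolding params_def by auto
  then show False using arcsD(6)[OF m] u eta_pos by fastforce
qed

lemma arc_disjoint:
  assumes m: "m \<in> arcs" "m' \<in> arcs" "m \<noteq> m'" shows "arc \<eta> m \<inter> arc \<eta> m' = {}"
proof (rule ccontr)
  assume neg: "\<not> ?thesis"
  obtain e s t f s' t' where mm: "m = (e, s, t)" "m' = (f, s', t')" by (metis prod.exhaust)
  obtain x where "x \<in> arc \<eta> m" "x \<in> arc \<eta> m'" using neg by blast
  then obtain u u' where u: "u \<in> {s + \<eta>..t - \<eta>}" "u' \<in> {s' + \<eta>..t' - \<eta>}" "c e u = c f u'"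
    unfolding mm arc_def by auto
  note d = arcsD[OF m(1)[unfolded mm]] and d' = arcsD[OF m(2)[unfolded mm]]
  have "c e u \<notin> Q" using arc_not_Q m(1) u(1) unfolding mm by blast
  moreover have "u \<in> {0..1}" "u' \<in> {0..1}" using u d(5) d'(5) by auto
  ultimately have eq: "e = f" "u = u'" using meet_Q[OF d(1) d'(1) _ _ u(3)] by auto
  have s: "s' \<le> s \<or> t \<le> s'" "t' \<le> s \<or> t \<le> t'" using d(6) d'(2,3) eq(1) by auto
  have t: "s \<le> s' \<or> t' \<le> s" "t \<le> s' \<or> t' \<le> t" using d'(6) d(2,3) eq(1) by auto
  have uu: "s < u" "u < t" "s' < u" "u < t'" using u(1,2) eq(2) eta_pos by auto
  have "s = s'" "t = t'" using s t uu by linarith+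
  then show False using m(3) mm eq by simp
qed

lemma arc_star:
  assumes m: "(e, s, t) \<in> arcs" and q: "q \<in> Q" and meet: "arc \<eta> (e, s, t) \<inter> star \<eta> q \<noteq> {}"
  shows "q = c e s \<or> q = c e t"
proof -
  obtain x where x: "x \<in> arc \<eta> (e, s, t)" "x \<in> star \<eta> q" using meet by blast
  then obtain u where u: "u \<in> {s + \<eta>..t - \<eta>}" "x = c e u" unfolding arc_def by auto
  note d = arcsD[OF m]
  have xQ: "x \<notin> Q" using arc_not_Q[OF m u(1)] u(2) by simp
  obtain f t' u' where f: "f \<in> E" "t' \<in> params f" "u' \<in> {0..1}" "\<bar>u' - t'\<bar> \<le> \<eta>" "c f t' = q" "x = c f u'"
    using x(2) xQ q unfolding star_iff by blast
  have "u \<in> {0..1}" using u d(5) by auto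
  then have eq: "e = f" "u = u'" using meet_Q[OF d(1) f(1) _ f(3)] u(2) f(6) xQ by auto
  have "t' \<le> s \<or> t \<le> t'" using d(6) f(2) eq by auto
  then have "t' = s \<or> t' = t" using f(4) u(1) eq(2) by auto
  then show ?thesis using f(5) eq by auto
qed

lemma arc_ends:
  assumes m: "(e, s, t) \<in> arcs"
  shows "c e (s + \<eta>) \<in> arc \<eta> (e, s, t) \<inter> star \<eta> (c e s)" "c e (t - \<eta>) \<in> arc \<eta> (e, s, t) \<inter> star \<eta> (c e t)"
proof -
  note d = arcsD[OF m]
  have in01: "s + \<eta> \<in> {0..1}" "t - \<eta> \<in> {0..1}" using d(4,5) by auto
  have "c e (s + \<eta>) \<in> arc \<eta> (e, s, t)" "c e (t - \<eta>) \<in> arc \<eta> (e, s, t)"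
    using d(4) unfolding arc_def by auto
  moreover have "c e (s + \<eta>) \<in> star \<eta> (c e s)"
    unfolding star_iff
    by (rule disjI2, rule bexI[OF _ d(1)], rule bexI[OF _ d(2)], rule bexI[OF _ in01(1)]) (use eta_pos in simp)
  moreover have "c e (t - \<eta>) \<in> star \<eta> (c e t)"
    unfolding star_iff
    by (rule disjI2, rule bexI[OF _ d(1)], rule bexI[OF _ d(3)], rule bexI[OF _ in01(2)]) (use eta_pos in simp)
  ultimately show "c e (s + \<eta>) \<in> arc \<eta> (e, s, t) \<inter> star \<eta> (c e s)"
    "c e (t - \<eta>) \<in> arc \<eta> (e, s, t) \<inter> star \<eta> (c e t)" by simp_all
qed

lemma arc_compact_connected:
  assumes "m \<in> arcs" shows "compact (arc \<eta> m)" "connected (arc \<eta> m)" "arc \<eta> m \<subseteq> M"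
proof -
  obtain e s t where m: "m = (e, s, t)" by (metis prod.exhaust)
  note d = arcsD[OF assms[unfolded m]]
  have "continuous_on {s + \<eta>..t - \<eta>} (c e)" using cont[OF d(1)] d(5) by (rule continuous_on_subset)
  then show "compact (arc \<eta> m)" "connected (arc \<eta> m)"
    unfolding m arc_def by (auto intro: compact_continuous_image connected_continuous_image)
  show "arc \<eta> m \<subseteq> M" using in_M[OF d(1)] d(5) unfolding m arc_def by auto
qed

lemma star_compact_connected:
  assumes "q \<in> Q" shows "compact (star \<eta> q)" "connected (star \<eta> q)" "star \<eta> q \<subseteq> M" "q \<in> star \<eta> q"
proof -
  let ?F = "insert {q} ((\<lambda>(e, t). c e ` ({t - \<eta>..t + \<eta>} \<inter> {0..1})) ` (SIGMA e : E. {t \<in> params e. c e t = q}))"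
  have contF: "continuous_on ({t - \<eta>..t + \<eta>} \<inter> {0..1}) (c e)" if "e \<in> E" for e t
    using cont[OF that] by (rule continuous_on_subset) auto
  have int: "{t - \<eta>..t + \<eta>} \<inter> {0..1} = {max (t - \<eta>) 0..min (t + \<eta>) 1}" for t :: real by auto
  have piece: "compact S \<and> connected S \<and> q \<in> S \<and> S \<subseteq> M" if "S \<in> ?F" for S
  proof (cases "S = {q}")
    case True
    then show ?thesis using assms Q_M by auto
  next
    case False
    then obtain e t where e: "e \<in> E" "t \<in> params e" "c e t = q" "S = c e ` ({t - \<eta>..t + \<eta>} \<inter> {0..1})"
      using \<open>S \<in> ?F\<close> by auto
    have "compact S" "connected S" unfolding e(4) using contF[OF e(1), of t]
      by (auto simp: int intro: compact_continuous_image connected_continuous_image)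
    moreover have "q \<in> S" using e(2,3) eta_pos params_01[of e] unfolding e(4) by force
    moreover have "S \<subseteq> M" using in_M[OF e(1)] unfolding e(4) by auto
    ultimately show ?thesis by blast
  qed
  have "finite ?F" using finE fin_params by (intro finite.insertI finite_imageI finite_SigmaI) auto
  then show "compact (star \<eta> q)" unfolding star_def using piece by (intro compact_Union) auto
  show "connected (star \<eta> q)" unfolding star_def
    by (rule connected_Union) (use piece in blast)+
  show "star \<eta> q \<subseteq> M" unfolding star_def using piece by blast
  show "q \<in> star \<eta> q" unfolding star_iff by simp
qed

end

text \<open>Any end of an edge serves at a crossing, since a robber who uses the edge visits both of
  its ends.\<close>

definition cops_at :: "'e \<Rightarrow> 'a set" where
  "cops_at u = (if u \<in> \<pi> ` V then {v \<in> V. \<pi> v = u} else (\<lambda>e. SOME v. v \<in> e) ` {e \<in> E. u \<in> edge_interior c e})"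

lemma some_end: "e \<in> E \<Longrightarrow> (SOME v. v \<in> e) \<in> e"
  using edge_2 by (metis card.empty some_in_eq zero_neq_numeral)

lemma cops_at: "cops_at u \<subseteq> V" "finite (cops_at u) \<and> card (cops_at u) \<le> 2" "v \<in> V \<Longrightarrow> v \<in> cops_at (\<pi> v)"
proof -
  let ?Eu = "{e \<in> E. u \<in> edge_interior c e}"
  show sub: "cops_at u \<subseteq> V" unfolding cops_at_def using some_end edge_V by auto
  have "card (cops_at u) \<le> 2"
  proof (cases "u \<in> \<pi> ` V")
    case True
    then obtain v where "v \<in> V" "\<pi> v = u" by blast
    then have "cops_at u = {v}" using inj_\<pi> True unfolding cops_at_def by (auto simp: inj_on_def)
    then show ?thesis by simp
  next
    case False
    have "\<not> 3 \<le> card ?Eu"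
    proof
      assume "3 \<le> card ?Eu"
      then obtain S where S: "S \<subseteq> ?Eu" "card S = 3" by (metis obtain_subset_with_card_n)
      then obtain e f h where "S = {e, f, h}" "e \<noteq> f" "e \<noteq> h" "f \<noteq> h" by (metis card_3_iff)
      with S no_three[of e f h] show False by auto
    qed
    moreover have "card ((\<lambda>e. SOME v. v \<in> e) ` ?Eu) \<le> card ?Eu" using finE by (intro card_image_le) simp
    ultimately show ?thesis using False unfolding cops_at_def by auto
  qed
  then show "finite (cops_at u) \<and> card (cops_at u) \<le> 2" using sub finV finite_subset by blast
  show "v \<in> V \<Longrightarrow> v \<in> cops_at (\<pi> v)" unfolding cops_at_def by auto
qed

lemma cops_at_edge:
  assumes e: "e \<in> E" and t: "t \<in> {0..1}" shows "\<exists>v\<in>e. v \<in> cops_at (c e t)"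
proof (cases "t = 0 \<or> t = 1")
  case True
  then have "c e t \<in> \<pi> ` e" using ends[OF e] by auto
  then obtain v where "v \<in> e" "c e t = \<pi> v" by blast
  then show ?thesis using cops_at(3) edge_V[OF e] by auto
next
  case False
  then have "c e t \<in> edge_interior c e" using t unfolding edge_interior_def by auto
  then show ?thesis using some_end[OF e] avoid[OF e] e unfolding cops_at_def by auto
qed

text \<open>The vertex sets of the stars are the initial classes of \<open>ex_labelling\<close>, and
  those of the arcs are the connecting sets.\<close>

theorem ex_surface_labelling:
  assumes fine: "\<forall>\<epsilon>>0. \<exists>(T :: nat set set) p \<beta>. tri_cover T p \<beta> M \<epsilon> \<and> euler T = eu"
    and neV: "V \<noteq> {}"
  shows "\<exists>(T :: nat set set) (lam :: nat \<Rightarrow> 'e). surface T \<and> euler T = eu \<and>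
    (\<forall>u. conn (vadj T) {w \<in> \<Union>T. lam w = u}) \<and> Q \<subseteq> lam ` \<Union>T \<and>
    (\<forall>e s t. (e, s, t) \<in> arcs \<longrightarrow> (\<exists>w w'. vadj T w w' \<and> lam w = c e s \<and> lam w' = c e t))"
proof -
  obtain \<eta> where \<eta>: "gap \<eta>" using ex_gap by blast
  have fin_arcs: "finite arcs"
    by (rule finite_subset[of _ "SIGMA e : E. params e \<times> params e"])
      (use finE fin_params in \<open>auto simp: arcs_def\<close>)
  let ?F = "star \<eta> ` Q \<union> arc \<eta> ` arcs"
  have finF: "finite (?F \<times> ?F)" using finQ fin_arcs by simp
  have compF: "compact S" if "S \<in> ?F" for S
    using that star_compact_connected(1)[OF \<eta>] arc_compact_connected(1)[OF \<eta>] by auto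
  let ?P = "\<lambda>(S, S') d. S \<inter> S' = {} \<longrightarrow> (\<forall>x\<in>S. \<forall>y\<in>S'. d \<le> dist x y)"
  have "\<exists>d>0. \<forall>a\<in>?F \<times> ?F. ?P a d"
  proof (rule finite_uniform_pos[OF finF])
    fix a assume a: "a \<in> ?F \<times> ?F"
    obtain S S' where SS: "a = (S, S')" by (metis prod.exhaust)
    show "\<exists>d>0. ?P a d"
    proof (cases "S \<inter> S' = {}")
      case True
      have "compact S" "compact S'" using compF a unfolding SS by blast+
      then have "\<exists>d>0. \<forall>x\<in>S. \<forall>y\<in>S'. d \<le> dist x y"
        using separate_compact_closed[of S S'] True compact_imp_closed by blast
      then show ?thesis unfolding SS by auto
    next
      case False
      then show ?thesis unfolding SS by (auto intro: exI[of _ 1])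
    qed
  next
    fix a d d' assume "?P a d" "d' \<le> d"
    then show "?P a d'" by (auto split: prod.splits) (meson order_trans)
  qed
  then obtain d where d: "0 < d" "\<forall>a\<in>?F \<times> ?F. ?P a d" by blast
  \<comment> \<open>Disjoint pieces are at least \<open>d\<close> apart, and
    \<open>star_nbhd_disjoint\<close> needs more than twice the mesh; hence
    \<open>d / 3\<close>.\<close>
  obtain T :: "nat set set" and p \<beta> where T: "tri_cover T p \<beta> M (d / 3)" "euler T = eu"
    using fine[rule_format, of "d / 3"] d(1) by auto
  have surf: "surface T" using T(1) unfolding tri_cover_def by blast
  interpret surface T by (rule surf)
  let ?N = "star_nbhd T \<beta>"
  have disj: "?N S \<inter> ?N S' = {}" if S: "S \<in> ?F" "S' \<in> ?F" "S \<inter> S' = {}" "S \<subseteq> M" "S' \<subseteq> M" for S S'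
  proof (rule star_nbhd_disjoint[OF T(1) S(4,5)])
    fix x y assume xy: "x \<in> S" "y \<in> S'"
    have "(S, S') \<in> ?F \<times> ?F" using S(1,2) by (rule SigmaI)
    from bspec[OF d(2) this] have "\<forall>x\<in>S. \<forall>y\<in>S'. d \<le> dist x y" using S(3) by simp
    then have "d \<le> dist x y" using xy by simp
    then show "2 * (d / 3) < dist x y" using d(1) by linarith
  qed
  note st = star_compact_connected[OF \<eta>] and ar = arc_compact_connected[OF \<eta>]
  define src tgt where "src m = c (fst m) (fst (snd m))" and "tgt m = c (fst m) (snd (snd m))" for m
  have "\<exists>lam. (\<forall>q\<in>Q. \<forall>w\<in>?N (star \<eta> q). lam w = q) \<and> (\<forall>q. conn (vadj T) {w \<in> W. lam w = q}) \<and>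
    (\<forall>m\<in>arcs. src m \<noteq> tgt m \<longrightarrow>
      (\<exists>w w'. vadj T w w' \<and> lam w = src m \<and> lam w' = tgt m))"
  proof (rule ex_labelling[where P = "\<lambda>m. ?N (arc \<eta> m)"])
    show "finite W" by (rule fin_W)
    show "vadj T y x" if "vadj T x y" for x y by (rule vadj_sym[OF that])
    show "conn (vadj T) W" by (rule conn_verts)
    show "Q \<noteq> {}" using neV unfolding Q_def by auto
    show "?N S \<subseteq> W" for S unfolding star_nbhd_def by blast
    then show "?N (arc \<eta> m) \<subseteq> W" for m .
    show "?N (star \<eta> q) \<noteq> {}" if "q \<in> Q" for q
      using star_nbhd_nonempty[OF T(1) st(3)[OF that]] st(4)[OF that] by blast
    show "conn (vadj T) (?N (star \<eta> q))" if "q \<in> Q" for q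
      by (rule star_nbhd_conn[OF T(1) st(3,2)[OF that]])
    show "?N (star \<eta> q) \<inter> ?N (star \<eta> q') = {}" if "q \<in> Q" "q' \<in> Q" "q \<noteq> q'" for q q'
      by (rule disj) (use that st(3) star_disjoint[OF \<eta>] in auto)
    show "conn (vadj T) (?N (arc \<eta> m))" if "m \<in> arcs" for m
      by (rule star_nbhd_conn[OF T(1) ar(3,2)[OF that]])
    show "?N (arc \<eta> m) \<inter> ?N (arc \<eta> m') = {}" if "m \<in> arcs" "m' \<in> arcs" "m \<noteq> m'" for m m'
      by (rule disj) (use that ar(3) arc_disjoint[OF \<eta>] in auto)
    fix m assume m: "m \<in> arcs"
    obtain e s t where est: "m = (e, s, t)" by (metis prod.exhaust)
    note d = arcsD[OF \<eta> m[unfolded est]]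
    have Qst: "c e s \<in> Q" "c e t \<in> Q" using d(2,3) unfolding params_def by auto
    note en = arc_ends[OF \<eta> m[unfolded est]]
    have ends': "src m = c e s" "tgt m = c e t" unfolding src_def tgt_def est by simp_all
    have M: "arc \<eta> (e, s, t) \<subseteq> M" using ar(3)[OF m] unfolding est .
    show "src m \<in> Q \<and> ?N (arc \<eta> m) \<inter> ?N (star \<eta> (src m)) \<noteq> {}"
      using Qst(1) star_nbhd_meets[OF T(1), of "c e (s + \<eta>)"] en(1) M unfolding ends' unfolding est by auto
    show "tgt m \<in> Q \<and> ?N (arc \<eta> m) \<inter> ?N (star \<eta> (tgt m)) \<noteq> {}"
      using Qst(2) star_nbhd_meets[OF T(1), of "c e (t - \<eta>)"] en(2) M unfolding ends' unfolding est by auto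
    show "q = src m \<or> q = tgt m"
      if "q \<in> Q" "?N (arc \<eta> m) \<inter> ?N (star \<eta> q) \<noteq> {}" for q
    proof -
      have "arc \<eta> m \<inter> star \<eta> q \<noteq> {}"
        using disj[of "arc \<eta> m" "star \<eta> q"] that m ar(3)[OF m] st(3)[OF that(1)] by blast
      then show ?thesis using arc_star[OF \<eta> m[unfolded est] that(1)] unfolding ends' unfolding est by simp
    qed
  qed
  then obtain lam where lam: "\<forall>q\<in>Q. \<forall>w\<in>?N (star \<eta> q). lam w = q" "\<forall>q. conn (vadj T) {w \<in> W. lam w = q}"
    "\<forall>m\<in>arcs. src m \<noteq> tgt m \<longrightarrow>
      (\<exists>w w'. vadj T w w' \<and> lam w = src m \<and> lam w' = tgt m)"
    by (elim exE conjE) (rule that)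
  show ?thesis
  proof (intro exI[of _ T] exI[of _ lam] conjI allI impI)
    show "surface T" "euler T = eu" by (fact surf, fact T(2))
    show "conn (vadj T) {w \<in> W. lam w = u}" for u using lam(2) by blast
    show "Q \<subseteq> lam ` W"
    proof
      fix q assume q: "q \<in> Q"
      then obtain w where "w \<in> ?N (star \<eta> q)"
        using star_nbhd_nonempty[OF T(1) st(3)[OF q]] st(4)[OF q] by blast
      then show "q \<in> lam ` W" using lam(1) q unfolding star_nbhd_def by (metis (no_types, lifting) image_eqI mem_Collect_eq)
    qed
    show "\<exists>w w'. vadj T w w' \<and> lam w = c e s \<and> lam w' = c e t" if m: "(e, s, t) \<in> arcs" for e s t
    proof -
      note d = arcsD[OF \<eta> m]
      have "s \<noteq> t" using d(4) eta_pos[OF \<eta>] by auto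
      then have "c e s \<noteq> c e t" using inj[OF d(1)] d(2,3) params_01 unfolding inj_on_def by blast
      then show ?thesis using bspec[OF lam(3) m] by (simp add: src_def tgt_def)
    qed
  qed
qed

theorem cops_win_drawn:
  assumes fine: "\<forall>\<epsilon>>0. \<exists>(T :: nat set set) p \<beta>. tri_cover T p \<beta> M \<epsilon> \<and> euler T = eu"
    and genus: "2 - int g \<le> eu"
  shows "cops_win V E r (2 * ((2 * g + 3) * (4 * r * (k + 1) + 1)))"
proof (cases "V = {}")
  case True
  then show ?thesis unfolding cops_win_def robber_play_def by (intro exI[of _ "\<lambda>_. {}"]) simp
next
  case False
  obtain T :: "nat set set" and lam :: "nat \<Rightarrow> 'e" where T: "surface T" "euler T = eu"
    "\<forall>u. conn (vadj T) {w \<in> \<Union>T. lam w = u}" "Q \<subseteq> lam ` \<Union>T"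
    "\<forall>e s t. (e, s, t) \<in> arcs \<longrightarrow> (\<exists>w w'. vadj T w w' \<and> lam w = c e s \<and> lam w' = c e t)"
    using ex_surface_labelling[OF fine False] by (elim exE conjE) (rule that)
  show ?thesis
  proof (rule cops_win_surface[where lam = lam and \<pi> = \<pi> and cops = cops_at, OF T(1) _ T(3)[rule_format]])
    show "2 - int g \<le> euler T" using genus T(2) by simp
    show "\<pi> v \<in> lam ` \<Union>T" if "v \<in> V" for v using that T(4) unfolding Q_def by blast
    fix a b assume ab: "{a, b} \<in> E" "a \<in> V" "b \<in> V"
    let ?e = "{a, b}"
    let ?adj = "\<lambda>u u'. \<exists>w w'. vadj T w w' \<and> lam w = u \<and> lam w' = u'"
    have adj_sym: "?adj u' u" if "?adj u u'" for u u' using that vadj_sym by metis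
    \<comment> \<open>The route of an edge consists of the points of \<open>Q\<close> on its curve
      in the order of their parameters; consecutive ones bound an arc.\<close>
    define ts where "ts = sorted_list_of_set (params ?e)"
    have ts: "set ts = params ?e" "sorted_wrt (<) ts" "length ts = card (params ?e)"
      using fin_params[OF ab(1)] unfolding ts_def by auto
    have ts_ne: "ts \<noteq> []" using endpoint_params(1)[OF ab(1)] ts(1) by auto
    have nth_less: "ts ! i < ts ! j" if "i < j" "j < length ts" for i j
      using sorted_wrt_nth_less[OF ts(2) that] .
    have hd0: "hd ts = 0"
    proof -
      obtain i where i: "i < length ts" "ts ! i = 0" using endpoint_params(1)[OF ab(1)] ts(1) by (metis in_set_conv_nth)
      have "ts ! 0 \<in> params ?e" using ts_ne ts(1) by (metis length_greater_0_conv nth_mem)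
      then have "0 \<le> ts ! 0" using params_01[of ?e] by auto
      then have "i = 0" using nth_less[of 0 i] i by (cases "i = 0") auto
      then show ?thesis using i ts_ne by (simp add: hd_conv_nth)
    qed
    have last1: "last ts = 1"
    proof -
      obtain i where i: "i < length ts" "ts ! i = 1" using endpoint_params(2)[OF ab(1)] ts(1) by (metis in_set_conv_nth)
      have "ts ! (length ts - 1) \<in> params ?e" using ts_ne ts(1) by (metis last_conv_nth last_in_set)
      then have "ts ! (length ts - 1) \<le> 1" using params_01[of ?e] by auto
      moreover have "i < length ts - 1 \<Longrightarrow> 1 < ts ! (length ts - 1)" using nth_less[of i "length ts - 1"] i by simp
      ultimately have "i = length ts - 1" using i(1) by linarith
      then show ?thesis using i ts_ne by (simp add: last_conv_nth)
    qed
    have arc: "(?e, ts ! i, ts ! Suc i) \<in> arcs" if i: "Suc i < length ts" for i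
    proof -
      have mem: "ts ! i \<in> params ?e" "ts ! Suc i \<in> params ?e"
        unfolding ts(1)[symmetric] by (rule nth_mem; use i in simp)+
      have "u \<le> ts ! i \<or> ts ! Suc i \<le> u" if "u \<in> params ?e" for u
      proof -
        obtain j where j: "j < length ts" "u = ts ! j" using \<open>u \<in> params ?e\<close> ts(1) by (metis in_set_conv_nth)
        show ?thesis
        proof (cases "j \<le> i")
          case True
          then show ?thesis using nth_less[of j i] i j by (cases "j = i") auto
        next
          case False
          then show ?thesis using nth_less[of "Suc i" j] j by (cases "j = Suc i") auto
        qed
      qed
      then show ?thesis using mem nth_less[of i "Suc i"] i ab(1) unfolding arcs_def by simp
    qed
    let ?us = "map (c ?e) ts"
    have us: "?us \<noteq> []" "length ?us \<le> k + 2" "hd ?us = c ?e 0" "last ?us = c ?e 1"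
      using ts_ne ts(3) card_params[OF ab(1)] hd0 last1 by (auto simp: hd_map last_map)
    have us_cops: "\<forall>u\<in>set ?us. a \<in> cops_at u \<or> b \<in> cops_at u"
    proof
      fix u assume "u \<in> set ?us"
      then obtain t where "t \<in> params ?e" "u = c ?e t" using ts(1) by auto
      then show "a \<in> cops_at u \<or> b \<in> cops_at u" using cops_at_edge[OF ab(1), of t] params_01[of ?e] by auto
    qed
    have us_adj: "?adj (?us ! i) (?us ! Suc i)" if "Suc i < length ?us" for i
      using T(5)[rule_format, OF arc[of i]] that by simp
    have rev_adj: "?adj (rev ?us ! i) (rev ?us ! Suc i)" if i: "Suc i < length (rev ?us)" for i
    proof -
      let ?n = "length ?us"
      have n: "Suc i < ?n" using i by simp
      have "?adj (?us ! (?n - Suc (Suc i))) (?us ! Suc (?n - Suc (Suc i)))" by (rule us_adj) (use n in simp)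
      moreover have "Suc (?n - Suc (Suc i)) = ?n - Suc i" using n by simp
      moreover have "rev ?us ! i = ?us ! (?n - Suc i)" "rev ?us ! Suc i = ?us ! (?n - Suc (Suc i))"
        using n by (simp_all only: rev_nth Suc_lessD)
      ultimately show ?thesis using adj_sym by (simp only:)
    qed
    \<comment> \<open>The curve of \<open>{a, b}\<close> may run from \<open>b\<close> to
      \<open>a\<close>; then the reversed list is the route.\<close>
    have "{c ?e 0, c ?e 1} = {\<pi> a, \<pi> b}" using ends[OF ab(1)] by auto
    then consider "c ?e 0 = \<pi> a" "c ?e 1 = \<pi> b" | "c ?e 0 = \<pi> b" "c ?e 1 = \<pi> a"
      by (auto simp: doubleton_eq_iff)
    then show "\<exists>us. us \<noteq> [] \<and> hd us = \<pi> a \<and> last us = \<pi> b \<and> length us \<le> k + 2 \<and>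
      (\<forall>u\<in>set us. a \<in> cops_at u \<or> b \<in> cops_at u) \<and> (\<forall>i. Suc i < length us \<longrightarrow> ?adj (us ! i) (us ! Suc i))"
    proof cases
      case 1
      then show ?thesis using us us_cops us_adj by (intro exI[of _ ?us] conjI allI impI) (simp_all only: simp_thms)
    next
      case 2
      have "rev ?us \<noteq> []" "hd (rev ?us) = \<pi> a" "last (rev ?us) = \<pi> b" "length (rev ?us) \<le> k + 2"
        using us 2 by (simp_all add: hd_rev last_rev)
      then show ?thesis using us_cops rev_adj
        by (intro exI[of _ "rev ?us"] conjI allI impI) (simp_all only: set_rev simp_thms)
    qed
  qed (use cops_at in auto)
qed

end

section \<open>Transport from an abstract surface to a triangulated space\<close>

lemma homeomorphic_space_top_of_set_imp:
  fixes S :: "'e::euclidean_space set"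
  assumes "top_of_set S homeomorphic_space (euclidean :: 'f::euclidean_space topology)"
  shows "S homeomorphic (UNIV :: 'f set)"
proof -
  obtain f g where fg: "homeomorphic_maps (top_of_set S) (euclidean :: 'f topology) f g"
    using assms unfolding homeomorphic_space_def by blast
  then have "continuous_on S f" "continuous_on UNIV g" "g ` UNIV \<subseteq> S" "\<forall>x\<in>S. g (f x) = x" "\<forall>y. f (g y) = y"
    unfolding homeomorphic_maps_def by (auto simp: continuous_map_in_subtopology)
  then have "homeomorphism S (UNIV :: 'f set) f g"
    by (intro homeomorphismI) auto
  then show ?thesis unfolding homeomorphic_def by blast
qed

lemma closed_surface_tri_cover:
  fixes K :: "(real^5) set set"
  assumes X: "closed_surface X" and K: "simplicial_complex K"
    and h: "homeomorphic_map X (top_of_set (\<Union>K)) h"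
  shows "\<exists>(T :: (real^5) set set) p \<beta> \<delta>. tri_cover T p \<beta> (\<Union>K) \<delta> \<and> euler T = euler_char_2 K"
proof (rule simplicial_surface_tri_cover[OF K])
  let ?M = "\<Union>K"
  have hX: "h ` topspace X = ?M" using homeomorphic_imp_surjective_map[OF h] by simp
  have XM: "X homeomorphic_space top_of_set ?M" using h by (rule homeomorphic_map_imp_homeomorphic_space)
  have "connected_space (top_of_set ?M)"
    using homeomorphic_connected_space[OF XM] X unfolding closed_surface_def by blast
  then have "connectedin euclidean ?M" by (simp add: connectedin_def)
  then show "connected ?M" by simp
  have "topspace X \<noteq> {}" using X unfolding closed_surface_def by (elim conjE)
  then show "?M \<noteq> {}" unfolding hX[symmetric] by simp
  fix x assume "x \<in> ?M"
  then obtain y where y: "y \<in> topspace X" "x = h y" using hX by blast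
  then obtain U where U: "openin X U" "y \<in> U"
    "subtopology X U homeomorphic_space (euclidean :: (real^2) topology)"
    using X unfolding closed_surface_def by blast
  have UX: "U \<subseteq> topspace X" using U(1) by (rule openin_subset)
  have op: "openin (top_of_set ?M) (h ` U)" using homeomorphic_map_openness[OF h UX] U(1) by simp
  have hU: "h ` (topspace X \<inter> U) = topspace (top_of_set ?M) \<inter> h ` U"
    using UX hX by auto
  have "homeomorphic_map (subtopology X U) (subtopology (top_of_set ?M) (h ` U)) h"
    by (rule homeomorphic_map_subtopologies[OF h hU])
  moreover have "subtopology (top_of_set ?M) (h ` U) = top_of_set (h ` U)"
    using image_mono[OF UX, of h] unfolding hX by (simp add: subtopology_subtopology inf.absorb2)
  ultimately have "subtopology X U homeomorphic_space top_of_set (h ` U)"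
    using homeomorphic_map_imp_homeomorphic_space by metis
  then have "top_of_set (h ` U) homeomorphic_space (euclidean :: (real^2) topology)"
    using U(3) homeomorphic_space_sym homeomorphic_space_trans by blast
  then have "h ` U homeomorphic (UNIV :: (real^2) set)" by (rule homeomorphic_space_top_of_set_imp)
  then show "\<exists>U. openin (top_of_set ?M) U \<and> x \<in> U \<and> U homeomorphic (UNIV :: (real^2) set)"
    using op U(2) y(2) by blast
qed

text \<open>\<open>h\<close> is injective on the surface, so it commutes with intersections of
  curves and creates no new crossings.\<close>

lemma drawn_graph_homeomorphic_image:
  fixes K :: "'e::euclidean_space set"
  assumes graph: "simple_graph V E" and h: "homeomorphic_map X (top_of_set K) h"
    and dr: "drawing X V E \<pi> c" and few: "\<And>e. e \<in> E \<Longrightarrow> card (crossings E c e) \<le> k"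
  shows "drawn_graph K V E (\<lambda>v. h (\<pi> v)) (\<lambda>e t. h (c e t)) k"
proof -
  have hinj: "inj_on h (topspace X)" and hX: "h ` topspace X = K"
    using homeomorphic_imp_injective_map[OF h] homeomorphic_imp_surjective_map[OF h] by auto
  have hcont: "continuous_map X (top_of_set K) h" using h by (rule homeomorphic_imp_continuous_map)
  have \<pi>: "inj_on \<pi> V" "\<pi> ` V \<subseteq> topspace X"
    and c: "\<And>e. e \<in> E \<Longrightarrow> pathin X (c e)" "\<And>e. e \<in> E \<Longrightarrow> inj_on (c e) {0..1}"
      "\<And>e. e \<in> E \<Longrightarrow> {c e 0, c e 1} = \<pi> ` e" "\<And>e. e \<in> E \<Longrightarrow> edge_interior c e \<inter> \<pi> ` V = {}"
    and cross: "\<And>e f. e \<in> E \<Longrightarrow> f \<in> E \<Longrightarrow> e \<noteq> f \<Longrightarrow> finite (edge_interior c e \<inter> edge_interior c f)"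
    and three: "\<And>e f g. e \<in> E \<Longrightarrow> f \<in> E \<Longrightarrow> g \<in> E \<Longrightarrow> e \<noteq> f \<Longrightarrow> f \<noteq> g \<Longrightarrow> e \<noteq> g \<Longrightarrow>
        edge_interior c e \<inter> edge_interior c f \<inter> edge_interior c g = {}"
    using dr unfolding drawing_def by simp_all
  have cX: "c e ` {0..1} \<subseteq> topspace X" if "e \<in> E" for e
    using c(1)[OF that] unfolding pathin_def continuous_map_def by auto
  have int_X: "edge_interior c e \<subseteq> topspace X" if "e \<in> E" for e
    using cX[OF that] unfolding edge_interior_def by (auto simp: image_subset_iff)
  let ?c = "\<lambda>e t. h (c e t)"
  have int: "edge_interior ?c e = h ` edge_interior c e" for e
    unfolding edge_interior_def by (simp add: image_image)
  have int2: "edge_interior ?c e \<inter> edge_interior ?c f = h ` (edge_interior c e \<inter> edge_interior c f)"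
    if "e \<in> E" "f \<in> E" for e f
    unfolding int using inj_on_image_Int[OF hinj int_X int_X] that by metis
  show ?thesis
  proof
    show "simple_graph V E" by (rule graph)
    show "inj_on (\<lambda>v. h (\<pi> v)) V"
      using comp_inj_on[OF \<pi>(1) inj_on_subset[OF hinj \<pi>(2)]] by (simp add: comp_def)
    show "(\<lambda>v. h (\<pi> v)) ` V \<subseteq> K" using \<pi>(2) hX by auto
    fix e assume e: "e \<in> E"
    have "continuous_map (top_of_set {0..1}) (top_of_set K) (h \<circ> c e)"
      using c(1)[OF e] hcont unfolding pathin_def by (rule continuous_map_compose)
    then show "continuous_on {0..1} (?c e)"
      by (simp add: comp_def)
    show "?c e ` {0..1} \<subseteq> K" using cX[OF e] hX by auto
    show "inj_on (?c e) {0..1}"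
      using comp_inj_on[OF c(2)[OF e] inj_on_subset[OF hinj cX[OF e]]] by (simp add: comp_def)
    have "{?c e 0, ?c e 1} = h ` {c e 0, c e 1}" by simp
    also have "\<dots> = (\<lambda>v. h (\<pi> v)) ` e" unfolding c(3)[OF e] by (simp add: image_image)
    finally show "{?c e 0, ?c e 1} = (\<lambda>v. h (\<pi> v)) ` e" .
    have "h ` edge_interior c e \<inter> h ` (\<pi> ` V) = {}"
      using inj_on_image_Int[OF hinj int_X[OF e] \<pi>(2)] c(4)[OF e] by simp
    then show "edge_interior ?c e \<inter> (\<lambda>v. h (\<pi> v)) ` V = {}" unfolding int by (simp add: image_image)
    show "finite (edge_interior ?c e \<inter> edge_interior ?c f)" if "f \<in> E" "e \<noteq> f" for f
      unfolding int2[OF e that(1)] using cross[OF e that] by simp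
    show "edge_interior ?c e \<inter> edge_interior ?c f \<inter> edge_interior ?c g = {}"
      if "f \<in> E" "g \<in> E" "e \<noteq> f" "f \<noteq> g" "e \<noteq> g" for f g
    proof -
      have "edge_interior ?c e \<inter> edge_interior ?c f \<inter> edge_interior ?c g =
        h ` (edge_interior c e \<inter> edge_interior c f) \<inter> h ` edge_interior c g"
        unfolding int2[OF e that(1)] unfolding int ..
      also have "\<dots> = h ` (edge_interior c e \<inter> edge_interior c f \<inter> edge_interior c g)"
        by (rule inj_on_image_Int[OF hinj, symmetric]) (use int_X e that in blast)+
      finally show ?thesis using three[OF e that] by simp
    qed
    have finE: "finite E"
      by (rule finite_subset[of _ "Pow V"]) (use graph in \<open>auto simp: simple_graph_def\<close>)
    have fin: "finite (crossings E c e)"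
      unfolding crossings_def using finE cross[OF e] by (intro finite_SigmaI) auto
    have "crossings E ?c e \<subseteq> (\<lambda>(f, x). (f, h x)) ` crossings E c e"
    proof
      fix z assume z: "z \<in> crossings E ?c e"
      obtain f y where zf: "z = (f, y)" by (metis prod.exhaust)
      have f: "f \<in> E" "f \<noteq> e" "y \<in> edge_interior ?c e \<inter> edge_interior ?c f"
        using z unfolding zf crossings_def by auto
      then obtain x where "y = h x" "x \<in> edge_interior c e \<inter> edge_interior c f"
        unfolding int2[OF e f(1)] by blast
      then show "z \<in> (\<lambda>(f, x). (f, h x)) ` crossings E c e"
        using f unfolding zf crossings_def by (intro image_eqI[of _ _ "(f, x)"]) auto
    qed
    then have "card (crossings E ?c e) \<le> card (crossings E c e)"
      using fin by (meson card_image_le card_mono finite_imageI order_trans)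
    then show "card (crossings E ?c e) \<le> k" using few[OF e] by linarith
  qed
qed

lemma cops_win_mono: "cops_win V E r m \<Longrightarrow> m \<le> n \<Longrightarrow> cops_win V E r n"
  unfolding cops_win_def by (meson order_trans)

theorem theorem6:
  fixes V :: "'a set" and E :: "'a set set" and g k r :: nat
  assumes "g \<ge> 1" and "k \<ge> 1" and "r \<ge> 1"
    and "simple_graph V E"
    and "gk_planar TYPE('p) g k V E"
  shows "cop_width V E r \<le> (4 * g + 6) * (k + 1) * (8 * r + 1)"
proof -
  obtain X :: "'p topology" and \<gamma> \<pi> c where X: "closed_surface X" "has_euler_genus X \<gamma>" "\<gamma> \<le> g"
    "drawing X V E \<pi> c" "\<forall>e\<in>E. card (crossings E c e) \<le> k"
    using assms(5) unfolding gk_planar_def by blast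
  obtain K :: "(real^5) set set" where K: "simplicial_complex K" "X homeomorphic_space top_of_set (\<Union>K)"
    "int \<gamma> = 2 - euler_char_2 K"
    using X(2) unfolding has_euler_genus_def by blast
  obtain h where h: "homeomorphic_map X (top_of_set (\<Union>K)) h"
    using K(2) unfolding homeomorphic_space by blast
  obtain T :: "(real^5) set set" and p \<beta> \<delta> where T: "tri_cover T p \<beta> (\<Union>K) \<delta>" "euler T = euler_char_2 K"
    using closed_surface_tri_cover[OF X(1) K(1) h] by blast
  interpret drawn_graph "\<Union>K" V E "\<lambda>v. h (\<pi> v)" "\<lambda>e t. h (c e t)" k
    by (rule drawn_graph_homeomorphic_image[OF assms(4) h X(4)]) (use X(5) in blast)
  have "cops_win V E r (2 * ((2 * g + 3) * (4 * r * (k + 1) + 1)))"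
  proof (rule cops_win_drawn)
    show "\<forall>\<epsilon>>0. \<exists>(T' :: nat set set) p \<beta>. tri_cover T' p \<beta> (\<Union>K) \<epsilon> \<and> euler T' = euler T"
      using tri_cover_fine[OF T(1)] by blast
    show "2 - int g \<le> euler T" using T(2) K(3) X(3) by linarith
  qed
  \<comment> \<open>\<open>2 * (2 * g + 3)\<close> is \<open>4 * g + 6\<close>, and
    \<open>(k + 1) * (8 * r + 1)\<close> exceeds the window term \<open>4 * r * (k + 1) + 1\<close>
    by \<open>4 * r * (k + 1) + k\<close>.\<close>
  moreover have "2 * ((2 * g + 3) * (4 * r * (k + 1) + 1)) \<le> (4 * g + 6) * (k + 1) * (8 * r + 1)"
  proof -
    have "4 * r * (k + 1) + 1 \<le> (k + 1) * (8 * r + 1)" by (simp add: algebra_simps)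
    then have "(4 * g + 6) * (4 * r * (k + 1) + 1) \<le> (4 * g + 6) * ((k + 1) * (8 * r + 1))"
      by (rule mult_le_mono2)
    then show ?thesis by (simp add: algebra_simps)
  qed
  ultimately have "cops_win V E r ((4 * g + 6) * (k + 1) * (8 * r + 1))" by (rule cops_win_mono)
  then show ?thesis unfolding cop_width_def by (intro Least_le) simp
qed

end
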